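(* Let $K$ be an algebraically closed field of characteristic zero, let $\Phi=(f_1,f_2,f_3)$ be a polynomial automorphism of $K^3$, let $\deg_1$ be the standard homogeneous degree on $K[x_1,x_2,x_3]$, let $d_i=\deg_1(f_i)$, and assume $d_1\le d_2\le d_3$. Let $\deg_2$ be the weighted degree assigning weight $d_i$ to $x_i$. Let $I=\{P : P(\overline{f_1},\overline{f_2},\overline{f_3})=0\}$, where $\overline{f_i}$ is the homogeneous component of highest degree of $f_i$, and assume $I=(R)$ is principal. Then there exists a $\deg_2$-homogeneous polynomial $h(x_1,x_2)$ (possibly zero) whose $\deg_2$ equals $d_3$ or $-\infty$ such that, setting $x_3'=x_3+h(x_1,x_2)$, $R$ is a nonzero scalar multiple of (or, in the first case, equal to) one of the following: (1) $0$; (2) $x_3'$; (3) $x_1^{e_1}+cx_2^{e_2}$ with $c\in K^*$, $\gcd(e_1,e_2)=1$; (4) $(x_2+ax_1^{e_1})x_3'+cx_1^k$ with $c\in K^*$, $a\in K$, $k\ge 2$, $e_1\ge 1$; (5) $x_1^kx_3'+P(x_1,x_2)$ with $k\ge 1$ and $P$ $\deg_2$-homogeneous; (6) ${x_3'}^2+cx_2^3$ with $c\in K^*$; (7) ${x_3'}^2+cx_1x_2^2$ with $c\in K^*$; (8) ${x_3'}^2+cx_1^{r_1}$ with $c\in K^*$, $r_1\in 3+2\mathbb{N}$; (9) ${x_3'}^2+cx_1^{r_1}x_2$ with $c\in K^*$, $r_1\ge 1$; (10) ${x_3'}^2+ax_1^{e_1}+bx_2^2$ with $ab\ne 0$, $e_1\in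 3+2\mathbb{N}$; (11) ${x_3'}^2+(ax_1^{e_1}+bx_2)x_1^{r_1}$ with $ab\ne 0$, $e_1\ge 1$; (12) ${x_3'}^2+(a_1x_1^{e_1}+b_1x_2)(a_2x_1^{e_1}+b_2x_2)$ with $a_1b_2-b_1a_2\ne 0$, $e_1\ge 1$; (13) ${x_3'}^2+(a_1x_1+b_1x_2)(a_2x_1+b_2x_2)^2$ with $(a_i,b_i)\ne(0,0)$ for $i=1,2$; (14) ${x_3'}^2+(ax_1^{e_1}+bx_2)^2x_1$ with $ab\ne 0$, $e_1\ge 2$.
   Context: $\mathbb{N}=\{0,1,2,\dots\}$; $\deg_2(0)=-\infty$. *)

theory Defs
  imports "HOL-Library.Poly_Mapping" "HOL-Library.Product_Plus" "HOL-Computational_Algebra.Polynomial"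
begin

text \<open>Polynomials in K[x1,x2,x3]: a monomial x1^a x2^b x3^c is the exponent triple (a,b,c);
a polynomial is a finitely supported map from exponent triples to coefficients.
Multiplication is the convolution product of Poly_Mapping.\<close>

type_synonym 'a mpoly3 = "(nat \<times> nat \<times> nat) \<Rightarrow>\<^sub>0 'a"

definition C3 :: "'a::zero \<Rightarrow> 'a mpoly3" where
  "C3 c = Poly_Mapping.single (0,0,0) c"

definition X1 :: "'a::{zero,one} mpoly3" where "X1 = Poly_Mapping.single (1,0,0) 1"
definition X2 :: "'a::{zero,one} mpoly3" where "X2 = Poly_Mapping.single (0,1,0) 1"
definition X3 :: "'a::{zero,one} mpoly3" where "X3 = Poly_Mapping.single (0,0,1) 1"

definition subst3 :: "'a::comm_ring_1 mpoly3 \<Rightarrow> 'a mpoly3 \<Rightarrow> 'a mpoly3 \<Rightarrow> 'a mpoly3 \<Rightarrow> 'a mpoly3" where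
  "subst3 P g1 g2 g3 =
     (\<Sum>m\<in>Poly_Mapping.keys P. case m of (a,b,c) \<Rightarrow> C3 (Poly_Mapping.lookup P m) * g1 ^ a * g2 ^ b * g3 ^ c)"

definition poly_automorphism3 :: "'a::comm_ring_1 mpoly3 \<Rightarrow> 'a mpoly3 \<Rightarrow> 'a mpoly3 \<Rightarrow> bool" where
  "poly_automorphism3 f1 f2 f3 \<longleftrightarrow>
     (\<exists>g1 g2 g3.
        subst3 g1 f1 f2 f3 = X1 \<and> subst3 g2 f1 f2 f3 = X2 \<and> subst3 g3 f1 f2 f3 = X3 \<and>
        subst3 f1 g1 g2 g3 = X1 \<and> subst3 f2 g1 g2 g3 = X2 \<and> subst3 f3 g1 g2 g3 = X3)"

definition wdeg_mono :: "nat \<times> nat \<times> nat \<Rightarrow> nat \<times> nat \<times> nat \<Rightarrow> nat" where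
  "wdeg_mono w m = (case w of (w1,w2,w3) \<Rightarrow> case m of (a,b,c) \<Rightarrow> w1*a + w2*b + w3*c)"

text \<open>Standard degree deg_1 (for nonzero polynomials; deg_1 0 = -\<infinity> is never used here).\<close>
definition deg1 :: "'a::zero mpoly3 \<Rightarrow> nat" where
  "deg1 p = Max (wdeg_mono (1,1,1) ` Poly_Mapping.keys p)"

definition top_comp :: "'a::comm_monoid_add mpoly3 \<Rightarrow> 'a mpoly3" where
  "top_comp p = (\<Sum>m\<in>{m\<in>Poly_Mapping.keys p. wdeg_mono (1,1,1) m = deg1 p}. Poly_Mapping.single m (Poly_Mapping.lookup p m))"

text \<open>p is w-homogeneous of w-degree d (the zero polynomial counts, having degree -\<infinity>).\<close>
definition whomog :: "nat \<times> nat \<times> nat \<Rightarrow> nat \<Rightarrow> 'a::zero mpoly3 \<Rightarrow> bool" where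
  "whomog w d p \<longleftrightarrow> (\<forall>m\<in>Poly_Mapping.keys p. wdeg_mono w m = d)"

definition in_x1x2 :: "'a::zero mpoly3 \<Rightarrow> bool" where
  "in_x1x2 p \<longleftrightarrow> (\<forall>m\<in>Poly_Mapping.keys p. snd (snd m) = 0)"

definition alg_closed_field :: "'a::field itself \<Rightarrow> bool" where
  "alg_closed_field _ \<longleftrightarrow> (\<forall>p::'a poly. degree p \<ge> 1 \<longrightarrow> (\<exists>x. poly p x = 0))"

text \<open>The normal forms (1)-(14), with Y standing for x3' = x3 + h.\<close>
definition normal_form :: "nat \<times> nat \<times> nat \<Rightarrow> 'a::field mpoly3 \<Rightarrow> 'a mpoly3 \<Rightarrow> bool" where
  "normal_form w Y F \<longleftrightarrow>
     F = 0
   \<or> F = Y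
   \<or> (\<exists>c e1 e2. c \<noteq> 0 \<and> gcd e1 e2 = 1 \<and> F = X1 ^ e1 + C3 c * X2 ^ e2)
   \<or> (\<exists>c a k e1. c \<noteq> 0 \<and> k \<ge> 2 \<and> e1 \<ge> 1 \<and> F = (X2 + C3 a * X1 ^ e1) * Y + C3 c * X1 ^ k)
   \<or> (\<exists>k P d. k \<ge> 1 \<and> in_x1x2 P \<and> whomog w d P \<and> F = X1 ^ k * Y + P)
   \<or> (\<exists>c. c \<noteq> 0 \<and> F = Y ^ 2 + C3 c * X2 ^ 3)
   \<or> (\<exists>c. c \<noteq> 0 \<and> F = Y ^ 2 + C3 c * X1 * X2 ^ 2)
   \<or> (\<exists>c n. c \<noteq> 0 \<and> F = Y ^ 2 + C3 c * X1 ^ (3 + 2 * n))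
   \<or> (\<exists>c r1. c \<noteq> 0 \<and> r1 \<ge> 1 \<and> F = Y ^ 2 + C3 c * X1 ^ r1 * X2)
   \<or> (\<exists>a b n. a * b \<noteq> 0 \<and> F = Y ^ 2 + C3 a * X1 ^ (3 + 2 * n) + C3 b * X2 ^ 2)
   \<or> (\<exists>a b e1 r1. a * b \<noteq> 0 \<and> e1 \<ge> 1 \<and> F = Y ^ 2 + (C3 a * X1 ^ e1 + C3 b * X2) * X1 ^ r1)
   \<or> (\<exists>a1 b1 a2 b2 e1. a1 * b2 - b1 * a2 \<noteq> 0 \<and> e1 \<ge> 1 \<and>
        F = Y ^ 2 + (C3 a1 * X1 ^ e1 + C3 b1 * X2) * (C3 a2 * X1 ^ e1 + C3 b2 * X2))
   \<or> (\<exists>a1 b1 a2 b2. (a1, b1) \<noteq> (0, 0) \<and> (a2, b2) \<noteq> (0, 0) \<and>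
        F = Y ^ 2 + (C3 a1 * X1 + C3 b1 * X2) * (C3 a2 * X1 + C3 b2 * X2) ^ 2)
   \<or> (\<exists>a b e1. a * b \<noteq> 0 \<and> e1 \<ge> 2 \<and> F = Y ^ 2 + (C3 a * X1 ^ e1 + C3 b * X2) ^ 2 * X1)"

end

theory Submission
  imports Defs "HOL-Library.Product_Lexorder"
begin

text \<open>
  Let \<open>\<psi>\<close> be the substitution of the leading forms, so that \<open>I\<close> is its kernel, a prime ideal, and \<open>R\<close>
  is \<open>deg\<^sub>2\<close>-homogeneous of some degree \<open>N\<close>. Two facts restrict \<open>R\<close>.

  First, \<open>N < d1 + d2 + d3\<close>. The Jacobian formula shows that substituting the automorphism into a
  polynomial whose leading form is \<open>R\<^sup>m Q\<close>, with \<open>Q\<close> outside \<open>I\<close>, lowers the degree by at most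
  \<open>m (d1 + d2 + d3 - 3)\<close>; if \<open>N\<close> were large, the components of the inverse automorphism, which
  must drop to degree one, could not exist.

  Second, the surface \<open>R = 0\<close> is not rigid. The leading part of the derivation
  \<open>\<partial>/\<partial>x\<^sub>j\<close> transported by the automorphism is locally nilpotent and preserves \<open>I\<close>; divided by
  the largest possible power of \<open>R\<close> it is a homogeneous locally nilpotent derivation that kills \<open>R\<close>
  and is nonzero modulo \<open>R\<close>. Its flow gives a nonconstant polynomial curve on \<open>R = 0\<close> along which
  some homogeneous function of positive degree is a nonzero constant.

  By the degree bound \<open>R\<close> has degree at most two in \<open>x3\<close>. Degrees zero and one give
  the forms (2)-(5). In degree two one completes the square, \<open>R = x3'\<^sup>2 + B(x1,x2)\<close>, where the bound
  leaves the listed forms together with the singularities of type \<open>D\<close>, \<open>E\<^sub>6\<close>, \<open>E\<^sub>7\<close>, \<open>E\<^sub>8\<close>. The latter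
  are excluded by the curve: the homogeneous function splits into factors that are constant
  along it, which reduces the equation to \<open>y\<^sup>k = g(z)\<close> with \<open>g\<close> squarefree, and this has no
  nonconstant polynomial solutions.
\<close>

subsection \<open>Polynomials in three variables\<close>

text \<open>A polynomial curve alone excludes nothing: the weights are positive, so through each
  point (a, b, c) of the surface runs the curve \<open>(a T^d1, b T^d2, c T^d3)\<close>, which
  passes through the origin. The remaining singularities are contradicted by the homogeneous
  function that is a nonzero constant along the curve. It keeps the curve away from the origin, and
  since the units of \<open>K[T]\<close> are the nonzero constants, every factor of its restriction
  is constant too. Such factors exist because the weights of these surfaces fix the exponent of one
  variable modulo its power in the equation; eliminating that power leaves a binary form, which
  splits over an algebraically closed field.

  In the degree bound, the 3 counts the differentiations in a Jacobian determinant. If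
  \<open>N\<close> were at least \<open>d1 + d2 + d3\<close>, each factor \<open>R\<close> in a
  leading form would leave a surplus of at least 3, but the components of the inverse must come down
  to degree 1.\<close>

abbreviation "lookup \<equiv> Poly_Mapping.lookup"
abbreviation "keys \<equiv> Poly_Mapping.keys"
abbreviation "single \<equiv> Poly_Mapping.single"

text \<open>Together with the lexicographic order this makes the exponent triples a linearly ordered
  cancellative monoid, so that \<open>mpoly3\<close> over a domain has no zero divisors.\<close>

instance prod :: (ordered_cancel_comm_monoid_add, ordered_cancel_comm_monoid_add)
  ordered_cancel_comm_monoid_add
proof
  fix a b c :: "'a \<times> 'b"
  assume "a \<le> b"
  then show "c + a \<le> c + b"
    by (auto simp: less_eq_prod_def add_strict_left_mono add_left_mono)
qed

definition rhom :: "('a::comm_ring_1 \<Rightarrow> 'b::comm_ring_1) \<Rightarrow> bool" where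
  "rhom \<kappa> \<longleftrightarrow> \<kappa> 1 = 1 \<and> (\<forall>a b. \<kappa> (a + b) = \<kappa> a + \<kappa> b) \<and> (\<forall>a b. \<kappa> (a * b) = \<kappa> a * \<kappa> b)"

lemma rhomD:
  assumes "rhom \<kappa>"
  shows "\<kappa> 1 = 1" "\<kappa> (a + b) = \<kappa> a + \<kappa> b" "\<kappa> (a * b) = \<kappa> a * \<kappa> b" "\<kappa> 0 = 0" "\<kappa> (- a) = - \<kappa> a"
    "\<kappa> (a - b) = \<kappa> a - \<kappa> b" "\<kappa> (a ^ n) = \<kappa> a ^ n"
proof -
  have 0: "\<kappa> 1 = 1" "\<And>a b. \<kappa> (a + b) = \<kappa> a + \<kappa> b" "\<And>a b. \<kappa> (a * b) = \<kappa> a * \<kappa> b"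
    using assms by (auto simp: rhom_def)
  have z: "\<kappa> 0 = 0" using 0(2)[of 0 0] by simp
  have u: "\<kappa> (- a) = - \<kappa> a" for a
    using 0(2)[of a "- a"] z by (simp add: minus_unique)
  show "\<kappa> 1 = 1" "\<kappa> (a + b) = \<kappa> a + \<kappa> b" "\<kappa> (a * b) = \<kappa> a * \<kappa> b" "\<kappa> 0 = 0" "\<kappa> (- a) = - \<kappa> a"
    using 0 z u by auto
  show "\<kappa> (a - b) = \<kappa> a - \<kappa> b" using 0(2)[of a "- b"] u[of b] by simp
  show "\<kappa> (a ^ n) = \<kappa> a ^ n" by (induction n) (auto simp: 0)
qed

lemma rhom_sum: "rhom \<kappa> \<Longrightarrow> \<kappa> (sum f A) = (\<Sum>a\<in>A. \<kappa> (f a))"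
  by (induction A rule: infinite_finite_induct) (auto simp: rhomD)

lemma rhom_comp: "rhom F \<Longrightarrow> rhom G \<Longrightarrow> rhom (\<lambda>x. F (G x))"
  by (auto simp: rhom_def)

lemma rhom_C3: "rhom C3"
  by (simp add: rhom_def C3_def single_add mult_single flip: zero_prod_def)

lemmas C3_simps = rhomD(1,4)[OF rhom_C3]
lemmas C3_add = rhomD(2)[OF rhom_C3]
lemmas C3_mult = rhomD(3)[OF rhom_C3]
lemmas C3_uminus = rhomD(5)[OF rhom_C3]
lemmas C3_diff = rhomD(6)[OF rhom_C3]
lemmas C3_power = rhomD(7)[OF rhom_C3]

lemma lookup_C3: "lookup (C3 c) m = (if m = (0,0,0) then c else 0)"
  by (auto simp: C3_def lookup_single when_def)

lemma C3_inject [simp]: "C3 a = C3 b \<longleftrightarrow> a = b"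
  by (auto dest: arg_cong[of _ _ "\<lambda>p. lookup p (0,0,0)"] simp: lookup_C3)

lemma C3_eq_0 [simp]: "C3 (a::'a::comm_ring_1) = 0 \<longleftrightarrow> a = 0"
  using C3_inject[of a 0] by (simp only: C3_simps)

lemma C3_inverse: "c \<noteq> 0 \<Longrightarrow> C3 (c::'a::field) * C3 (inverse c) = 1"
  by (simp add: C3_simps flip: C3_mult)

lemma X_power:
  "(X1::'a::comm_ring_1 mpoly3) ^ n = single (n,0,0) 1"
  "(X2::'a mpoly3) ^ n = single (0,n,0) 1"
  "(X3::'a mpoly3) ^ n = single (0,0,n) 1"
  by (induction n) (auto simp: X1_def X2_def X3_def mult_single simp flip: zero_prod_def)

lemma single_eq_monomial:
  "single (a,b,c) (q::'a::comm_ring_1) = C3 q * X1 ^ a * X2 ^ b * X3 ^ c"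
  by (simp add: X_power C3_def mult_single)

lemma mpoly3_expand:
  "(P::'a::comm_ring_1 mpoly3) = (\<Sum>m\<in>keys P. single m (lookup P m))"
  by (rule poly_mapping_eqI)
     (simp add: lookup_sum lookup_single when_def in_keys_iff)

lemma mpoly3_induct [case_names C X1 X2 X3 add mult]:
  fixes P :: "'a::comm_ring_1 mpoly3"
  assumes C: "\<And>c. Q (C3 c)" and X: "Q X1" "Q X2" "Q X3"
    and add: "\<And>p q. Q p \<Longrightarrow> Q q \<Longrightarrow> Q (p + q)" and mult: "\<And>p q. Q p \<Longrightarrow> Q q \<Longrightarrow> Q (p * q)"
  shows "Q P"
proof -
  have pw: "Q p \<Longrightarrow> Q (p ^ n)" for p n
    using C[of 1] by (induction n) (auto simp: C3_simps mult)
  have s: "Q (single m q)" for m q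
    by (cases m) (auto simp: single_eq_monomial intro!: mult pw C X)
  have "Q (\<Sum>m\<in>A. single m (g m))" if "finite A" for A g
    using that C[of 0] by (induction A) (auto simp: C3_simps add s)
  from this[of "keys P" "lookup P"] show ?thesis
    by (simp flip: mpoly3_expand)
qed

text \<open>The coefficient map is a parameter because polynomials are evaluated in four targets:
  \<open>mpoly3\<close> itself via \<open>C3\<close>, \<open>K[T]\<close>, \<open>K\<close>, and
  polynomials over \<open>mpoly3\<close> for derivations.\<close>

definition ev :: "('a::comm_ring_1 \<Rightarrow> 'b::comm_ring_1) \<Rightarrow> 'a mpoly3 \<Rightarrow> 'b \<Rightarrow> 'b \<Rightarrow> 'b \<Rightarrow> 'b" where
  "ev \<kappa> P x y z = (\<Sum>m\<in>keys P. case m of (a,b,c) \<Rightarrow> \<kappa> (lookup P m) * x ^ a * y ^ b * z ^ c)"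

lemma subst3_eq_ev: "subst3 P f g h = ev C3 P f g h"
  by (simp add: subst3_def ev_def)

lemma ev_superset:
  assumes "rhom \<kappa>" "finite S" "keys P \<subseteq> S"
  shows "ev \<kappa> P x y z = (\<Sum>m\<in>S. case m of (a,b,c) \<Rightarrow> \<kappa> (lookup P m) * x ^ a * y ^ b * z ^ c)"
  unfolding ev_def
  by (rule sum.mono_neutral_left) (use assms in \<open>auto simp: in_keys_iff rhomD\<close>)

lemma ev_add:
  assumes "rhom \<kappa>"
  shows "ev \<kappa> (P + Q) x y z = ev \<kappa> P x y z + ev \<kappa> Q x y z"
proof -
  let ?S = "keys P \<union> keys Q"
  have "keys (P + Q) \<subseteq> ?S" by (rule keys_add)
  then show ?thesis
    by (simp add: ev_superset[OF assms, of ?S] lookup_add rhomD[OF assms] case_prod_unfold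
        algebra_simps flip: sum.distrib)
qed

lemma ev_zero [simp]: "ev \<kappa> 0 x y z = 0"
  by (simp add: ev_def)

lemma ev_single:
  assumes "rhom \<kappa>"
  shows "ev \<kappa> (single (a,b,c) q) x y z = \<kappa> q * x ^ a * y ^ b * z ^ c"
  using ev_superset[OF assms, of "{(a,b,c)}" "single (a,b,c) q"]
  by (cases "q = 0") auto

lemma ev_sum: "rhom \<kappa> \<Longrightarrow> ev \<kappa> (sum F A) x y z = (\<Sum>a\<in>A. ev \<kappa> (F a) x y z)"
  by (induction A rule: infinite_finite_induct) (auto simp: ev_add)

lemma ev_mult:
  assumes "rhom \<kappa>"
  shows "ev \<kappa> (P * Q) x y z = ev \<kappa> P x y z * ev \<kappa> Q x y z"
proof -
  have s: "ev \<kappa> (single m p * single n q) x y z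
      = ev \<kappa> (single m p) x y z * ev \<kappa> (single n q) x y z" for m n p q
    by (cases m; cases n)
       (simp add: mult_single ev_single[OF assms] rhomD[OF assms] power_add algebra_simps)
  have "ev \<kappa> ((\<Sum>m\<in>A. single m (g m)) * (\<Sum>m\<in>B. single m (h m))) x y z
     = ev \<kappa> (\<Sum>m\<in>A. single m (g m)) x y z * ev \<kappa> (\<Sum>m\<in>B. single m (h m)) x y z"
    for A B g h
    by (simp add: sum_product ev_sum[OF assms] s)
  from this[of "lookup P" "keys P" "lookup Q" "keys Q"]
  show ?thesis by (simp flip: mpoly3_expand)
qed

lemma rhom_ev:
  assumes "rhom \<kappa>" shows "rhom (\<lambda>P. ev \<kappa> P x y z)"
proof -
  have "ev \<kappa> 1 x y z = 1"
    using ev_single[OF assms, of 0 0 0 1] by (simp add: rhomD[OF assms] flip: zero_prod_def)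
  then show ?thesis by (simp add: rhom_def ev_add[OF assms] ev_mult[OF assms])
qed

lemma ev_basic [simp]:
  assumes "rhom \<kappa>"
  shows "ev \<kappa> (C3 c) x y z = \<kappa> c" "ev \<kappa> X1 x y z = x" "ev \<kappa> X2 x y z = y" "ev \<kappa> X3 x y z = z"
  using ev_single[OF assms] by (auto simp: C3_def X1_def X2_def X3_def rhomD[OF assms])

lemmas ev_simps = rhomD[OF rhom_ev] rhom_sum[OF rhom_ev]

lemma rhom_eqI:
  assumes "rhom F" "rhom G" "\<And>c. F (C3 c) = G (C3 c)" "F X1 = G X1" "F X2 = G X2" "F X3 = G X3"
  shows "F P = G P"
  by (induction P rule: mpoly3_induct) (use assms in \<open>auto simp: rhom_def\<close>)

text \<open>Universal property of the polynomial ring, from which the composition law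
  \<open>ev_ev\<close> follows.\<close>

lemma rhom_eq_ev:
  assumes "rhom F"
  shows "F P = ev (\<lambda>c. F (C3 c)) P (F X1) (F X2) (F X3)"
proof -
  have k: "rhom (\<lambda>c. F (C3 c))" using rhom_comp[OF assms rhom_C3] .
  show ?thesis by (rule rhom_eqI[OF assms rhom_ev[OF k]]) (simp_all add: k)
qed

lemma ev_ev:
  assumes "rhom \<kappa>"
  shows "ev \<kappa> (ev C3 P f g h) x y z = ev \<kappa> P (ev \<kappa> f x y z) (ev \<kappa> g x y z) (ev \<kappa> h x y z)"
  by (subst rhom_eq_ev[OF rhom_comp[OF rhom_ev[OF assms] rhom_ev[OF rhom_C3]]])
     (simp add: assms rhom_C3)

lemma ev_X_id: "ev C3 P X1 X2 X3 = P"
proof (rule rhom_eqI[OF rhom_ev[OF rhom_C3], of "\<lambda>x. x"])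
  show "rhom (\<lambda>x::'a mpoly3. x)" by (simp add: rhom_def)
qed (simp_all add: rhom_C3)

subsection \<open>Weighted degrees\<close>

text \<open>Bounded degree and homogeneity are both conditions on the degrees that occur, so one
  predicate serves both. Degrees are integers since derivations may push them below zero; 0
  satisfies every condition, which replaces the degree -infinity.\<close>

definition wset :: "nat \<times> nat \<times> nat \<Rightarrow> int set \<Rightarrow> 'a::zero mpoly3 \<Rightarrow> bool" where
  "wset w T P \<longleftrightarrow> (\<forall>m\<in>keys P. int (wdeg_mono w m) \<in> T)"

abbreviation wle :: "nat \<times> nat \<times> nat \<Rightarrow> int \<Rightarrow> 'a::zero mpoly3 \<Rightarrow> bool" where
  "wle w n \<equiv> wset w {..n}"

abbreviation whom :: "nat \<times> nat \<times> nat \<Rightarrow> int \<Rightarrow> 'a::zero mpoly3 \<Rightarrow> bool" where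
  "whom w n \<equiv> wset w {n}"

lemma whomog_iff: "whomog w d P \<longleftrightarrow> whom w (int d) P"
  by (auto simp: whomog_def wset_def)

lemma wset_mono: "wset w S P \<Longrightarrow> S \<subseteq> T \<Longrightarrow> wset w T P"
  by (auto simp: wset_def)

lemma wset_zero [simp]: "wset w T 0"
  by (simp add: wset_def)

lemma wset_add: "wset w T P \<Longrightarrow> wset w T Q \<Longrightarrow> wset w T (P + Q)"
  using keys_add[of P Q] by (auto simp: wset_def)

lemma wset_uminus [simp]: "wset w T (- P :: 'a::ab_group_add mpoly3) \<longleftrightarrow> wset w T P"
  by (simp add: wset_def in_keys_iff)

lemma wset_diff: "wset w T P \<Longrightarrow> wset w T Q \<Longrightarrow> wset w T (P - Q :: 'a::ab_group_add mpoly3)"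
  using wset_add[of w T P "- Q"] by simp

lemma wset_sum: "(\<And>a. a \<in> A \<Longrightarrow> wset w T (F a)) \<Longrightarrow> wset w T (sum F A)"
  by (induction A rule: infinite_finite_induct) (auto simp: wset_add)

lemma wdeg_mono_add: "wdeg_mono w (m + n) = wdeg_mono w m + wdeg_mono w n"
  by (cases w; cases m; cases n) (simp add: wdeg_mono_def algebra_simps)

lemma wset_mult:
  assumes "wset w S P" "wset w T Q" "\<And>s t. s \<in> S \<Longrightarrow> t \<in> T \<Longrightarrow> s + t \<in> U"
  shows "wset w U (P * Q)"
  unfolding wset_def
proof
  fix m assume "m \<in> keys (P * Q)"
  then obtain a b where "a \<in> keys P" "b \<in> keys Q" "m = a + b"
    using keys_mult[of P Q] by blast
  then show "int (wdeg_mono w m) \<in> U"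
    using assms by (auto simp: wset_def wdeg_mono_add)
qed

lemma wset_single: "wset w T (single m c) \<longleftrightarrow> c = 0 \<or> int (wdeg_mono w m) \<in> T"
  by (simp add: wset_def)

lemma wset_C3: "wset w T (C3 c) \<longleftrightarrow> c = 0 \<or> 0 \<in> T"
  by (cases w) (simp add: C3_def wset_single wdeg_mono_def)

lemma wset_one: "0 \<in> T \<Longrightarrow> wset w T (1::'a::comm_ring_1 mpoly3)"
  using wset_C3[of w T "1::'a"] by (simp add: C3_simps)

lemma wset_X:
  "wset (w1,w2,w3) T (X1::'a::comm_ring_1 mpoly3) \<longleftrightarrow> int w1 \<in> T"
  "wset (w1,w2,w3) T (X2::'a mpoly3) \<longleftrightarrow> int w2 \<in> T"
  "wset (w1,w2,w3) T (X3::'a mpoly3) \<longleftrightarrow> int w3 \<in> T"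
  by (simp_all add: X1_def X2_def X3_def wset_single wdeg_mono_def)

lemma whom_mult: "whom w n P \<Longrightarrow> whom w k Q \<Longrightarrow> n + k = l \<Longrightarrow> whom w l (P * Q)"
  by (rule wset_mult) auto

lemma wle_mult: "wle w n P \<Longrightarrow> wle w k Q \<Longrightarrow> n + k \<le> l \<Longrightarrow> wle w l (P * Q)"
  by (rule wset_mult[of w "{..n}" P "{..k}" Q]) auto

lemma whom_power: "whom w n (P::'a::comm_ring_1 mpoly3) \<Longrightarrow> int k * n = l \<Longrightarrow> whom w l (P ^ k)"
proof (induction k arbitrary: l)
  case (Suc k)
  then show ?case by (auto intro!: whom_mult[OF _ Suc.IH[OF _ refl]] simp: algebra_simps)
qed (auto intro: wset_one)

lemma whom_C3_mult: "whom w n (P::'a::comm_ring_1 mpoly3) \<Longrightarrow> whom w n (C3 c * P)"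
  by (rule whom_mult[of w 0]) (auto simp: wset_C3)

lemma wset_disjoint: "wset w S P \<Longrightarrow> wset w T P \<Longrightarrow> S \<inter> T = {} \<Longrightarrow> P = 0"
  by (metis Int_iff empty_iff ex_in_conv keys_eq_empty wset_def)

lemma whom_wle: "whom w n P \<Longrightarrow> n \<le> k \<Longrightarrow> wle w k P"
  by (auto simp: wset_def)

lemma wle_mono: "wle w n P \<Longrightarrow> n \<le> k \<Longrightarrow> wle w k P"
  by (auto simp: wset_def)

lemma whom_zero: "whom w n P \<Longrightarrow> wle w k P \<Longrightarrow> k < n \<Longrightarrow> P = 0"
  by (rule wset_disjoint[of w "{n}" P "{..k}"]) simp_all

lemma whom_negative: "whom w n P \<Longrightarrow> n < 0 \<Longrightarrow> P = 0"
  by (rule wset_disjoint[of w "{n}" P "{0..}"]) (simp_all add: wset_def[of w "{0..}"])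

text \<open>\<open>Q\<close> is the component of degree \<open>n\<close> of a \<open>P\<close> of
  degree at most \<open>n\<close>. It may be 0, so cancellation of leading terms is expressed by
  \<open>top w n P 0\<close>.\<close>

definition top :: "nat \<times> nat \<times> nat \<Rightarrow> int \<Rightarrow> 'a::ab_group_add mpoly3 \<Rightarrow> 'a mpoly3 \<Rightarrow> bool" where
  "top w n P Q \<longleftrightarrow> whom w n Q \<and> wle w (n - 1) (P - Q)"

lemma topD: "top w n P Q \<Longrightarrow> whom w n Q" "top w n P Q \<Longrightarrow> wle w (n - 1) (P - Q)"
  "top w n P Q \<Longrightarrow> wle w n P"
proof -
  assume a: "top w n P Q"
  then show "whom w n Q" "wle w (n - 1) (P - Q)" by (auto simp: top_def)
  then have "wle w n (Q + (P - Q))"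
    by (intro wset_add) (auto elim: whom_wle wle_mono)
  then show "wle w n P" by simp
qed

lemma top_self: "whom w n P \<Longrightarrow> top w n P P"
  by (simp add: top_def)

lemma top_lower: "wle w (n - 1) P \<Longrightarrow> top w n P 0"
  by (simp add: top_def)

lemma top_unique:
  assumes "top w n P Q" "top w n P Q'" shows "Q = Q'"
proof -
  have "wle w (n - 1) ((P - Q) - (P - Q'))" by (intro wset_diff topD(2)[OF assms(1)] topD(2)[OF assms(2)])
  then have "wle w (n - 1) (Q' - Q)" by simp
  moreover have "whom w n (Q' - Q)"
    by (intro wset_diff topD(1)[OF assms(1)] topD(1)[OF assms(2)])
  ultimately have "Q' - Q = 0"
    using whom_zero[of w n "Q' - Q" "n - 1"] by simp
  then show ?thesis by simp
qed

lemma top_add: "top w n P P' \<Longrightarrow> top w n Q Q' \<Longrightarrow> top w n (P + Q) (P' + Q')"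
  by (auto simp: top_def add_diff_add intro!: wset_add)

lemma top_sum: "(\<And>a. a \<in> A \<Longrightarrow> top w n (F a) (G a)) \<Longrightarrow> top w n (sum F A) (sum G A)"
  by (induction A rule: infinite_finite_induct) (auto simp: top_add top_lower)

lemma top_mult:
  fixes P :: "'a::comm_ring_1 mpoly3"
  assumes "top w n P P'" "top w k Q Q'" shows "top w (n + k) (P * Q) (P' * Q')"
proof -
  have "wle w (n + k - 1) ((P - P') * Q + P' * (Q - Q'))"
    using assms[THEN topD(1)] assms[THEN topD(2)] assms[THEN topD(3)]
    by (intro wset_add wle_mult[of w "n - 1" "P - P'" k Q] wle_mult[of w n P' "k - 1" "Q - Q'"])
       (auto elim: whom_wle)
  moreover have "whom w (n + k) (P' * Q')"
    using assms[THEN topD(1)] by (auto intro: whom_mult)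
  ultimately show ?thesis by (simp add: top_def algebra_simps)
qed

lemma top_power:
  fixes P :: "'a::comm_ring_1 mpoly3"
  assumes "top w n P P'" shows "top w (int k * n) (P ^ k) (P' ^ k)"
proof (induction k)
  case (Suc k)
  then show ?case using top_mult[OF assms Suc] by (simp add: algebra_simps)
qed (auto intro!: top_self wset_one)

lemma ex_top:
  fixes P :: "'a::comm_ring_1 mpoly3"
  assumes "wle w n P"
  obtains Q where "top w n P Q"
proof
  let ?S = "{m\<in>keys P. int (wdeg_mono w m) = n}"
  let ?Q = "\<Sum>m\<in>?S. single m (lookup P m)"
  let ?R = "\<Sum>m\<in>keys P - ?S. single m (lookup P m)"
  have "P = ?Q + ?R"
    by (subst mpoly3_expand, subst sum.subset_diff[of ?S]) auto
  then have e: "P - ?Q = ?R" by (simp add: algebra_simps)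
  show "top w n P ?Q"
    unfolding top_def e
  proof (intro conjI wset_sum)
    fix m assume "m \<in> keys P - ?S"
    then have "int (wdeg_mono w m) \<le> n" "int (wdeg_mono w m) \<noteq> n"
      using assms by (auto simp: wset_def)
    then show "wle w (n - 1) (single m (lookup P m))"
      by (simp add: wset_single)
  qed (simp add: wset_single)
qed

lemma ex_top_nonzero:
  fixes P :: "'a::comm_ring_1 mpoly3"
  assumes "P \<noteq> 0"
  obtains n Q where "top w (int n) P Q" "Q \<noteq> 0"
proof -
  let ?n = "Max (wdeg_mono w ` keys P)"
  have ne: "keys P \<noteq> {}" using assms by simp
  have "wle w (int ?n) P" by (simp add: wset_def)
  then obtain Q where Q: "top w (int ?n) P Q" by (rule ex_top)
  have "?n \<in> wdeg_mono w ` keys P" using ne by (intro Max_in) auto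
  then obtain m where m: "m \<in> keys P" "wdeg_mono w m = ?n" by auto
  have "Q \<noteq> 0"
    using topD(2)[OF Q] m by (force simp: wset_def)
  with Q show ?thesis by (rule that)
qed

text \<open>Over a domain the product of leading forms is nonzero, so degrees add.\<close>

lemma wle_mult_cancel:
  fixes P :: "'a::idom mpoly3"
  assumes "top w n P P'" "P' \<noteq> 0" "wle w k (P * Q)"
  shows "wle w (k - n) Q"
proof (cases "Q = 0")
  case False
  obtain l Q' where Q: "top w (int l) Q Q'" "Q' \<noteq> 0" using ex_top_nonzero[OF False] .
  have t: "top w (n + l) (P * Q) (P' * Q')" using top_mult[OF assms(1) Q(1)] .
  have "n + l \<le> k"
  proof (rule ccontr)
    assume "\<not> n + l \<le> k"
    then have "top w (n + l) (P * Q) 0" using assms(3) by (intro top_lower) (auto elim: wle_mono)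
    with t have "P' * Q' = 0" by (rule top_unique)
    with assms(2) Q(2) show False by simp
  qed
  then show ?thesis using topD(3)[OF Q(1)] by (auto elim: wle_mono)
qed simp

lemma whom_mult_cancel:
  fixes P :: "'a::idom mpoly3"
  assumes P: "whom w n P" "P \<noteq> 0" and PQ: "whom w k (P * Q)"
  shows "whom w (k - n) Q"
proof -
  have "wle w (k - n) Q"
    using wle_mult_cancel[OF top_self[OF P(1)] P(2) whom_wle[OF PQ order_refl]] .
  then obtain Q' where Q': "top w (k - n) Q Q'" by (rule ex_top)
  have "top w k (P * Q) (P * Q')" using top_mult[OF top_self[OF P(1)] Q'] by simp
  from top_unique[OF this top_self[OF PQ]] have "Q' = Q" using P(2) by simp
  with topD(1)[OF Q'] show ?thesis by simp
qed

lemma wle_const: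
  assumes "0 < w1" "0 < w2" "0 < w3" "wle (w1,w2,w3) 0 P"
  shows "\<exists>c. P = C3 (c::'a::zero)"
proof -
  have "m = (0,0,0)" if "m \<in> keys P" for m
    using assms that by (cases m) (auto simp: wset_def wdeg_mono_def)
  then have "P = C3 (lookup P (0,0,0))"
    by (intro poly_mapping_eqI) (auto simp: C3_def lookup_single when_def in_keys_iff)
  then show ?thesis ..
qed

text \<open>The origin of the weights: with each variable weighted by the degree bound of what
  replaces it, monomials of weight below \<open>n\<close> cannot reach degree \<open>n\<close>, so
  that component is found by substituting leading forms.\<close>

lemma top_ev:
  fixes P :: "'a::comm_ring_1 mpoly3"
  assumes f: "top u (int w1) f1 h1" "top u (int w2) f2 h2" "top u (int w3) f3 h3"
    and P: "top (w1,w2,w3) n P Q"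
  shows "top u n (ev C3 P f1 f2 f3) (ev C3 Q h1 h2 h3)"
proof -
  have mono: "top u (int (wdeg_mono (w1,w2,w3) (a,b,c))) (C3 q * f1 ^ a * f2 ^ b * f3 ^ c) (C3 q * h1 ^ a * h2 ^ b * h3 ^ c)"
    for q a b c
    using top_mult[OF top_mult[OF top_mult[OF top_self[of u 0 "C3 q"] top_power[OF f(1), of a]]
          top_power[OF f(2), of b]] top_power[OF f(3), of c]]
    by (simp add: wset_C3 wdeg_mono_def algebra_simps)
  have le: "wle u k (ev C3 p f1 f2 f3)" if "wle (w1,w2,w3) k p" for k p
    unfolding ev_def
  proof (rule wset_sum)
    fix m assume "m \<in> keys p"
    with that show "wle u k (case m of (a,b,c) \<Rightarrow> C3 (lookup p m) * f1 ^ a * f2 ^ b * f3 ^ c)"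
      by (cases m) (force simp: wset_def[of "(w1,w2,w3)"] intro: wle_mono[OF topD(3)[OF mono]])
  qed
  have "top u n (ev C3 Q f1 f2 f3) (ev C3 Q h1 h2 h3)"
    unfolding ev_def
  proof (rule top_sum)
    fix m assume "m \<in> keys Q"
    with topD(1)[OF P]
    show "top u n (case m of (a,b,c) \<Rightarrow> C3 (lookup Q m) * f1 ^ a * f2 ^ b * f3 ^ c)
       (case m of (a,b,c) \<Rightarrow> C3 (lookup Q m) * h1 ^ a * h2 ^ b * h3 ^ c)"
      using mono by (cases m) (fastforce simp: wset_def)
  qed
  from top_add[OF this top_lower[OF le[OF topD(2)[OF P]]]]
  show ?thesis by (simp add: ev_simps(6)[OF rhom_C3])
qed

lemma whom_ev:
  fixes P :: "'a::comm_ring_1 mpoly3"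
  assumes "whom u (int w1) f1" "whom u (int w2) f2" "whom u (int w3) f3" "whom (w1,w2,w3) n P"
  shows "whom u n (ev C3 P f1 f2 f3)"
  using topD(1)[OF top_ev[OF assms[THEN top_self]]] .

lemma wle_ev:
  fixes P :: "'a::comm_ring_1 mpoly3"
  assumes "wle u (int w1) f1" "wle u (int w2) f2" "wle u (int w3) f3" "wle (w1,w2,w3) n P"
  shows "wle u n (ev C3 P f1 f2 f3)"
proof -
  obtain h1 h2 h3 Q where "top u (int w1) f1 h1" "top u (int w2) f2 h2" "top u (int w3) f3 h3"
    "top (w1,w2,w3) n P Q"
    using assms[THEN ex_top] by metis
  from topD(3)[OF top_ev[OF this]] show ?thesis .
qed

subsection \<open>Derivations\<close>

definition deriv3 :: "('a::comm_ring_1 mpoly3 \<Rightarrow> 'a mpoly3) \<Rightarrow> bool" where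
  "deriv3 D \<longleftrightarrow> (\<forall>P Q. D (P + Q) = D P + D Q) \<and> (\<forall>P Q. D (P * Q) = D P * Q + P * D Q) \<and> (\<forall>c. D (C3 c) = 0)"

lemma deriv3D:
  assumes "deriv3 D"
  shows "D (P + Q) = D P + D Q" "D (P * Q) = D P * Q + P * D Q" "D (C3 c) = 0" "D 0 = 0" "D 1 = 0"
    "D (- P) = - D P" "D (P - Q) = D P - D Q" "D (C3 c * P) = C3 c * D P"
    "D (P ^ n) = of_nat n * P ^ (n - 1) * D P" "D (sum F A) = (\<Sum>a\<in>A. D (F a))"
proof -
  have 0: "\<And>P Q. D (P + Q) = D P + D Q" "\<And>P Q. D (P * Q) = D P * Q + P * D Q" "\<And>c. D (C3 c) = 0"
    using assms by (auto simp: deriv3_def)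
  have z: "D 0 = 0" "D 1 = 0" using 0(3)[of 0] 0(3)[of 1] by (simp_all add: C3_simps)
  have u: "D (- P) = - D P" for P using 0(1)[of P "- P"] z by (simp add: minus_unique)
  show "D (P + Q) = D P + D Q" "D (P * Q) = D P * Q + P * D Q" "D (C3 c) = 0" "D 0 = 0" "D 1 = 0"
    "D (- P) = - D P" "D (C3 c * P) = C3 c * D P"
    using 0 z u by auto
  show "D (P - Q) = D P - D Q" using 0(1)[of P "- Q"] u[of Q] by simp
  show "D (P ^ n) = of_nat n * P ^ (n - 1) * D P"
  proof (induction n)
    case (Suc n)
    then show ?case by (cases n) (simp_all add: 0 algebra_simps)
  qed (simp add: z)
  show "D (sum F A) = (\<Sum>a\<in>A. D (F a))"
    by (induction A rule: infinite_finite_induct) (auto simp: 0 z)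
qed

text \<open>The derivation with given values on the variables, read off from the algebra morphism
  \<open>P \<mapsto> P(X + T A)\<close> modulo \<open>T\<^sup>2\<close>.\<close>
definition der :: "'a::comm_ring_1 mpoly3 \<Rightarrow> 'a mpoly3 \<Rightarrow> 'a mpoly3 \<Rightarrow> 'a mpoly3 \<Rightarrow> 'a mpoly3" where
  "der A1 A2 A3 P = coeff (ev (\<lambda>c. [:C3 c:]) P [:X1, A1:] [:X2, A2:] [:X3, A3:]) 1"

lemma rhom_const_poly: "rhom (\<lambda>c. [:\<kappa> c:])" if "rhom \<kappa>"
  using that by (simp add: rhom_def pCons_one)

lemma deriv3_der: "deriv3 (der A1 A2 A3)"
  and der_X [simp]: "der A1 A2 A3 X1 = A1" "der A1 A2 A3 X2 = A2" "der A1 A2 A3 X3 = A3"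
proof -
  let ?E = "\<lambda>P. ev (\<lambda>c. [:C3 c:]) P [:X1, A1:] [:X2, A2:] [:X3, A3:]"
  note k = rhom_const_poly[OF rhom_C3]
  have "rhom (\<lambda>P. coeff (?E P) 0)"
    by (rule rhom_comp[OF _ rhom_ev[OF k]]) (simp add: rhom_def coeff_mult_0)
  then have 0: "coeff (?E P) 0 = P" for P
  proof (rule rhom_eqI)
    show "rhom (\<lambda>P::'a mpoly3. P)" by (simp add: rhom_def)
  qed (simp_all add: k)
  show "deriv3 (der A1 A2 A3)"
    unfolding deriv3_def der_def
    by (simp add: ev_add[OF k] ev_mult[OF k] coeff_mult 0 k algebra_simps)
  show "der A1 A2 A3 X1 = A1" "der A1 A2 A3 X2 = A2" "der A1 A2 A3 X3 = A3"
    by (simp_all add: der_def k)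
qed

lemmas der_simps = deriv3D[OF deriv3_der]

definition pd :: "nat \<Rightarrow> 'a::comm_ring_1 mpoly3 \<Rightarrow> 'a mpoly3" where
  "pd i = der (if i = 1 then 1 else 0) (if i = 2 then 1 else 0) (if i = 3 then 1 else 0)"

lemma deriv3_pd: "deriv3 (pd i)"
  by (simp add: pd_def deriv3_der)

lemmas pd_simps = deriv3D[OF deriv3_pd]

lemma pd_X [simp]:
  "pd i X1 = (if i = 1 then 1 else 0)" "pd i X2 = (if i = 2 then 1 else 0)" "pd i X3 = (if i = 3 then 1 else 0)"
  by (simp_all add: pd_def)

lemma chain_rule:
  assumes "deriv3 D"
  shows "D (ev C3 P f1 f2 f3)
    = ev C3 (pd 1 P) f1 f2 f3 * D f1 + ev C3 (pd 2 P) f1 f2 f3 * D f2 + ev C3 (pd 3 P) f1 f2 f3 * D f3"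
  by (induction P rule: mpoly3_induct)
     (simp_all add: ev_simps[OF rhom_C3] rhom_C3 pd_simps deriv3D[OF assms] algebra_simps)

lemma der_eq_pd: "der A1 A2 A3 P = pd 1 P * A1 + pd 2 P * A2 + pd 3 P * A3"
  using chain_rule[OF deriv3_der, of A1 A2 A3 P X1 X2 X3] by (simp add: ev_X_id)

lemma C3_of_nat: "C3 (of_nat n :: 'a::comm_ring_1) = of_nat n"
  by (induction n) (simp_all add: C3_simps C3_add)

lemma der_single:
  "der A1 A2 A3 (single (a,b,c) q) =
     single (a - 1,b,c) (of_nat a * q) * A1
   + single (a,b - 1,c) (of_nat b * q) * A2
   + single (a,b,c - 1) (of_nat c * q) * A3"
  by (simp add: single_eq_monomial der_simps C3_mult C3_of_nat algebra_simps)

lemma wset_der: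
  assumes P: "wset (w1,w2,w3) S P"
    and A: "\<And>s. s \<in> S \<Longrightarrow> wset (w1,w2,w3) {t. s - int w1 + t \<in> U} A1"
      "\<And>s. s \<in> S \<Longrightarrow> wset (w1,w2,w3) {t. s - int w2 + t \<in> U} A2"
      "\<And>s. s \<in> S \<Longrightarrow> wset (w1,w2,w3) {t. s - int w3 + t \<in> U} A3"
  shows "wset (w1,w2,w3) U (der A1 A2 A3 P)"
proof -
  let ?w = "(w1,w2,w3)"
  have "wset ?w U (der A1 A2 A3 (single m q))"
    if m: "int (wdeg_mono ?w m) \<in> S" for m q
  proof -
    obtain a b c where abc: "m = (a,b,c)" by (cases m)
    let ?s = "int (wdeg_mono ?w m)"
    have "wset ?w {?s - int w1} (single (a - 1,b,c) (of_nat a * q))"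
      "wset ?w {?s - int w2} (single (a,b - 1,c) (of_nat b * q))"
      "wset ?w {?s - int w3} (single (a,b,c - 1) (of_nat c * q))"
      subgoal by (cases a) (simp_all add: wset_single abc wdeg_mono_def algebra_simps)
      subgoal by (cases b) (simp_all add: wset_single abc wdeg_mono_def algebra_simps)
      subgoal by (cases c) (simp_all add: wset_single abc wdeg_mono_def algebra_simps)
      done
    then show ?thesis
      unfolding abc der_single
      by (intro wset_add wset_mult[OF _ A(1)[OF m]] wset_mult[OF _ A(2)[OF m]] wset_mult[OF _ A(3)[OF m]])
         (auto simp: abc)
  qed
  then have "wset ?w U (\<Sum>m\<in>keys P. der A1 A2 A3 (single m (lookup P m)))"
    using P by (intro wset_sum) (auto simp: wset_def[of _ S])
  then show ?thesis by (simp flip: der_simps(10) mpoly3_expand)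
qed

lemma whom_der:
  assumes "whom (w1,w2,w3) n P" "whom (w1,w2,w3) (int w1 + t) A1" "whom (w1,w2,w3) (int w2 + t) A2"
    "whom (w1,w2,w3) (int w3 + t) A3"
  shows "whom (w1,w2,w3) (n + t) (der A1 A2 A3 P)"
  by (rule wset_der[OF assms(1)]; rule wset_mono[OF assms(2)] wset_mono[OF assms(3)] wset_mono[OF assms(4)]; simp)

lemma wle_der:
  assumes "wle (w1,w2,w3) n P" "wle (w1,w2,w3) (int w1 + t) A1" "wle (w1,w2,w3) (int w2 + t) A2"
    "wle (w1,w2,w3) (int w3 + t) A3"
  shows "wle (w1,w2,w3) (n + t) (der A1 A2 A3 P)"
  by (rule wset_der[OF assms(1)]; rule wset_mono[OF assms(2)] wset_mono[OF assms(3)] wset_mono[OF assms(4)]; force)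

lemma top_der:
  assumes P: "top (w1,w2,w3) n P Q" and A: "top (w1,w2,w3) (int w1 + t) A1 B1"
    "top (w1,w2,w3) (int w2 + t) A2 B2" "top (w1,w2,w3) (int w3 + t) A3 B3"
  shows "top (w1,w2,w3) (n + t) (der A1 A2 A3 P) (der B1 B2 B3 Q)"
proof -
  let ?w = "(w1,w2,w3)"
  have "wle ?w ((n - 1) + t) (der A1 A2 A3 (P - Q))"
    by (rule wle_der) (use topD(2)[OF P] A[THEN topD(3)] in auto)
  moreover have "wle ?w (n + (t - 1)) (der (A1 - B1) (A2 - B2) (A3 - B3) Q)"
    by (rule wle_der) (use whom_wle[OF topD(1)[OF P]] A[THEN topD(2)] in \<open>auto simp: algebra_simps\<close>)
  ultimately have "wle ?w (n + t - 1) (der A1 A2 A3 (P - Q) + der (A1 - B1) (A2 - B2) (A3 - B3) Q)"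
    by (intro wset_add) (simp_all add: algebra_simps)
  also have "der A1 A2 A3 (P - Q) + der (A1 - B1) (A2 - B2) (A3 - B3) Q = der A1 A2 A3 P - der B1 B2 B3 Q"
    by (simp add: der_eq_pd pd_simps algebra_simps)
  finally show ?thesis
    unfolding top_def using whom_der[OF topD(1)[OF P] A[THEN topD(1)]] by simp
qed

fun wt :: "nat \<times> nat \<times> nat \<Rightarrow> nat \<Rightarrow> nat" where
  "wt (w1,w2,w3) i = (if i = 1 then w1 else if i = 2 then w2 else w3)"

lemma top_pd:
  assumes "i \<in> {1,2,3}" "top (w1,w2,w3) n P Q"
  shows "top (w1,w2,w3) (n - int (wt (w1,w2,w3) i)) (pd i P) (pd i Q)"
  using assms(1) top_der[OF assms(2), of "- int (wt (w1,w2,w3) i)"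
      "if i = 1 then 1 else 0" "if i = 1 then 1 else 0" "if i = 2 then 1 else 0" "if i = 2 then 1 else 0"
      "if i = 3 then 1 else 0" "if i = 3 then 1 else 0"]
  by (auto simp: pd_def top_self wset_one)

lemma wle_pd:
  assumes "i \<in> {1,2,3}" "wle (w1,w2,w3) n P"
  shows "wle (w1,w2,w3) (n - int (wt (w1,w2,w3) i)) (pd i P)"
  using ex_top[OF assms(2)] top_pd[OF assms(1)] topD(3) by metis

lemma euler:
  assumes "whom (w1,w2,w3) n (P::'a::comm_ring_1 mpoly3)"
  shows "of_nat w1 * X1 * pd 1 P + of_nat w2 * X2 * pd 2 P + of_nat w3 * X3 * pd 3 P = of_int n * P"
proof -
  let ?E = "der (of_nat w1 * X1) (of_nat w2 * X2) (of_nat w3 * X3) :: 'a mpoly3 \<Rightarrow> 'a mpoly3"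
  have s: "?E (single m q) = of_nat (wdeg_mono (w1,w2,w3) m) * single m q" for m q
  proof -
    obtain a b c where m: "m = (a,b,c)" by (cases m)
    have p: "of_nat k * (x ^ (k - 1) * x) = of_nat k * x ^ k" for k and x :: "'a mpoly3"
      by (cases k) (auto simp: algebra_simps)
    have "?E (single m q) = C3 q * (of_nat w1 * (of_nat a * (X1 ^ (a - 1) * X1)) * X2 ^ b * X3 ^ c
       + of_nat w2 * (of_nat b * (X2 ^ (b - 1) * X2)) * X1 ^ a * X3 ^ c
       + of_nat w3 * (of_nat c * (X3 ^ (c - 1) * X3)) * X1 ^ a * X2 ^ b)"
      by (simp add: m der_single) (simp add: single_eq_monomial C3_mult C3_of_nat algebra_simps)
    then show ?thesis
      by (simp only: p) (simp add: m wdeg_mono_def single_eq_monomial algebra_simps)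
  qed
  have "?E P = ?E (\<Sum>m\<in>keys P. single m (lookup P m))"
    by (simp flip: mpoly3_expand)
  also have "\<dots> = (\<Sum>m\<in>keys P. of_nat (wdeg_mono (w1,w2,w3) m) * single m (lookup P m))"
    by (simp add: der_simps s)
  also have "\<dots> = (\<Sum>m\<in>keys P. of_int n * single m (lookup P m))"
  proof (rule sum.cong)
    fix m assume "m \<in> keys P"
    then have "int (wdeg_mono (w1,w2,w3) m) = n" using assms by (auto simp: wset_def)
    then show "of_nat (wdeg_mono (w1,w2,w3) m) * single m (lookup P m)
      = of_int n * single m (lookup P m)" by (metis of_int_of_nat_eq)
  qed simp
  also have "\<dots> = of_int n * P" by (simp flip: sum_distrib_left mpoly3_expand)
  finally show ?thesis by (simp add: der_eq_pd algebra_simps)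
qed

lemma of_int_mpoly3_eq_0: "of_int n * (P::'a::field_char_0 mpoly3) = 0 \<longleftrightarrow> n = 0 \<or> P = 0"
proof -
  have "(of_int n :: 'a mpoly3) = C3 (of_int n)"
    by (cases n rule: int_diff_cases) (simp add: C3_diff C3_of_nat)
  then show ?thesis by simp
qed

text \<open>Euler's identity; characteristic zero keeps \<open>n P\<close> nonzero.\<close>

lemma ex_pd_nonzero:
  fixes P :: "'a::field_char_0 mpoly3"
  assumes "whom w n P" "P \<noteq> 0" "n \<noteq> 0"
  obtains i where "i \<in> {1,2,3}" "pd i P \<noteq> 0"
proof -
  obtain w1 w2 w3 where w: "w = (w1,w2,w3)" by (cases w)
  have "\<not> (pd 1 P = 0 \<and> pd 2 P = 0 \<and> pd 3 P = 0)"
    using euler[OF assms(1)[unfolded w]] assms(2,3) of_int_mpoly3_eq_0[of n P] by auto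
  then show ?thesis using that by auto
qed

definition jac :: "'a::comm_ring_1 mpoly3 \<Rightarrow> 'a mpoly3 \<Rightarrow> 'a mpoly3 \<Rightarrow> 'a mpoly3" where
  "jac a b c = pd 1 a * (pd 2 b * pd 3 c - pd 3 b * pd 2 c) - pd 2 a * (pd 1 b * pd 3 c - pd 3 b * pd 1 c)
     + pd 3 a * (pd 1 b * pd 2 c - pd 2 b * pd 1 c)"

text \<open>Multiplicativity of the 3 by 3 determinant, arranged as the chain rule expands
  \<open>jac\<close>.\<close>

lemma det3_mult:
  fixes a1 :: "'a::comm_ring_1"
  shows "(a1*x1+a2*y1+a3*z1) * ((b1*x2+b2*y2+b3*z2) * (c1*x3+c2*y3+c3*z3) - (b1*x3+b2*y3+b3*z3) * (c1*x2+c2*y2+c3*z2))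
    - (a1*x2+a2*y2+a3*z2) * ((b1*x1+b2*y1+b3*z1) * (c1*x3+c2*y3+c3*z3) - (b1*x3+b2*y3+b3*z3) * (c1*x1+c2*y1+c3*z1))
    + (a1*x3+a2*y3+a3*z3) * ((b1*x1+b2*y1+b3*z1) * (c1*x2+c2*y2+c3*z2) - (b1*x2+b2*y2+b3*z2) * (c1*x1+c2*y1+c3*z1))
    = (a1*(b2*c3-b3*c2) - a2*(b1*c3-b3*c1) + a3*(b1*c2-b2*c1))
      * (x1*(y2*z3-y3*z2) - x2*(y1*z3-y3*z1) + x3*(y1*z2-y2*z1))"
  by (simp add: algebra_simps)

lemma jac_ev:
  "jac (ev C3 P f1 f2 f3) (ev C3 Q f1 f2 f3) (ev C3 S f1 f2 f3) = ev C3 (jac P Q S) f1 f2 f3 * jac f1 f2 f3"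
  unfolding jac_def chain_rule[OF deriv3_pd] ev_simps[OF rhom_C3] by (rule det3_mult)

text \<open>Each product contains one derivative of each entry, hence the loss of 3.\<close>

lemma wle_jac:
  assumes "wle (1,1,1) a A" "wle (1,1,1) b B" "wle (1,1,1) c C"
  shows "wle (1,1,1) (a + b + c - 3) (jac A B C)"
proof -
  have p: "wle (1,1,1) (a - 1) (pd i A)" "wle (1,1,1) (b - 1) (pd i B)" "wle (1,1,1) (c - 1) (pd i C)"
    if "i \<in> {1,2,3}" for i
    using wle_pd[OF that assms(1)] wle_pd[OF that assms(2)] wle_pd[OF that assms(3)] that by (auto split: if_splits)
  show ?thesis
    unfolding jac_def
    by (intro wset_add wset_diff wle_mult[OF p(1), where k = "b + c - 2"]
        wle_mult[OF p(2) p(3), where l = "b + c - 2"]) auto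
qed

subsection \<open>The relation between the leading terms\<close>

lemma X_nonzero: "X1 \<noteq> (0::'a::zero_neq_one mpoly3)" "X2 \<noteq> (0::'a mpoly3)" "X3 \<noteq> (0::'a mpoly3)"
  unfolding X1_def X2_def X3_def by (metis lookup_single_eq lookup_zero zero_neq_one)+

locale automorphism3 =
  fixes f1 f2 f3 g1 g2 g3 h1 h2 h3 :: "'a::field_char_0 mpoly3" and d1 d2 d3 :: nat
  assumes gf: "ev C3 g1 f1 f2 f3 = X1" "ev C3 g2 f1 f2 f3 = X2" "ev C3 g3 f1 f2 f3 = X3"
    and fg: "ev C3 f1 g1 g2 g3 = X1" "ev C3 f2 g1 g2 g3 = X2" "ev C3 f3 g1 g2 g3 = X3"
    and top_f: "top (1,1,1) (int d1) f1 h1" "top (1,1,1) (int d2) f2 h2" "top (1,1,1) (int d3) f3 h3"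
    and h_nonzero: "h1 \<noteq> 0" "h2 \<noteq> 0" "h3 \<noteq> 0"
    and d_pos: "1 \<le> d1" and d_le: "d1 \<le> d2" "d2 \<le> d3"
begin

definition \<Phi> :: "'a mpoly3 \<Rightarrow> 'a mpoly3" where "\<Phi> P = ev C3 P f1 f2 f3"
definition \<Gamma> :: "'a mpoly3 \<Rightarrow> 'a mpoly3" where "\<Gamma> P = ev C3 P g1 g2 g3"
definition \<psi> :: "'a mpoly3 \<Rightarrow> 'a mpoly3" where "\<psi> P = ev C3 P h1 h2 h3"

abbreviation "d \<equiv> (d1,d2,d3)"

lemma rhom_maps: "rhom \<Phi>" "rhom \<Gamma>" "rhom \<psi>"
  using rhom_ev[OF rhom_C3] by (simp_all add: \<Phi>_def[abs_def] \<Gamma>_def[abs_def] \<psi>_def[abs_def])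

lemmas \<Phi>_simps = rhomD[OF rhom_maps(1)]
lemmas \<psi>_simps = rhomD[OF rhom_maps(3)] rhom_sum[OF rhom_maps(3)]

lemma map_basic [simp]:
  "\<Phi> (C3 c) = C3 c" "\<Phi> X1 = f1" "\<Phi> X2 = f2" "\<Phi> X3 = f3"
  "\<psi> (C3 c) = C3 c" "\<psi> X1 = h1" "\<psi> X2 = h2" "\<psi> X3 = h3"
  by (simp_all add: \<Phi>_def \<psi>_def rhom_C3)

lemma \<Phi>_\<Gamma> [simp]: "\<Phi> (\<Gamma> P) = P" and \<Gamma>_\<Phi> [simp]: "\<Gamma> (\<Phi> P) = P"
  by (simp_all add: \<Phi>_def \<Gamma>_def ev_ev[OF rhom_C3] gf fg ev_X_id)

lemma \<Phi>_eq_0 [simp]: "\<Phi> P = 0 \<longleftrightarrow> P = 0"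
  by (metis \<Gamma>_\<Phi> \<Phi>_simps(4))

lemma top_\<Phi>: "top d n P Q \<Longrightarrow> top (1,1,1) n (\<Phi> P) (\<psi> Q)"
  unfolding \<Phi>_def \<psi>_def by (rule top_ev[OF top_f])

lemma wle_\<Phi>: "wle d n P \<Longrightarrow> wle (1,1,1) n (\<Phi> P)"
  unfolding \<Phi>_def by (rule wle_ev[OF top_f[THEN topD(3)]])

lemma jac_nonzero: "jac f1 f2 f3 \<noteq> 0"
proof -
  have "jac X1 X2 X3 = (1::'a mpoly3)" by (simp add: jac_def)
  then have "\<Phi> (jac g1 g2 g3) * jac f1 f2 f3 = 1"
    using jac_ev[of g1 f1 f2 f3 g2 g3] by (simp add: gf \<Phi>_def)
  then show ?thesis by auto
qed

text \<open>Cramer's rule: a partial derivative of \<open>P\<close> is the Jacobian of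
  \<open>P\<close> with two variables, and its image times \<open>jac f1 f2 f3\<close> is the
  Jacobian of \<open>\<Phi> P\<close> with two components. Dividing by the nonzero
  \<open>jac f1 f2 f3\<close> does not raise the degree.\<close>

lemma wle_\<Phi>_pd:
  assumes i: "i \<in> {1,2,3}" and P: "wle (1,1,1) k (\<Phi> P)"
  shows "wle (1,1,1) (k + int d1 + int d2 + int d3 - 3 - int (wt d i)) (\<Phi> (pd i P))"
proof -
  obtain n J where J: "top (1,1,1) (int n) (jac f1 f2 f3) J" "J \<noteq> 0"
    using ex_top_nonzero[OF jac_nonzero] .
  have j: "jac P X2 X3 = pd 1 P" "jac X1 P X3 = pd 2 P" "jac X1 X2 P = pd 3 P"
    by (simp_all add: jac_def)
  have "wle (1,1,1) (k + int d1 + int d2 + int d3 - 3 - int (wt d i)) (jac f1 f2 f3 * \<Phi> (pd i P))"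
    using i jac_ev[of P f1 f2 f3 X2 X3] jac_ev[of X1 f1 f2 f3 P X3] jac_ev[of X1 f1 f2 f3 X2 P]
      wle_jac[OF P top_f(2,3)[THEN topD(3)]] wle_jac[OF topD(3)[OF top_f(1)] P topD(3)[OF top_f(3)]]
      wle_jac[OF top_f(1,2)[THEN topD(3)] P]
    by (auto simp: j \<Phi>_def rhom_C3 algebra_simps)
  from wle_mult_cancel[OF J this] show ?thesis by (rule wle_mono) simp
qed

end

locale principal_relation = automorphism3 +
  fixes R :: "'a mpoly3" and N :: nat
  assumes \<psi>_eq_0: "\<psi> P = 0 \<longleftrightarrow> R dvd P" and R_nonzero: "R \<noteq> 0"
    and R_hom: "whom d (int N) R" and N_pos: "1 \<le> N"
begin

lemma \<psi>_R [simp]: "\<psi> R = 0"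
  by (simp add: \<psi>_eq_0)

text \<open>Nonzero multiples of \<open>R\<close> have degree at least \<open>N\<close>, so the
  kernel is trivial in lower degrees.\<close>

lemma \<psi>_lower: "wle d n P \<Longrightarrow> n < int N \<Longrightarrow> \<psi> P = 0 \<Longrightarrow> P = 0"
proof (rule ccontr)
  assume P: "wle d n P" "n < int N" "\<psi> P = 0" "P \<noteq> 0"
  then obtain S where S: "P = R * S" by (auto simp: \<psi>_eq_0)
  have "wle d (n - int N) S"
    using wle_mult_cancel[OF top_self[OF R_hom] R_nonzero, of n S] P(1) S by simp
  then have "S = 0" using P(2) by (intro wset_disjoint[of d "{..n - int N}" S "{0..}"]) (auto simp: wset_def)
  with S P(4) show False by simp
qed

text \<open>The kernel of \<open>\<psi>\<close> is prime, and a factor of degree below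
  \<open>N\<close> lies in it only if it is 0.\<close>

lemma R_not_product:
  assumes "R = P * Q" "wle d a P" "wle d b Q" "a < int N" "b < int N"
  shows False
proof -
  have "\<psi> P * \<psi> Q = 0" using assms(1) \<psi>_R by (simp add: \<psi>_simps)
  then have "P = 0 \<or> Q = 0" using \<psi>_lower[of a P] \<psi>_lower[of b Q] assms(2-5) by auto
  then show False using assms(1) R_nonzero by auto
qed

lemma factor_R_power:
  assumes "whom d (int n) P" "P \<noteq> 0"
  obtains m Q where "P = R ^ m * Q" "\<psi> Q \<noteq> 0"
  using assms
proof (induction n arbitrary: P thesis rule: less_induct)
  case (less n)
  show ?case
  proof (cases "\<psi> P = 0")
    case False
    then show ?thesis using less.prems(1)[of 0 P] by simp
  next
    case True
    then obtain S where S: "P = R * S" by (auto simp: \<psi>_eq_0)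
    have Sh: "whom d (int n - int N) S"
      using whom_mult_cancel[OF R_hom R_nonzero, of "int n" S] less.prems(2) S by simp
    have "S \<noteq> 0" using S less.prems(3) by auto
    then have "\<not> int n - int N < 0" using whom_negative[OF Sh] by auto
    then have "int n - int N = int (n - N)" "n - N < n" using N_pos by auto
    with less.IH[of "n - N" S] Sh \<open>S \<noteq> 0\<close> obtain m Q where "S = R ^ m * Q" "\<psi> Q \<noteq> 0" by metis
    then show ?thesis using less.prems(1)[of "Suc m" Q] S by (simp add: mult.assoc)
  qed
qed

lemma R_power_hom: "whom d (int m * int N) (R ^ m)"
  by (rule whom_power[OF R_hom]) simp

text \<open>The inequality says that composing \<open>P\<close> with the automorphism lowers the degree by at most
  \<open>d1 + d2 + d3 - 3\<close> for each factor \<open>R\<close> of the leading form of \<open>P\<close>: a partial derivative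
  removes one such factor, and by the Jacobian formula it does not raise the degree of the
  composition too much.\<close>
lemma parachute:
  assumes "top d n P (R ^ m * Q)" "\<psi> Q \<noteq> 0" "wle (1,1,1) k (\<Phi> P)"
  shows "n - int m * (int d1 + int d2 + int d3 - 3) \<le> k"
  using assms
proof (induction m arbitrary: n P Q k)
  case 0
  then have t: "top (1,1,1) n (\<Phi> P) (\<psi> Q)" using top_\<Phi> by simp
  show ?case
  proof (rule ccontr)
    assume "\<not> ?case"
    then have "top (1,1,1) n (\<Phi> P) 0" using 0(3) by (intro top_lower) (auto elim: wle_mono)
    with t 0(2) show False using top_unique by blast
  qed
next
  case (Suc m)
  obtain i where i: "i \<in> {1,2,3}" "pd i R \<noteq> 0"
    using ex_pd_nonzero[OF R_hom R_nonzero] N_pos by auto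
  have "1 \<le> wt d i" using d_pos d_le by auto
  then have \<psi>i: "\<psi> (pd i R) \<noteq> 0"
    using \<psi>_lower[OF wle_pd[OF i(1) topD(3)[OF top_self[OF R_hom]]]] i(2) by auto
  \<comment> \<open>The cofactor of \<open>R ^ m\<close> after the product rule. Its second summand
    is a multiple of \<open>R\<close>, so only the first survives under
    \<open>\<psi>\<close>.\<close>
  let ?Q = "of_nat (Suc m) * pd i R * Q + R * pd i Q"
  have "pd i (R ^ Suc m * Q) = R ^ m * ?Q"
    unfolding pd_simps(2)[of i "R ^ Suc m" Q] pd_simps(9) by (simp add: algebra_simps)
  then have t: "top d (n - int (wt d i)) (pd i P) (R ^ m * ?Q)"
    using top_pd[OF i(1) Suc.prems(1)] by simp
  have "\<psi> (of_nat (Suc m)) = of_nat (Suc m)"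
    by (metis C3_of_nat map_basic(5))
  then have "\<psi> ?Q \<noteq> 0"
    using \<psi>i Suc.prems(2) of_int_mpoly3_eq_0[of "int (Suc m)" "1::'a mpoly3"] by (simp add: \<psi>_simps)
  from Suc.IH[OF t this wle_\<Phi>_pd[OF i(1) Suc.prems(3)]]
  show ?case by (simp add: algebra_simps)
qed

lemma N_bound: "N < d1 + d2 + d3"
proof (rule ccontr)
  assume N: "\<not> N < d1 + d2 + d3"
  have tR: "top (1,1,1) (int N) (\<Phi> R) 0" using top_\<Phi>[OF top_self[OF R_hom]] by simp
  \<comment> \<open>The image of \<open>R\<close> has degree below \<open>N\<close>, and a single
    factor \<open>R\<close> accounts for the drop. So d1 + d2 + d3 is at least 4, which forces d3 to
    be at least 2.\<close>
  have "int N - (int d1 + int d2 + int d3 - 3) \<le> int N - 1"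
    using parachute[of "int N" R 1 1 "int N - 1"] topD(2)[OF tR] top_self[OF R_hom] by (simp add: \<psi>_simps)
  then have d3: "2 \<le> d3" using d_le by auto
  \<comment> \<open>A component of the inverse maps to a variable. If its leading form has degree
    \<open>n\<close> and contains \<open>R ^ m\<close>, then n >= m N and n - m (d1 + d2 + d3 - 3)
    <= 1 give 3 m <= 1. So m = 0 and n <= 1, which leaves no room for x3, of weight at least
    2.\<close>
  have g: "wle (0,0,1) 0 g" if "\<Phi> g = X" "wle (1,1,1) 1 X" "X \<noteq> 0" for g X
  proof -
    have "g \<noteq> 0" using that(1,3) by (auto simp: \<Phi>_simps)
    then obtain n G where G: "top d (int n) g G" "G \<noteq> 0" using ex_top_nonzero by metis
    obtain m Q where Q: "G = R ^ m * Q" "\<psi> Q \<noteq> 0" using factor_R_power[OF topD(1)[OF G(1)] G(2)] .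
    have "int n - int m * (int d1 + int d2 + int d3 - 3) \<le> 1"
      using parachute[of "int n" g m Q 1] G(1) Q that by simp
    moreover have Qh: "whom d (int n - int m * int N) Q"
      using whom_mult_cancel[OF R_power_hom, of m "int n" Q] topD(1)[OF G(1)] Q(1) R_nonzero by simp
    have "int m * int N \<le> int n"
      using whom_negative[OF Qh] Q(2) by (force simp: \<psi>_simps)
    moreover have "int m * 3 \<le> int m * (int N - (int d1 + int d2 + int d3 - 3))"
      using N by (intro mult_left_mono) auto
    ultimately have "int m * 3 \<le> 1" by (simp add: algebra_simps)
    then have "m = 0" by simp
    then have "n \<le> 1" using \<open>int n - int m * _ \<le> 1\<close> by simp
    with topD(3)[OF G(1)] have le: "wle d 1 g" by (auto elim: wle_mono)
    show ?thesis
      unfolding wset_def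
    proof
      fix a assume a: "a \<in> keys g"
      obtain a1 a2 a3 where abc: "a = (a1,a2,a3)" by (cases a)
      have "d1 * a1 + d2 * a2 + d3 * a3 \<le> 1" using le a by (auto simp: wset_def wdeg_mono_def abc)
      then have "a3 = 0" using d3 by (cases a3) auto
      then show "int (wdeg_mono (0,0,1) a) \<in> {..0}" by (simp add: abc wdeg_mono_def)
    qed
  qed
  \<comment> \<open>The weight (0,0,1) measures the degree in x3: the components of the inverse do
    not contain x3, yet substituting them into \<open>f3\<close> yields \<open>X3\<close>.\<close>
  have "wle (0,0,1) 0 (ev C3 f3 g1 g2 g3)"
  proof (rule wle_ev[of "(0,0,1)" 0 g1 0 g2 0 g3])
    show "wle (0,0,1) (int 0) g1" using g[of g1 X1] gf by (simp add: \<Phi>_def wset_X X_nonzero)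
    show "wle (0,0,1) (int 0) g2" using g[of g2 X2] gf by (simp add: \<Phi>_def wset_X X_nonzero)
    show "wle (0,0,1) (int 0) g3" using g[of g3 X3] gf by (simp add: \<Phi>_def wset_X X_nonzero)
    show "wle (0,0,0) 0 f3" by (auto simp: wset_def wdeg_mono_def)
  qed
  then show False by (simp add: fg wset_X)
qed

end

subsection \<open>Locally nilpotent derivations\<close>

definition loc_nilp :: "('a::comm_ring_1 mpoly3 \<Rightarrow> 'a mpoly3) \<Rightarrow> bool" where
  "loc_nilp D \<longleftrightarrow> (\<forall>P. \<exists>k. (D ^^ k) P = 0)"

lemma funpow_deriv3:
  assumes "deriv3 D"
  shows "(D ^^ k) (P + Q) = (D ^^ k) P + (D ^^ k) Q" "(D ^^ k) 0 = 0"
    "(D ^^ k) (C3 c * P) = C3 c * (D ^^ k) P" "(D ^^ k) (P - Q) = (D ^^ k) P - (D ^^ k) Q"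
  by (induction k) (simp_all add: deriv3D[OF assms])

lemma funpow_zero_mono:
  assumes "deriv3 D" "(D ^^ k) P = 0" "k \<le> l" shows "(D ^^ l) P = 0"
proof -
  have "(D ^^ l) P = (D ^^ (l - k)) ((D ^^ k) P)"
    using assms(3) by (simp flip: funpow_add[THEN fun_cong, unfolded comp_def])
  then show ?thesis by (simp add: assms(2) funpow_deriv3[OF assms(1)])
qed

lemma loc_nilpI:
  fixes D :: "'a::comm_ring_1 mpoly3 \<Rightarrow> 'a mpoly3"
  assumes D: "deriv3 D" and s: "\<And>m q. \<exists>k. (D ^^ k) (single m q) = 0"
  shows "loc_nilp D"
  unfolding loc_nilp_def
proof
  fix P :: "'a mpoly3"
  have "\<exists>k. (D ^^ k) (\<Sum>m\<in>A. single m (g m)) = 0" if "finite A" for A g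
    using that
  proof (induction A)
    case (insert m A)
    obtain k l where "(D ^^ k) (single m (g m)) = 0" "(D ^^ l) (\<Sum>m\<in>A. single m (g m)) = 0"
      using s insert.IH by metis
    then have "(D ^^ max k l) (single m (g m)) = 0" "(D ^^ max k l) (\<Sum>m\<in>A. single m (g m)) = 0"
      by (auto intro: funpow_zero_mono[OF D])
    then show ?case using insert.hyps by (intro exI[of _ "max k l"]) (simp add: funpow_deriv3[OF D])
  qed (auto simp: funpow_deriv3[OF D])
  from this[of "keys P" "lookup P"] show "\<exists>k. (D ^^ k) P = 0"
    by (simp flip: mpoly3_expand)
qed

lemma loc_nilp_pd:
  assumes "j \<in> {1,2,3}" shows "loc_nilp (pd j :: 'a::comm_ring_1 mpoly3 \<Rightarrow> 'a mpoly3)"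
proof (rule loc_nilpI[OF deriv3_pd])
  fix m and q :: 'a
  let ?n = "wdeg_mono (1,1,1) m"
  have "wle (1,1,1) (int ?n - int k) ((pd j ^^ k) (single m q))" for k
  proof (induction k)
    case (Suc k)
    then show ?case using wle_pd[OF assms Suc] assms by (auto simp: algebra_simps)
  qed (simp add: wset_single)
  from this[of "Suc ?n"] have "(pd j ^^ Suc ?n) (single m q) = 0"
    by (intro wset_disjoint[of "(1,1,1)" "{..-1}" _ "{0..}"]) (auto simp: wset_def)
  then show "\<exists>k. (pd j ^^ k) (single m q) = 0" by blast
qed

text \<open>Divided powers, for which the Leibniz rule has no binomial coefficients.\<close>

definition dpow :: "('a::field_char_0 mpoly3 \<Rightarrow> 'a mpoly3) \<Rightarrow> nat \<Rightarrow> 'a mpoly3 \<Rightarrow> 'a mpoly3" where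
  "dpow D k P = C3 (inverse (fact k)) * (D ^^ k) P"

lemma dpow_0 [simp]: "dpow D 0 P = P"
  by (simp add: dpow_def C3_simps)

lemma dpow_Suc:
  assumes "deriv3 D" shows "D (dpow D k P) = C3 (of_nat (Suc k)) * dpow D (Suc k) P"
proof -
  have "of_nat (Suc k) * inverse (fact (Suc k)) = (inverse (fact k) :: 'a)"
    by (simp add: field_simps del: of_nat_Suc)
  then have "C3 (of_nat (Suc k)) * C3 (inverse (fact (Suc k))) = C3 (inverse (fact k) :: 'a)"
    by (simp only: C3_mult[symmetric])
  then show ?thesis by (simp add: dpow_def deriv3D[OF assms] flip: mult.assoc)
qed

lemma dpow_mult:
  assumes D: "deriv3 D"
  shows "dpow D n (P * Q) = (\<Sum>i\<le>n. dpow D i P * dpow D (n - i) Q)"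
proof (induction n)
  case (Suc n)
  let ?p = "\<lambda>i. dpow D i P" and ?q = "\<lambda>i. dpow D i Q"
  let ?c = "\<lambda>k. C3 (of_nat k) :: 'a mpoly3"
  have "?c (Suc n) * dpow D (Suc n) (P * Q) = D (\<Sum>i\<le>n. ?p i * ?q (n - i))"
    by (simp add: Suc dpow_Suc[OF D, symmetric] del: of_nat_Suc)
  also have "\<dots> = (\<Sum>i\<le>n. ?c (Suc i) * ?p (Suc i) * ?q (n - i)) + (\<Sum>i\<le>n. ?p i * (?c (Suc (n - i)) * ?q (Suc (n - i))))"
    by (simp add: deriv3D[OF D] dpow_Suc[OF D] sum.distrib)
  also have "(\<Sum>i\<le>n. ?c (Suc i) * ?p (Suc i) * ?q (n - i)) = (\<Sum>i\<le>Suc n. ?c i * ?p i * ?q (Suc n - i))"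
    by (simp add: sum.atMost_Suc_shift C3_simps del: sum.atMost_Suc of_nat_Suc)
  also have "(\<Sum>i\<le>n. ?p i * (?c (Suc (n - i)) * ?q (Suc (n - i)))) = (\<Sum>i\<le>Suc n. ?p i * (?c (Suc n - i) * ?q (Suc n - i)))"
    by (simp add: C3_simps Suc_diff_le del: of_nat_Suc of_nat_diff)
  also have "(\<Sum>i\<le>Suc n. ?c i * ?p i * ?q (Suc n - i)) + (\<Sum>i\<le>Suc n. ?p i * (?c (Suc n - i) * ?q (Suc n - i)))
      = (\<Sum>i\<le>Suc n. (?c i + ?c (Suc n - i)) * (?p i * ?q (Suc n - i)))"
    by (simp add: algebra_simps flip: sum.distrib)
  also have "\<dots> = (\<Sum>i\<le>Suc n. ?c (Suc n) * (?p i * ?q (Suc n - i)))"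
  proof (rule sum.cong[OF refl])
    fix i assume "i \<in> {..Suc n}"
    then have "i + (Suc n - i) = Suc n" by simp
    then have "?c i + ?c (Suc n - i) = ?c (Suc n)" by (metis C3_add of_nat_add)
    then show "(?c i + ?c (Suc n - i)) * (?p i * ?q (Suc n - i)) = ?c (Suc n) * (?p i * ?q (Suc n - i))" by simp
  qed
  also have "\<dots> = ?c (Suc n) * (\<Sum>i\<le>Suc n. ?p i * ?q (Suc n - i))"
    by (simp only: sum_distrib_left)
  finally show ?case by (subst (asm) mult_left_cancel) (simp_all del: of_nat_Suc)
qed simp

text \<open>The exponential of \<open>T D\<close>, that is, the flow of the derivation with time
  \<open>T\<close>; local nilpotence makes the sum finite.\<close>

definition expo :: "('a::field_char_0 mpoly3 \<Rightarrow> 'a mpoly3) \<Rightarrow> 'a mpoly3 \<Rightarrow> 'a mpoly3 poly" where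
  "expo D P = (\<Sum>k<(LEAST k. (D ^^ k) P = 0). monom (dpow D k P) k)"

lemma coeff_expo:
  assumes "deriv3 D" "loc_nilp D"
  shows "coeff (expo D P) k = dpow D k P"
proof -
  let ?l = "LEAST k. (D ^^ k) P = 0"
  have "(D ^^ ?l) P = 0" by (rule LeastI_ex) (use assms(2) in \<open>auto simp: loc_nilp_def\<close>)
  then have "dpow D k P = 0" if "?l \<le> k" for k
    using funpow_zero_mono[OF assms(1) _ that] by (simp add: dpow_def)
  then show ?thesis by (auto simp: expo_def coeff_sum when_def not_less)
qed

lemma rhom_expo:
  assumes "deriv3 D" "loc_nilp D" shows "rhom (expo D)"
proof -
  have "(D ^^ k) 1 = (if k = 0 then 1 else 0)" for k
    by (induction k) (auto simp: deriv3D[OF assms(1)])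
  then have "expo D 1 = 1"
    by (intro poly_eqI) (simp add: coeff_expo[OF assms] dpow_def C3_simps coeff_1)
  moreover have "expo D (P + Q) = expo D P + expo D Q" for P Q
    by (intro poly_eqI) (simp add: coeff_expo[OF assms] dpow_def funpow_deriv3[OF assms(1)] algebra_simps)
  moreover have "expo D (P * Q) = expo D P * expo D Q" for P Q
    by (intro poly_eqI) (simp add: coeff_expo[OF assms] coeff_mult dpow_mult[OF assms(1)])
  ultimately show ?thesis by (simp add: rhom_def)
qed

text \<open>The degree of \<open>expo D P\<close> in the new variable is additive in \<open>P\<close> and drops under \<open>D\<close>.\<close>
lemma loc_nilp_eigen:
  fixes D :: "'a::field_char_0 mpoly3 \<Rightarrow> 'a mpoly3"
  assumes D: "deriv3 D" "loc_nilp D" and R: "D R = R * Q"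
  shows "D R = 0"
proof (rule ccontr)
  assume DR: "D R \<noteq> 0"
  have nz: "expo D P \<noteq> 0" if "P \<noteq> 0" for P
    using coeff_expo[OF D, of P 0] that by auto
  have RQ: "R \<noteq> 0" "Q \<noteq> 0" using R DR by auto
  have "degree (expo D (D R)) = degree (expo D R) + degree (expo D Q)"
    unfolding R rhomD(3)[OF rhom_expo[OF D]] using nz RQ by (intro degree_mult_eq) auto
  \<comment> \<open>\<open>expo D (D R)\<close> is the \<open>T\<close>-derivative of
    \<open>expo D R\<close>, so its degree cannot reach the sum just computed.\<close>
  moreover have "coeff (expo D (D R)) k = C3 (of_nat (Suc k)) * coeff (expo D R) (Suc k)" for k
  proof -
    have "dpow D k (D R) = D (dpow D k R)"
      by (simp add: dpow_def deriv3D[OF D(1)] funpow_swap1)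
    then show ?thesis by (simp add: coeff_expo[OF D] dpow_Suc[OF D(1)])
  qed
  then have "coeff (expo D (D R)) (degree (expo D (D R))) = 0"
    using calculation by (simp add: coeff_eq_0)
  then have "expo D (D R) = 0" by (simp add: leading_coeff_0_iff)
  with nz[OF DR] show False by simp
qed

context principal_relation
begin

lemma ex_leading_derivation:
  obtains s B1 B2 B3 where "whom d (int d1 + s) B1" "whom d (int d2 + s) B2" "whom d (int d3 + s) B3"
    "\<not> (B1 = 0 \<and> B2 = 0 \<and> B3 = 0)" "loc_nilp (der B1 B2 B3)" "\<psi> (der B1 B2 B3 R) = 0"
proof -
  obtain j where j: "j \<in> {1,2,3}" "pd j h1 \<noteq> 0"
    using ex_pd_nonzero[OF topD(1)[OF top_f(1)] h_nonzero(1)] d_pos by auto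
  have pd_top: "top (1,1,1) (n - 1) (pd j P) (pd j Q)" if "top (1,1,1) n P Q" for n P Q
    using top_pd[OF j(1) that] j(1) by (auto split: if_splits)
  let ?A1 = "\<Gamma> (pd j f1)" and ?A2 = "\<Gamma> (pd j f2)" and ?A3 = "\<Gamma> (pd j f3)"
  let ?E = "der ?A1 ?A2 ?A3"
  have E: "\<Phi> (?E P) = pd j (\<Phi> P)" for P
    using chain_rule[OF deriv3_pd, of j P f1 f2 f3] by (simp add: der_eq_pd \<Phi>_simps) (simp add: \<Phi>_def)
  have "\<Phi> ((?E ^^ k) P) = (pd j ^^ k) (\<Phi> P)" for k P
    by (induction k) (simp_all add: E)
  then have nil: "\<exists>k. (?E ^^ k) P = 0" for P
    using loc_nilp_pd[OF j(1)] by (metis \<Phi>_eq_0 loc_nilp_def)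
  \<comment> \<open>The degree of \<open>?E\<close> as a derivation is sought as
    \<open>k - 1\<close> with \<open>k\<close> natural: -1 is the degree of \<open>pd j\<close>
    itself, and the case \<open>k = 0\<close> below shows that nothing smaller occurs.\<close>
  define ok where "ok k \<longleftrightarrow> wle d (int d1 + (int k - 1)) ?A1 \<and> wle d (int d2 + (int k - 1)) ?A2 \<and> wle d (int d3 + (int k - 1)) ?A3" for k
  have "\<exists>k. ok k"
  proof -
    have w: "\<exists>n. wle d (int n) P" for P :: "'a mpoly3"
      by (cases "P = 0") (auto elim!: ex_top_nonzero[of P d] dest: topD(3))
    obtain n1 n2 n3 where "wle d (int n1) ?A1" "wle d (int n2) ?A2" "wle d (int n3) ?A3" using w by metis
    then have "ok (Suc (n1 + n2 + n3))" unfolding ok_def by (auto elim!: wle_mono)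
    then show ?thesis ..
  qed
  then obtain k where k: "ok k" and min: "\<And>l. l < k \<Longrightarrow> \<not> ok l"
    using LeastI_ex[of ok] not_less_Least by metis
  define s where "s = int k - 1"
  obtain B1 B2 B3 where B: "top d (int d1 + s) ?A1 B1" "top d (int d2 + s) ?A2 B2" "top d (int d3 + s) ?A3 B3"
    using k ex_top unfolding ok_def s_def by metis
  let ?D = "der B1 B2 B3"
  have nz: "\<not> (B1 = 0 \<and> B2 = 0 \<and> B3 = 0)"
  proof
    assume "B1 = 0 \<and> B2 = 0 \<and> B3 = 0"
    then have l: "wle d (int d1 + s - 1) ?A1" "wle d (int d2 + s - 1) ?A2" "wle d (int d3 + s - 1) ?A3"
      using B[THEN topD(2)] by auto
    show False
    proof (cases k)
      \<comment> \<open>Here the choice of \<open>j\<close> matters: a degree below -1 would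
        annihilate \<open>pd j h1\<close>, the leading form of \<open>pd j f1\<close>.\<close>
      case 0
      then have "wle (1,1,1) (int d1 - 1 - 1) (pd j f1)" using wle_\<Phi>[OF l(1)] by (simp add: s_def)
      then have "pd j h1 = 0" using top_unique[OF pd_top[OF top_f(1)] top_lower] by simp
      with j show False by simp
    next
      case (Suc l)
      then have "ok l" using l by (simp add: ok_def s_def algebra_simps)
      with min[of l] Suc show False by simp
    qed
  qed
  \<comment> \<open>Iterates of \<open>?D\<close> give the leading parts of the iterates of
    \<open>?E\<close>, so they vanish with them.\<close>
  have it: "top d (n + int k * s) ((?E ^^ k) P) ((?D ^^ k) P)" if "whom d n P" for n k P
  proof (induction k)
    case 0 then show ?case by (simp add: top_self that)
  next
    case (Suc k) then show ?case using top_der[OF Suc B] by (simp add: algebra_simps)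
  qed
  have "loc_nilp ?D"
  proof (rule loc_nilpI[OF deriv3_der])
    fix m and q :: 'a
    obtain k where k: "(?E ^^ k) (single m q) = 0" using nil by metis
    have "whom d (int (wdeg_mono d m)) (single m q)" by (simp add: wset_single)
    from it[OF this, of k] have "(?D ^^ k) (single m q) = 0"
      unfolding k by (metis top_unique top_lower wset_zero)
    then show "\<exists>k. (?D ^^ k) (single m q) = 0" by blast
  qed
  \<comment> \<open>\<open>\<Phi> R\<close> has degree at most N - 1, so its derivative has degree
    at most N - 2, which is below N + s because s >= -1. The component of degree N + s is
    \<open>\<psi> (?D R)\<close>.\<close>
  moreover have "\<psi> (?D R) = 0"
  proof -
    have "top (1,1,1) (int N) (\<Phi> R) 0" using top_\<Phi>[OF top_self[OF R_hom]] by simp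
    then have "wle (1,1,1) (int N - 1) (\<Phi> R)" using topD(2) by fastforce
    then obtain Q where "top (1,1,1) (int N - 1) (\<Phi> R) Q" by (rule ex_top)
    from topD(3)[OF pd_top[OF this]] have "wle (1,1,1) (int N - 2) (\<Phi> (?E R))" by (simp add: E)
    then have "top (1,1,1) (int N + s) (\<Phi> (?E R)) 0"
      by (intro top_lower) (auto simp: s_def elim!: wle_mono)
    moreover have "top (1,1,1) (int N + s) (\<Phi> (?E R)) (\<psi> (?D R))"
      using top_\<Phi>[OF it[OF R_hom, of 1]] by simp
    ultimately show ?thesis by (metis top_unique)
  qed
  ultimately show ?thesis using that B[THEN topD(1)] nz by blast
qed

lemma ex_lnd:
  obtains t C1 C2 C3' where "whom d (int d1 + t) C1" "whom d (int d2 + t) C2" "whom d (int d3 + t) C3'"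
    "\<psi> C1 \<noteq> 0 \<or> \<psi> C2 \<noteq> 0 \<or> \<psi> C3' \<noteq> 0" "loc_nilp (der C1 C2 C3')" "der C1 C2 C3' R = 0"
proof -
  obtain s B1 B2 B3 where B: "whom d (int d1 + s) B1" "whom d (int d2 + s) B2" "whom d (int d3 + s) B3"
    "\<not> (B1 = 0 \<and> B2 = 0 \<and> B3 = 0)" "loc_nilp (der B1 B2 B3)" "\<psi> (der B1 B2 B3 R) = 0"
    by (rule ex_leading_derivation)
  \<comment> \<open>The derivative of \<open>R\<close> is a multiple of \<open>R\<close>, which a
    locally nilpotent derivation allows only when it is 0.\<close>
  have BR: "der B1 B2 B3 R = 0"
    using loc_nilp_eigen[OF deriv3_der B(5)] B(6) by (metis \<psi>_eq_0 dvdE)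
  define ok where "ok m \<longleftrightarrow> R ^ m dvd B1 \<and> R ^ m dvd B2 \<and> R ^ m dvd B3" for m
  have bound: "int m \<le> int d1 + int d2 + int d3 + s" if "ok m" for m
  proof -
    have "int m \<le> e + s" if "R ^ m dvd B" "whom d (e + s) B" "B \<noteq> 0" for B e
    proof -
      obtain S where S: "B = R ^ m * S" using \<open>R ^ m dvd B\<close> by (elim dvdE)
      have Sh: "whom d (e + s - int m * int N) S"
        using whom_mult_cancel[OF R_power_hom, of m "e + s" S] that(2) S R_nonzero by simp
      have "S \<noteq> 0" using S that(3) by auto
      then have "int m * int N \<le> e + s" using whom_negative[OF Sh] by force
      moreover have "int m * 1 \<le> int m * int N" using N_pos by (intro mult_left_mono) auto
      ultimately show ?thesis by simp
    qed
    from this[of B1 "int d1"] this[of B2 "int d2"] this[of B3 "int d3"] that B(1-4)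
    show ?thesis unfolding ok_def by auto
  qed
  have "ok 0" by (simp add: ok_def)
  moreover have "\<forall>m. ok m \<longrightarrow> m \<le> nat (int d1 + int d2 + int d3 + s)" using bound by fastforce
  ultimately obtain m where m: "ok m" and max: "\<And>l. ok l \<Longrightarrow> l \<le> m"
    using GreatestI_nat[of ok] Greatest_le_nat[of ok] by metis
  obtain C1 C2 C3' where C: "B1 = R ^ m * C1" "B2 = R ^ m * C2" "B3 = R ^ m * C3'"
    using m unfolding ok_def by (metis dvdE)
  have "\<psi> C1 \<noteq> 0 \<or> \<psi> C2 \<noteq> 0 \<or> \<psi> C3' \<noteq> 0"
  proof (rule ccontr)
    assume "\<not> ?thesis"
    then have "ok (Suc m)"
      unfolding ok_def C \<psi>_eq_0 by (auto simp: mult.commute intro!: mult_dvd_mono)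
    with max[of "Suc m"] show False by simp
  qed
  moreover have "whom d (int d1 + (s - int m * int N)) C1" "whom d (int d2 + (s - int m * int N)) C2"
     "whom d (int d3 + (s - int m * int N)) C3'"
    using whom_mult_cancel[OF R_power_hom _ B(1)[unfolded C]] whom_mult_cancel[OF R_power_hom _ B(2)[unfolded C]]
      whom_mult_cancel[OF R_power_hom _ B(3)[unfolded C]] R_nonzero by (simp_all add: algebra_simps)
  moreover
  let ?D = "der C1 C2 C3'"
  have D: "der B1 B2 B3 P = R ^ m * ?D P" for P
    by (simp add: der_eq_pd C algebra_simps)
  have DR: "?D R = 0" using BR R_nonzero by (simp add: D)
  \<comment> \<open>Since \<open>R\<close> is a constant of the derivation, its powers pass through
    the iterates, and local nilpotence survives the division.\<close>
  moreover have "(der B1 B2 B3 ^^ k) P = R ^ (m * k) * (?D ^^ k) P" for k P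
    by (induction k) (simp_all add: D der_simps(2,9) DR power_add algebra_simps)
  then have "loc_nilp ?D" using B(5) R_nonzero by (simp add: loc_nilp_def)
  ultimately show ?thesis using that by blast
qed

end

subsection \<open>Polynomial curves on the surface\<close>

abbreviation pev :: "'a::comm_ring_1 mpoly3 \<Rightarrow> 'a poly \<Rightarrow> 'a poly \<Rightarrow> 'a poly \<Rightarrow> 'a poly" where
  "pev \<equiv> ev (\<lambda>c. [:c:])"

lemma rhom_pCons: "rhom (\<lambda>c::'a::comm_ring_1. [:c:])"
  by (simp add: rhom_def pCons_one)

lemma rhom_id: "rhom (\<lambda>c::'a::comm_ring_1. c)"
  by (simp add: rhom_def)

text \<open>Kronecker substitution: for large \<open>M\<close> the monomials of \<open>P\<close> become distinct powers of \<open>T\<close>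
  under \<open>x1 = T\<close>, \<open>x2 = T\<^sup>M\<close>, \<open>x3 = T\<^bsup>M\<^sup>2\<^esup>\<close>.\<close>
lemma ex_nonvanishing_point:
  fixes P :: "'a::field_char_0 mpoly3"
  assumes "P \<noteq> 0"
  obtains x y z where "ev (\<lambda>c. c) P x y z \<noteq> 0"
proof -
  have "finite (wdeg_mono (1,1,1) ` keys P)" by simp
  then obtain M where M: "\<And>m. m \<in> keys P \<Longrightarrow> wdeg_mono (1,1,1) m < M"
    by (metis finite_nat_set_iff_bounded image_eqI)
  define e where "e = (\<lambda>(a,b,c). a + M * (b + M * c))"
  have inj: "inj_on e (keys P)"
  proof (rule inj_onI)
    fix m m' assume m: "m \<in> keys P" "m' \<in> keys P" "e m = e m'"
    obtain a b c a' b' c' where mm: "m = (a,b,c)" "m' = (a',b',c')" by (cases m; cases m')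
    have lt: "a < M" "b < M" "a' < M" "b' < M" using M[OF m(1)] M[OF m(2)] by (auto simp: mm wdeg_mono_def)
    have e: "a + M * (b + M * c) = a' + M * (b' + M * c')" using m(3) by (simp add: e_def mm)
    have aa: "a = a'" using arg_cong[OF e, of "\<lambda>x. x mod M"] lt by simp
    then have e': "b + M * c = b' + M * c'" using e lt by simp
    have "b = b'" using arg_cong[OF e', of "\<lambda>x. x mod M"] lt by simp
    then show "m = m'" using aa e' lt by (simp add: mm)
  qed
  let ?T = "[:0, 1:] :: 'a poly"
  let ?p = "pev P ?T (?T ^ M) (?T ^ (M * M))"
  have p: "?p = (\<Sum>m\<in>keys P. monom (lookup P m) (e m))"
    unfolding ev_def
    by (intro sum.cong) (auto simp: e_def monom_altdef algebra_simps simp flip: power_mult power_add)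
  obtain m where m: "m \<in> keys P" using assms by (metis keys_eq_empty ex_in_conv)
  have "coeff ?p (e m) = (\<Sum>k\<in>keys P. if k = m then lookup P k else 0)"
    unfolding p coeff_sum by (intro sum.cong) (use inj m in \<open>auto dest: inj_onD\<close>)
  then have "coeff ?p (e m) \<noteq> 0" using m by (simp add: in_keys_iff)
  then have "?p \<noteq> 0" by auto
  then obtain t where t: "poly ?p t \<noteq> 0" by (metis poly_all_0_iff_0)
  have "rhom (\<lambda>p. poly p t)" by (simp add: rhom_def)
  then have "poly ?p t = ev (\<lambda>c. c) P t (t ^ M) (t ^ (M * M))"
    by (subst rhom_eq_ev[OF rhom_comp[OF _ rhom_ev[OF rhom_pCons]]]) (simp_all add: rhom_pCons)
  with t show ?thesis using that by simp
qed

lemma rhom_map_poly: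
  assumes "rhom F" shows "rhom (map_poly F)"
proof -
  note F = rhomD[OF assms]
  have c: "coeff (map_poly F p) n = F (coeff p n)" for p n
    by (simp add: coeff_map_poly F)
  show ?thesis
    unfolding rhom_def
    by (auto intro!: poly_eqI simp: c F coeff_mult coeff_1 rhom_sum[OF assms])
qed

text \<open>With \<open>D a\<close> constant, \<open>D\<close> acts on polynomials in
  \<open>a\<close> as a multiple of d/da.\<close>

lemma funpow_derivation_power:
  assumes D: "deriv3 D" and a: "D a = C3 c"
  shows "(D ^^ k) (a ^ k) = C3 (fact k * c ^ k :: 'a::field_char_0)"
proof (induction k)
  case (Suc k)
  have "D (a ^ Suc k) = C3 (of_nat (Suc k) * c) * a ^ k"
    unfolding deriv3D(9)[OF D] a C3_mult C3_of_nat by (simp add: algebra_simps)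
  then have "(D ^^ Suc k) (a ^ Suc k) = C3 (of_nat (Suc k) * c) * (D ^^ k) (a ^ k)"
    by (simp only: funpow_Suc_right comp_def funpow_deriv3[OF D])
  also have "\<dots> = C3 (fact (Suc k) * c ^ Suc k)" by (simp add: Suc algebra_simps flip: C3_mult)
  finally show ?case .
qed (simp add: C3_simps)

context principal_relation
begin

text \<open>The danger is that modulo \<open>R\<close> only constants are homogeneous and killed by
  the derivation. Then the last nonzero iterate of every homogeneous element is a constant; some
  \<open>a\<close> has a nonzero constant derivative, and every homogeneous element of positive
  degree is, modulo \<open>R\<close>, a scalar times a power of \<open>a\<close>. So
  \<open>h1\<close> and \<open>h2\<close> are multiples of powers of one polynomial, and
  \<open>R\<close> divides a binomial in x1 and x2, contrary to \<open>R3\<close>.\<close>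

lemma kernel_element:
  assumes C: "whom d (int d1 + t) C1" "whom d (int d2 + t) C2" "whom d (int d3 + t) C3'"
    and R: "der C1 C2 C3' R = 0" "loc_nilp (der C1 C2 C3')" and R3: "\<not> wle (0,0,1) 0 R"
  obtains n h where "0 < n" "whom d (int n) h" "\<psi> h \<noteq> 0" "\<psi> (der C1 C2 C3' h) = 0"
proof (rule ccontr)
  note D = deriv3_der[of C1 C2 C3']
  let ?D = "der C1 C2 C3'"
  assume "\<not> thesis"
  with that have no: "\<psi> (?D P) \<noteq> 0" if "0 < n" "whom d n P" "\<psi> P \<noteq> 0" for n P
    using that by (metis zero_less_imp_eq_int of_nat_0_less_iff)
  have hom: "whom d (n + int k * t) ((?D ^^ k) P)" if "whom d n P" for n k P
  proof (induction k)
    case (Suc k)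
    then show ?case using whom_der[OF Suc C] by (simp add: algebra_simps)
  qed (simp add: that)
  have last: "\<exists>k. \<psi> ((?D ^^ k) P) \<noteq> 0 \<and> n + int k * t = 0" if P: "whom d n P" "\<psi> P \<noteq> 0" for n P
  proof -
    let ?l = "LEAST k. \<psi> ((?D ^^ k) P) = 0"
    have "\<exists>k. \<psi> ((?D ^^ k) P) = 0" using R(2) unfolding loc_nilp_def by (metis \<psi>_simps(4))
    then have l: "\<psi> ((?D ^^ ?l) P) = 0" by (rule LeastI_ex)
    then obtain k where k: "?l = Suc k" using P(2) by (cases ?l) auto
    have nz: "\<psi> ((?D ^^ k) P) \<noteq> 0" using not_less_Least[of k "\<lambda>k. \<psi> ((?D ^^ k) P) = 0"] k by auto
    have "\<not> n + int k * t < 0" using whom_negative[OF hom[OF P(1), of k]] nz by (auto simp: \<psi>_simps)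
    moreover have "\<not> 0 < n + int k * t" using no[OF _ hom[OF P(1), of k] nz] l k by auto
    ultimately show ?thesis using nz by (intro exI[of _ k]) auto
  qed
  have const: "\<exists>c. P = C3 c" if "whom d 0 P" for P :: "'a mpoly3"
    using that d_pos d_le by (intro wle_const[of d1 d2 d3]) (auto elim: whom_wle)
  have X: "whom d (int d1) (X1::'a mpoly3)" "whom d (int d2) (X2::'a mpoly3)" by (simp_all add: wset_X)
  obtain k where k: "\<psi> ((?D ^^ k) X1) \<noteq> 0" "int d1 + int k * t = 0"
    using last[OF X(1)] h_nonzero by auto
  from k(2) obtain k1 where k1: "k = Suc k1" using d_pos by (cases k) simp_all
  have t: "t < 0"
  proof (rule ccontr)
    assume "\<not> t < 0"
    then have "0 \<le> int k * t" by simp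
    with k(2) d_pos show False by simp
  qed
  let ?a = "(?D ^^ k1) X1"
  obtain c1 where c1: "?D ?a = C3 c1"
    using const[of "?D ?a"] hom[OF X(1), of k] k(2) k1 by auto
  have "c1 \<noteq> 0" using k(1) c1 by (auto simp: k1 C3_simps \<psi>_simps)
  have a: "whom d (- t) ?a"
    using hom[OF X(1), of k1] k(2) k1 by (simp add: algebra_simps add_eq_0_iff)
  have pow: "\<exists>c j. \<psi> P = C3 c * \<psi> ?a ^ j \<and> 0 < j" if P: "whom d n P" "0 < n" "\<psi> P \<noteq> 0" for n P
  proof -
    obtain j where j: "\<psi> ((?D ^^ j) P) \<noteq> 0" "n + int j * t = 0" using last[OF P(1,3)] by blast
    have "0 < j" using j(2) P(2) by (cases j) auto
    obtain c where c: "(?D ^^ j) P = C3 c" using const hom[OF P(1), of j] j(2) by auto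
    \<comment> \<open>Chosen so that \<open>j\<close> applications of the derivation kill the
      difference \<open>?P\<close>.\<close>
    let ?c = "c / (fact j * c1 ^ j)"
    let ?P = "P - C3 ?c * ?a ^ j"
    have "whom d n (?a ^ j)" using j(2) by (intro whom_power[OF a]) simp
    then have Ph: "whom d n ?P" by (intro wset_diff P(1) whom_C3_mult)
    have "(?D ^^ j) ?P = C3 c - C3 ?c * C3 (fact j * c1 ^ j)"
      by (simp only: funpow_deriv3[OF D] c funpow_derivation_power[OF D c1])
    also have "\<dots> = 0" using \<open>c1 \<noteq> 0\<close> by (simp flip: C3_mult)
    finally have z: "(?D ^^ j) ?P = 0" .
    \<comment> \<open>Otherwise the last nonzero iterate of \<open>?P\<close> has degree 0. As
      \<open>t < 0\<close>, this fixes the number of iterations as \<open>j\<close>, where the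
      iterate was just made to vanish.\<close>
    have "\<psi> ?P = 0"
    proof (rule ccontr)
      assume "\<psi> ?P \<noteq> 0"
      then obtain j' where j': "\<psi> ((?D ^^ j') ?P) \<noteq> 0" "n + int j' * t = 0" using last[OF Ph] by blast
      have "int j' * t = int j * t" using j(2) j'(2) by linarith
      then have "j' = j" using t by simp
      with j'(1) z show False by (simp add: \<psi>_simps)
    qed
    then have "\<psi> P = C3 ?c * \<psi> ?a ^ j" by (simp add: \<psi>_simps)
    with \<open>0 < j\<close> show ?thesis by blast
  qed
  obtain \<alpha> i where i: "h1 = C3 \<alpha> * \<psi> ?a ^ i" "0 < i" using pow[OF X(1)] d_pos h_nonzero by auto
  obtain \<beta> j where j: "h2 = C3 \<beta> * \<psi> ?a ^ j" "0 < j" using pow[OF X(2)] d_pos d_le h_nonzero by auto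
  have nz: "\<alpha> \<noteq> 0" "\<beta> \<noteq> 0" using i(1) j(1) h_nonzero by (auto simp: C3_simps)
  \<comment> \<open>Eliminates \<open>a\<close> between the expressions for \<open>h1\<close> and
    \<open>h2\<close>. Since \<open>i\<close> and \<open>j\<close> are positive, the two monomials
    differ and \<open>T\<close> is not 0.\<close>
  define T where "T = C3 (\<beta> ^ i) * X1 ^ j - C3 (\<alpha> ^ j) * X2 ^ i"
  have "\<psi> T = C3 (\<beta> ^ i) * h1 ^ j - C3 (\<alpha> ^ j) * h2 ^ i" by (simp add: T_def \<psi>_simps)
  also have "\<dots> = 0"
  proof -
    have "C3 (\<beta> ^ i) * x ^ j - C3 (\<alpha> ^ j) * y ^ i = 0" if "x = C3 \<alpha> * z ^ i" "y = C3 \<beta> * z ^ j" for x y z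
      using that by (simp add: power_mult_distrib C3_power mult.commute mult.left_commute flip: power_mult)
    from this[OF i(1) j(1)] show ?thesis .
  qed
  finally obtain S where S: "T = R * S" by (auto simp: \<psi>_eq_0)
  have "lookup T (j,0,0) = \<beta> ^ i"
    using i(2) j(2) by (simp add: T_def X_power C3_def mult_single lookup_minus lookup_single)
  then have "T \<noteq> 0" using nz by auto
  then have "S \<noteq> 0" using S by auto
  then obtain n S' where S': "top (0,0,1) (int n) S S'" "S' \<noteq> 0" using ex_top_nonzero by metis
  have "wle (0,0,1) 0 T"
    unfolding T_def X_power C3_def mult_single by (intro wset_diff) (simp_all add: wset_single wdeg_mono_def)
  then have "wle (0,0,1) (0 - int n) R"
    using wle_mult_cancel[OF S', of 0 R] S by (simp add: mult.commute)
  then have "wle (0,0,1) 0 R" by (rule wle_mono) simp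
  with R3 show False ..
qed

text \<open>The curve is the flow of the derivation followed by \<open>\<psi>\<close> and evaluation
  at a point. \<open>R\<close> and \<open>h\<close> stay constant along it because their derivatives
  vanish modulo \<open>R\<close>. The point is chosen where neither \<open>h\<close> nor the
  velocity of some coordinate vanishes.\<close>

lemma ex_curve:
  assumes R3: "\<not> wle (0,0,1) 0 R"
  obtains x1 x2 x3 h n c where "pev R x1 x2 x3 = 0" "whom d (int n) h" "0 < n" "pev h x1 x2 x3 = [:c:]" "c \<noteq> 0"
    "\<not> (degree x1 = 0 \<and> degree x2 = 0 \<and> degree x3 = 0)"
proof -
  obtain t C1 C2 C3' where C: "whom d (int d1 + t) C1" "whom d (int d2 + t) C2" "whom d (int d3 + t) C3'"
    "\<psi> C1 \<noteq> 0 \<or> \<psi> C2 \<noteq> 0 \<or> \<psi> C3' \<noteq> 0" "loc_nilp (der C1 C2 C3')" "der C1 C2 C3' R = 0"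
    by (rule ex_lnd)
  note D = deriv3_der[of C1 C2 C3']
  let ?D = "der C1 C2 C3'"
  obtain n h where h: "0 < n" "whom d (int n) h" "\<psi> h \<noteq> 0" "\<psi> (?D h) = 0"
    using kernel_element[OF C(1-3,6,5) R3] .
  obtain X where X: "X \<in> {X1,X2,X3}" "\<psi> (?D X) \<noteq> 0"
    using C(4) that[of X1] that[of X2] that[of X3] by auto
  then have "\<psi> h * \<psi> (?D X) \<noteq> 0" using h by simp
  then obtain x y z where v: "ev (\<lambda>c. c) (\<psi> h * \<psi> (?D X)) x y z \<noteq> 0" using ex_nonvanishing_point by metis
  define F where "F = (\<lambda>P. ev (\<lambda>c. c) (\<psi> P) x y z)"
  have F: "rhom F" unfolding F_def by (rule rhom_comp[OF rhom_ev[OF rhom_id] rhom_maps(3)])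
  have Fnz: "F h \<noteq> 0" "F (?D X) \<noteq> 0" using v by (auto simp: F_def ev_mult[OF rhom_id])
  have F0: "F P = 0" if "\<psi> P = 0" for P by (simp add: F_def that)
  \<comment> \<open>The kernel of \<open>\<psi>\<close> is stable under the derivation because the
    derivation kills its generator.\<close>
  have \<psi>D: "\<psi> ((?D ^^ k) P) = 0" if "\<psi> P = 0" for k P
  proof (induction k)
    case (Suc k)
    then obtain S where "(?D ^^ k) P = R * S" by (auto simp: \<psi>_eq_0)
    then show ?case by (simp add: deriv3D[OF D] C(6) \<psi>_simps)
  qed (simp add: that)
  define \<phi> where "\<phi> = (\<lambda>P. map_poly F (expo ?D P))"
  have \<phi>: "rhom \<phi>" unfolding \<phi>_def by (rule rhom_comp[OF rhom_map_poly[OF F] rhom_expo[OF D C(5)]])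
  have c: "coeff (\<phi> P) k = F (dpow ?D k P)" for P k
    by (simp add: \<phi>_def coeff_map_poly rhomD[OF F] coeff_expo[OF D C(5)])
  have cst: "\<phi> P = [:F P:]" if "\<psi> (?D P) = 0" for P
  proof (rule poly_eqI)
    fix k show "coeff (\<phi> P) k = coeff [:F P:] k"
    proof (cases k)
      case (Suc l)
      have "\<psi> ((?D ^^ Suc l) P) = 0" using \<psi>D[OF that, of l] by (simp add: funpow_swap1)
      then show ?thesis using Suc by (simp add: c dpow_def rhomD[OF F] F0)
    qed (simp add: c)
  qed
  have "F (C3 q) = q" for q by (simp add: F_def rhom_id)
  then have \<phi>C: "\<phi> (C3 q) = [:q:]" for q using cst[of "C3 q"] by (simp add: der_simps \<psi>_simps)
  have ev: "\<phi> P = pev P (\<phi> X1) (\<phi> X2) (\<phi> X3)" for P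
    by (subst rhom_eq_ev[OF \<phi>]) (simp add: \<phi>C)
  have "pev R (\<phi> X1) (\<phi> X2) (\<phi> X3) = 0"
    using cst[of R] F0[of R] by (simp add: C(6) \<psi>_simps flip: ev)
  moreover have "pev h (\<phi> X1) (\<phi> X2) (\<phi> X3) = [:F h:]" using cst[OF h(4)] by (simp flip: ev)
  moreover have "coeff (\<phi> X) 1 \<noteq> 0"
    using Fnz(2) by (simp add: c dpow_def C3_simps)
  then have "degree (\<phi> X) \<noteq> 0" using le_degree[of "\<phi> X" 1] by simp
  then have "\<not> (degree (\<phi> X1) = 0 \<and> degree (\<phi> X2) = 0 \<and> degree (\<phi> X3) = 0)"
    using X(1) by auto
  ultimately show ?thesis using that[OF _ h(2,1) _ Fnz(1)] by blast
qed

end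

subsection \<open>Univariate polynomials over an algebraically closed field\<close>

lemma dvd_cancel_no_common_root:
  fixes y u v :: "'a::field poly"
  assumes ac: "alg_closed_field TYPE('a)" and "y \<noteq> 0" "y dvd u * v"
    and "\<And>x. poly y x = 0 \<Longrightarrow> poly u x \<noteq> 0"
  shows "y dvd v"
  using assms(2-)
proof (induction "degree y" arbitrary: y v rule: less_induct)
  case less
  show ?case
  proof (cases "degree y = 0")
    case True
    then show ?thesis using less.prems(1) by (simp add: is_unit_iff_degree unit_imp_dvd)
  next
    case False
    then obtain r where r: "poly y r = 0" using ac unfolding alg_closed_field_def by (metis less_one not_less)
    then obtain y' where y: "y = [:- r, 1:] * y'" by (auto simp: poly_eq_0_iff_dvd)
    have "[:- r, 1:] dvd u * v" using less.prems(2) y by (metis dvd_mult_left)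
    then have "poly (u * v) r = 0" by (simp only: poly_eq_0_iff_dvd)
    then have "poly v r = 0" using less.prems(3)[OF r] by simp
    then obtain v' where v: "v = [:- r, 1:] * v'" by (auto simp: poly_eq_0_iff_dvd)
    have "y' dvd u * v'" using less.prems(2) unfolding y v by (simp add: mult.left_commute del: mult_pCons_left)
    moreover have "y' \<noteq> 0" using less.prems(1) y by auto
    moreover have "degree y' < degree y" unfolding y using \<open>y' \<noteq> 0\<close> by (subst degree_mult_eq) auto
    moreover have "poly u x \<noteq> 0" if "poly y' x = 0" for x using less.prems(3)[of x] that by (simp add: y)
    ultimately have "y' dvd v'" using less.hyps by blast
    then show ?thesis unfolding y v by (rule mult_dvd_mono[OF dvd_refl])
  qed
qed

text \<open>Differentiating, \<open>y\<^bsup>k-1\<^esup>\<close> divides \<open>z'\<close>, which is impossible for degree reasons.\<close>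
lemma power_eq_pcompose_const:
  fixes y z g :: "'a::field_char_0 poly"
  assumes ac: "alg_closed_field TYPE('a)" and k: "2 \<le> k" and eq: "y ^ k = pcompose g z"
    and g: "2 \<le> degree g" "\<And>r. poly g r = 0 \<Longrightarrow> poly (pderiv g) r \<noteq> 0"
  shows "degree z = 0 \<and> degree y = 0"
proof -
  have z: "degree z = 0"
  proof (rule ccontr)
    assume z: "degree z \<noteq> 0"
    have dg: "k * degree y = degree g * degree z"
    proof -
      have "degree (y ^ k) = degree g * degree z" by (simp add: eq degree_pcompose)
      moreover have "y \<noteq> 0"
      proof
        assume "y = 0"
        then have "degree (pcompose g z) = 0" using eq[symmetric] k by (simp add: zero_power)
        then show False using z g(1) by (simp add: degree_pcompose)
      qed
      ultimately show ?thesis by (simp add: degree_power_eq)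
    qed
    then have y: "y \<noteq> 0" using z g(1) by auto
    have "pderiv (y ^ k) = smult (of_nat k) (y ^ (k - 1)) * pderiv y"
      using pderiv_power_Suc[of y "k - 1"] k by simp
    then have dv: "y ^ (k - 1) dvd pcompose (pderiv g) z * pderiv z"
      unfolding eq pderiv_pcompose by (metis dvd_smult dvd_triv_left dvd_mult_left dvd_mult2 dvd_refl)
    have nc: "poly (pcompose (pderiv g) z) x \<noteq> 0" if "poly (y ^ (k - 1)) x = 0" for x
    proof -
      have "poly y x = 0" using that by (simp add: poly_power)
      then have "poly (y ^ k) x = 0" using k by simp
      then have "poly g (poly z x) = 0" unfolding eq poly_pcompose .
      from g(2)[OF this] show ?thesis unfolding poly_pcompose .
    qed
    have "y ^ (k - 1) dvd pderiv z" using y by (intro dvd_cancel_no_common_root[OF ac _ dv nc]) simp_all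
    then have "(k - 1) * degree y \<le> degree z - 1"
      using dvd_imp_degree_le[of "y ^ (k - 1)" "pderiv z"] z y
      by (simp add: pderiv_eq_0_iff degree_pderiv degree_power_eq)
    \<comment> \<open>Combined: 2 deg z <= k deg y <= 2 (k - 1) deg y <= 2 (deg z - 1).\<close>
    moreover have "2 * degree z \<le> k * degree y" using dg g(1) by simp
    moreover have "k \<le> 2 * (k - 1)" using k by simp
    then have "k * degree y \<le> 2 * (k - 1) * degree y" by (rule mult_le_mono1)
    then have "k * degree y \<le> 2 * ((k - 1) * degree y)" by (simp only: mult.assoc)
    ultimately show False using z by linarith
  qed
  moreover have "degree (y ^ k) = 0" by (simp add: eq degree_pcompose z)
  then have "degree y = 0" using k by (cases "y = 0") (auto simp: degree_power_eq)
  ultimately show ?thesis by simp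
qed

lemma pcompose_monom: "pcompose (monom a n) (p::'a::comm_ring_1 poly) = smult a (p ^ n)"
  by (induction n) (simp_all add: monom_0 monom_Suc pcompose_pCons)

lemma degree_ge_2I: "coeff p n \<noteq> 0 \<Longrightarrow> 2 \<le> n \<Longrightarrow> 2 \<le> degree p"
  using le_degree order_trans by blast

lemma quadratic_root_discriminant:
  "A * s\<^sup>2 + B * s + C = 0 \<Longrightarrow> (2 * A * s + B)\<^sup>2 = B\<^sup>2 - 4 * A * (C::'a::comm_ring_1)"
proof -
  assume s: "A * s\<^sup>2 + B * s + C = 0"
  have "(2 * A * s + B)\<^sup>2 = 4 * A * (A * s\<^sup>2 + B * s + C) + (B\<^sup>2 - 4 * A * C)"
    by (simp add: power2_eq_square algebra_simps)
  then show ?thesis by (simp add: s)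
qed

text \<open>The factor \<open>r\<close> restores the exponents lowered by differentiation; it is
  harmless at nonzero roots.\<close>

lemma pderiv_quadratic_form:
  fixes A :: "'a::field_char_0"
  shows "r * poly (pderiv (monom A (2 * m) + monom B m + [:C:])) r = of_nat m * r ^ m * (2 * A * r ^ m + B)"
proof -
  have p: "of_nat n * (r * r ^ (n - 1)) = of_nat n * r ^ n" for n by (cases n) auto
  have "r * poly (pderiv (monom A (2 * m) + monom B m + [:C:])) r
      = A * (of_nat (2 * m) * (r * r ^ (2 * m - 1))) + B * (of_nat m * (r * r ^ (m - 1)))"
    by (simp add: pderiv_add pderiv_monom poly_monom pderiv_pCons algebra_simps)
  also have "\<dots> = of_nat m * r ^ m * (2 * A * r ^ m + B)"
    unfolding p power_even_eq by (simp add: power2_eq_square algebra_simps)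
  finally show ?thesis .
qed

text \<open>The right side has simple roots in \<open>z\<close>: \<open>C \<noteq> 0\<close> keeps 0
  from being a root, and the discriminant separates the values of \<open>z ^ m\<close>. The case A =
  0 covers binomials.\<close>

lemma power_eq_quadratic:
  fixes y z :: "'a::field_char_0 poly"
  assumes ac: "alg_closed_field TYPE('a)" and k: "2 \<le> k" "2 \<le> m"
    and C: "C \<noteq> 0" "B\<^sup>2 \<noteq> 4 * A * C"
    and eq: "y ^ k = smult A (z ^ (2 * m)) + smult B (z ^ m) + [:C:]"
  shows "degree z = 0 \<and> degree y = 0"
proof (rule power_eq_pcompose_const[OF ac k(1)])
  let ?g = "monom A (2 * m) + monom B m + [:C:]"
  show "y ^ k = pcompose ?g z" by (simp add: eq pcompose_add pcompose_monom)
  have "A \<noteq> 0 \<or> B \<noteq> 0" using C by auto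
  then show "2 \<le> degree ?g"
    using degree_ge_2I[of ?g "2 * m"] degree_ge_2I[of ?g m] k(2)
    by (cases "A = 0") (auto simp: coeff_pCons split: nat.splits)
  fix r assume r: "poly ?g r = 0"
  then have r0: "r \<noteq> 0" using C k by (auto simp: poly_monom zero_power)
  have "A * (r ^ m)\<^sup>2 + B * r ^ m + C = 0" using r by (simp add: poly_monom power_mult mult.commute[of 2])
  then have "(2 * A * r ^ m + B)\<^sup>2 = B\<^sup>2 - 4 * A * C" by (rule quadratic_root_discriminant)
  then have nz: "2 * A * r ^ m + B \<noteq> 0" using C(2) by auto
  have "r * poly (pderiv ?g) r \<noteq> 0" unfolding pderiv_quadratic_form using nz r0 k by simp
  then show "poly (pderiv ?g) r \<noteq> 0" by (metis mult_zero_right)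
qed

lemma power_eq_binomial:
  fixes y z :: "'a::field_char_0 poly"
  assumes "alg_closed_field TYPE('a)" "2 \<le> k" "2 \<le> m" "C \<noteq> 0" "B \<noteq> 0" "y ^ k = smult B (z ^ m) + [:C:]"
  shows "degree z = 0 \<and> degree y = 0"
  using power_eq_quadratic[of k m C B 0 y z] assms by simp

text \<open>The additional factor \<open>z\<close> contributes the root 0, which is simple because
  \<open>C \<noteq> 0\<close>.\<close>

lemma power_eq_times_quadratic:
  fixes y z :: "'a::field_char_0 poly"
  assumes ac: "alg_closed_field TYPE('a)" and k: "2 \<le> k" "1 \<le> e"
    and C: "C \<noteq> 0" "B\<^sup>2 \<noteq> 4 * A * C"
    and eq: "y ^ k = z * (smult A (z ^ (2 * e)) + smult B (z ^ e) + [:C:])"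
  shows "degree z = 0 \<and> degree y = 0"
proof (rule power_eq_pcompose_const[OF ac k(1)])
  let ?q = "monom A (2 * e) + monom B e + [:C:]"
  let ?g = "[:0, 1:] * ?q"
  show "y ^ k = pcompose ?g z" unfolding pcompose_mult by (simp add: eq pcompose_add pcompose_monom pcompose_pCons)
  have "A \<noteq> 0 \<or> B \<noteq> 0" using C by auto
  then show "2 \<le> degree ?g"
    using degree_ge_2I[of ?g "Suc (2 * e)"] degree_ge_2I[of ?g "Suc e"] k(2)
    by (cases "A = 0") (auto simp: coeff_pCons split: nat.splits)
  fix r assume r: "poly ?g r = 0"
  have pd: "poly (pderiv ?g) r = poly ?q r + r * poly (pderiv ?q) r"
    unfolding pderiv_mult by (simp add: pderiv_pCons)
  show "poly (pderiv ?g) r \<noteq> 0"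
  proof (cases "r = 0")
    case True
    then show ?thesis unfolding pd using C k by (simp add: poly_monom zero_power)
  next
    case False
    have "poly ?q r = 0" using r False by (simp del: poly_add)
    then have "A * (r ^ e)\<^sup>2 + B * r ^ e + C = 0" by (simp add: poly_monom power_mult mult.commute[of 2])
    then have "(2 * A * r ^ e + B)\<^sup>2 = B\<^sup>2 - 4 * A * C" by (rule quadratic_root_discriminant)
    then have nz: "2 * A * r ^ e + B \<noteq> 0" using C(2) by auto
    show ?thesis unfolding pd \<open>poly ?q r = 0\<close> pderiv_quadratic_form using nz False k by simp
  qed
qed

lemma ex_sqrt: "alg_closed_field TYPE('a::field) \<Longrightarrow> \<exists>b::'a. b\<^sup>2 = a"
proof -
  assume ac: "alg_closed_field TYPE('a)"
  have "coeff [:- a, 0, 1:] 2 \<noteq> 0" by (simp add: numeral_2_eq_2)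
  then have "1 \<le> degree [:- a, 0, 1:]" using degree_ge_2I[of _ 2] by fastforce
  then obtain b where "poly [:- a, 0, 1:] b = 0" using ac unfolding alg_closed_field_def by blast
  then show ?thesis by (intro exI[of _ b]) (simp add: power2_eq_square)
qed

text \<open>A root of \<open>u\<close> is no root of \<open>v\<close>, so it is a multiple root of
  \<open>u\<close> and can be split off twice; what finally remains is a constant, which has a
  square root.\<close>

lemma coprime_factor_of_square:
  fixes u v w :: "'a::field poly"
  assumes ac: "alg_closed_field TYPE('a)" and "u * v = w\<^sup>2" "\<And>x. poly u x = 0 \<Longrightarrow> poly v x \<noteq> 0"
  shows "\<exists>s. u = s\<^sup>2"
  using assms(2-)
proof (induction "degree u" arbitrary: u w rule: less_induct)
  case less
  show ?case
  proof (cases "degree u = 0")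
    case True
    then obtain a where a: "u = [:a:]" by (elim degree_eq_zeroE)
    obtain b where "b\<^sup>2 = a" using ex_sqrt[OF ac] by blast
    then show ?thesis by (intro exI[of _ "[:b:]"]) (simp add: a poly_const_pow)
  next
    case False
    then obtain r where r: "poly u r = 0" using ac unfolding alg_closed_field_def by (metis less_one not_less)
    let ?l = "[:- r, 1:]"
    obtain u1 where u1: "u = ?l * u1" using r by (auto simp: poly_eq_0_iff_dvd)
    have "poly (w\<^sup>2) r = 0" using r by (simp flip: less.prems(1))
    then have "poly w r = 0" by simp
    then obtain w1 where w1: "w = ?l * w1" by (auto simp: poly_eq_0_iff_dvd)
    have "?l * (u1 * v) = ?l * (?l * w1\<^sup>2)"
      using less.prems(1) unfolding u1 w1 by (simp only: power2_eq_square mult_ac)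
    then have e1: "u1 * v = ?l * w1\<^sup>2" by (subst (asm) mult_left_cancel) auto
    then have "poly (u1 * v) r = 0" by simp
    then have "poly u1 r = 0" using less.prems(2)[OF r] by simp
    then obtain u2 where u2: "u1 = ?l * u2" by (auto simp: poly_eq_0_iff_dvd)
    have "?l * (u2 * v) = ?l * w1\<^sup>2" using e1 unfolding u2 by (simp only: mult_ac)
    then have e2: "u2 * v = w1\<^sup>2" by (subst (asm) mult_left_cancel) auto
    have "u2 \<noteq> 0" using False u1 u2 by auto
    then have "degree u2 < degree u" unfolding u1 u2 by (simp add: degree_mult_eq del: mult_pCons_left)
    moreover have "poly v x \<noteq> 0" if "poly u2 x = 0" for x using less.prems(2)[of x] that by (simp add: u1 u2)
    ultimately obtain s where "u2 = s\<^sup>2" using less.hyps e2 by blast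
    then have "u = (?l * s)\<^sup>2" unfolding u1 u2 by (simp only: power2_eq_square mult_ac)
    then show ?thesis ..
  qed
qed

text \<open>The units of \<open>K[T]\<close>: a product is one only if every factor is.\<close>

definition nzconst :: "'a::field poly \<Rightarrow> bool" where
  "nzconst p \<longleftrightarrow> p \<noteq> 0 \<and> degree p = 0"

lemma nzconst_iff: "nzconst p \<longleftrightarrow> (\<exists>c. c \<noteq> 0 \<and> p = [:c:])"
  by (auto simp: nzconst_def elim!: degree_eq_zeroE)

lemma nzconst_mult: "nzconst (p * q) \<longleftrightarrow> nzconst p \<and> nzconst q"
  by (auto simp: nzconst_def degree_mult_eq)

lemma nzconst_power: "0 < n \<Longrightarrow> nzconst (p ^ n) \<longleftrightarrow> nzconst p"
  by (auto simp: nzconst_def degree_power_eq)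

subsection \<open>Weighted homogeneous binary forms\<close>

text \<open>The values at \<open>(y, z)\<close> of weighted homogeneous polynomials of degree
  \<open>n\<close>. Working with values lets the same notion serve for \<open>y\<close>,
  \<open>z\<close> in \<open>K[T]\<close> and for variables of \<open>mpoly3\<close>.\<close>

inductive bform :: "('a \<Rightarrow> 'b::comm_ring_1) \<Rightarrow> nat \<Rightarrow> nat \<Rightarrow> 'b \<Rightarrow> 'b \<Rightarrow> nat \<Rightarrow> 'b \<Rightarrow> bool"
  for \<kappa> w1 w2 y z n where
  bform_zero: "bform \<kappa> w1 w2 y z n 0"
| bform_add: "bform \<kappa> w1 w2 y z n u \<Longrightarrow> bform \<kappa> w1 w2 y z n v \<Longrightarrow> bform \<kappa> w1 w2 y z n (u + v)"
| bform_mono: "w1 * i + w2 * j = n \<Longrightarrow> bform \<kappa> w1 w2 y z n (\<kappa> c * y ^ i * z ^ j)"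

lemma bform_sum:
  "(\<And>a. a \<in> A \<Longrightarrow> bform \<kappa> w1 w2 y z n (f a)) \<Longrightarrow> bform \<kappa> w1 w2 y z n (sum f A)"
  by (induction A rule: infinite_finite_induct) (auto intro: bform.intros)

lemma bform_mult:
  assumes \<kappa>: "rhom \<kappa>" and "bform \<kappa> w1 w2 y z n u" "bform \<kappa> w1 w2 y z k v"
  shows "bform \<kappa> w1 w2 y z (n + k) (u * v)"
  using assms(2)
proof induction
  case (bform_mono i j c)
  note 1 = bform_mono
  show ?case
    using assms(3)
  proof induction
    case (bform_mono i' j' c')
    have "\<kappa> c * y ^ i * z ^ j * (\<kappa> c' * y ^ i' * z ^ j') = \<kappa> (c * c') * y ^ (i + i') * z ^ (j + j')"
      by (simp add: rhomD[OF \<kappa>] power_add algebra_simps)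
    then show ?case
      by (simp only:) (rule bform.bform_mono, use 1 bform_mono in \<open>simp add: algebra_simps\<close>)
  qed (auto simp: algebra_simps intro: bform.intros)
qed (auto simp: algebra_simps intro: bform.intros)

lemma bform_power:
  assumes "rhom \<kappa>" "bform \<kappa> w1 w2 y z n u" "k * n = l"
  shows "bform \<kappa> w1 w2 y z l (u ^ k)"
  using assms(3)
proof (induction k arbitrary: l)
  case 0
  then show ?case using bform_mono[of w1 0 w2 0 0 \<kappa> y z 1] by (simp add: rhomD[OF assms(1)])
next
  case (Suc k)
  then show ?case using bform_mult[OF assms(1,2) Suc.IH[OF refl]] by simp
qed

text \<open>Splits a binary form into linear factors; the power of \<open>B\<close> collects the
  roots at infinity, present when \<open>q\<close> has degree below \<open>M\<close>.\<close>

lemma factor_homogenized: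
  fixes \<kappa> :: "'a::field \<Rightarrow> 'b::comm_ring_1"
  assumes ac: "alg_closed_field TYPE('a)" and \<kappa>: "rhom \<kappa>" and "degree q \<le> M"
  shows "\<exists>c rs. length rs \<le> M \<and> (q \<noteq> 0 \<longrightarrow> c \<noteq> 0) \<and> (degree q = M \<longrightarrow> length rs = M) \<and>
    (\<Sum>k\<le>M. \<kappa> (coeff q k) * A ^ k * B ^ (M - k)) = \<kappa> c * B ^ (M - length rs) * prod_list (map (\<lambda>r. A - \<kappa> r * B) rs)"
  using assms(3)
proof (induction M arbitrary: q)
  case 0
  then obtain c where "q = [:c:]" by (auto elim: degree_eq_zeroE)
  then show ?case by (intro exI[of _ c] exI[of _ "[]"]) simp
next
  case (Suc M)
  show ?case
  proof (cases "degree q \<le> M")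
    case True
    obtain c rs where c: "length rs \<le> M" "q \<noteq> 0 \<longrightarrow> c \<noteq> 0"
      "(\<Sum>k\<le>M. \<kappa> (coeff q k) * A ^ k * B ^ (M - k)) = \<kappa> c * B ^ (M - length rs) * prod_list (map (\<lambda>r. A - \<kappa> r * B) rs)"
      using Suc.IH[OF True] by blast
    have "coeff q (Suc M) = 0" using True by (simp add: coeff_eq_0)
    then have "(\<Sum>k\<le>Suc M. \<kappa> (coeff q k) * A ^ k * B ^ (Suc M - k))
       = (\<Sum>k\<le>M. \<kappa> (coeff q k) * A ^ k * B ^ (Suc M - k))" by (simp add: rhomD[OF \<kappa>])
    also have "\<dots> = (\<Sum>k\<le>M. B * (\<kappa> (coeff q k) * A ^ k * B ^ (M - k)))"
      by (intro sum.cong) (auto simp: Suc_diff_le algebra_simps)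
    also have "\<dots> = \<kappa> c * B ^ (Suc M - length rs) * prod_list (map (\<lambda>r. A - \<kappa> r * B) rs)"
      using c(1) by (simp only: sum_distrib_left[symmetric] c(3)) (simp add: Suc_diff_le algebra_simps)
    finally show ?thesis using c True by (intro exI[of _ c] exI[of _ rs]) auto
  next
    case False
    then have dq: "degree q = Suc M" using Suc.prems by simp
    then obtain r where "poly q r = 0" using ac unfolding alg_closed_field_def by (metis le_add1 plus_1_eq_Suc)
    then obtain q' where q': "q = [:- r, 1:] * q'" by (auto simp: poly_eq_0_iff_dvd)
    have "q' \<noteq> 0" using dq q' by auto
    then have "degree q' = M" using dq unfolding q' by (subst (asm) degree_mult_eq) auto
    then obtain c rs where c: "length rs = M" "c \<noteq> 0"
      "(\<Sum>k\<le>M. \<kappa> (coeff q' k) * A ^ k * B ^ (M - k)) = \<kappa> c * B ^ (M - length rs) * prod_list (map (\<lambda>r. A - \<kappa> r * B) rs)"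
      using Suc.IH[of q'] \<open>q' \<noteq> 0\<close> by auto
    let ?t = "\<lambda>k. \<kappa> (coeff q' k) * A ^ k * B ^ (M - k)"
    have q: "coeff q 0 = - r * coeff q' 0" "coeff q (Suc k) = coeff q' k - r * coeff q' (Suc k)" for k
      by (simp_all add: q')
    have z: "coeff q' (Suc M) = 0" using \<open>degree q' = M\<close> by (simp add: coeff_eq_0)
    have "(\<Sum>k\<le>Suc M. \<kappa> (coeff q k) * A ^ k * B ^ (Suc M - k))
       = \<kappa> (coeff q 0) * B ^ Suc M + (\<Sum>k\<le>M. \<kappa> (coeff q (Suc k)) * A ^ Suc k * B ^ (M - k))"
      by (simp add: sum.atMost_Suc_shift del: sum.atMost_Suc)
    also have "\<dots> = (\<Sum>k\<le>M. A * ?t k) - (\<kappa> r * \<kappa> (coeff q' 0) * B ^ Suc M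
         + (\<Sum>k\<le>M. \<kappa> r * \<kappa> (coeff q' (Suc k)) * A ^ Suc k * B ^ (M - k)))"
      by (simp add: q rhomD[OF \<kappa>] algebra_simps sum_subtractf)
    also have "\<kappa> r * \<kappa> (coeff q' 0) * B ^ Suc M
         + (\<Sum>k\<le>M. \<kappa> r * \<kappa> (coeff q' (Suc k)) * A ^ Suc k * B ^ (M - k))
      = (\<Sum>k\<le>Suc M. \<kappa> r * \<kappa> (coeff q' k) * A ^ k * B ^ (Suc M - k))"
      by (simp add: sum.atMost_Suc_shift del: sum.atMost_Suc)
    also have "\<dots> = (\<Sum>k\<le>M. \<kappa> r * \<kappa> (coeff q' k) * A ^ k * B ^ (Suc M - k))"
      by (simp add: z rhomD[OF \<kappa>])
    also have "\<dots> = (\<Sum>k\<le>M. (\<kappa> r * B) * ?t k)"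
      by (intro sum.cong) (auto simp: Suc_diff_le algebra_simps)
    also have "(\<Sum>k\<le>M. A * ?t k) - (\<Sum>k\<le>M. (\<kappa> r * B) * ?t k) = (A - \<kappa> r * B) * (\<Sum>k\<le>M. ?t k)"
      by (simp only: sum_distrib_left[symmetric] left_diff_distrib)
    also have "\<dots> = \<kappa> c * B ^ (Suc M - length (r # rs)) * prod_list (map (\<lambda>r. A - \<kappa> r * B) (r # rs))"
      unfolding c(3) by (simp add: algebra_simps)
    finally show ?thesis using c(1,2) by (intro exI[of _ c] exI[of _ "r # rs"]) auto
  qed
qed

text \<open>The exponent pairs of degree \<open>n\<close> form an arithmetic progression with step
  \<open>(e1, -e2)\<close>. Removing the common monomial leaves an ordinary form of degree
  \<open>M\<close> in \<open>y ^ e1\<close> and \<open>z ^ e2\<close>.\<close>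

lemma bform_normal:
  assumes \<kappa>: "rhom \<kappa>" and w: "0 < g" "0 < e1" "0 < e2" "coprime e1 e2" and b: "bform \<kappa> (g * e2) (g * e1) y z n u"
  shows "u = 0 \<or> (\<exists>i j M q. g * e2 * i + g * e1 * j + M * (g * e1 * e2) = n \<and> degree q \<le> M \<and>
    u = y ^ i * z ^ j * (\<Sum>k\<le>M. \<kappa> (coeff q k) * (y ^ e1) ^ k * (z ^ e2) ^ (M - k)))"
proof (cases "\<exists>i j. g * e2 * i + g * e1 * j = n")
  case False
  have "u = 0" using b by induction (use False in auto)
  then show ?thesis ..
next
  case True
  define i0 where "i0 = (LEAST i. \<exists>j. g * e2 * i + g * e1 * j = n)"
  have "\<exists>j. g * e2 * i0 + g * e1 * j = n" unfolding i0_def by (rule LeastI_ex[OF True])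
  then obtain J where J: "g * e2 * i0 + g * e1 * J = n" ..
  \<comment> \<open>\<open>J\<close> accompanies the least \<open>i\<close>, so \<open>j\<close> can
    only descend from it in steps of \<open>e2\<close>; \<open>M\<close> is the largest number of
    steps.\<close>
  define j0 M where "j0 = J mod e2" and "M = J div e2"
  have Jeq: "J = j0 + e2 * M" by (simp add: j0_def M_def)
  have sol: "\<exists>k\<le>M. i = i0 + e1 * k \<and> j = j0 + e2 * (M - k)" if ij: "g * e2 * i + g * e1 * j = n" for i j
  proof -
    have "i0 \<le> i" unfolding i0_def by (rule Least_le) (use ij in blast)
    then obtain k' where k': "i = i0 + k'" using le_Suc_ex by blast
    have "g * (e2 * k' + e1 * j) = g * (e1 * J)" using ij J by (simp add: k' algebra_simps)
    then have e: "e2 * k' + e1 * j = e1 * J" using w(1) by simp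
    then have "e1 dvd e2 * k'" by (metis dvd_add_left_iff dvd_triv_left)
    then have "e1 dvd k'" using w(4) by (simp add: coprime_dvd_mult_right_iff)
    then obtain k where k: "k' = e1 * k" ..
    have "e1 * (e2 * k + j) = e1 * J" using e by (simp add: k algebra_simps)
    then have "e2 * k + j = J" using w(2) by simp
    then have "e2 * k \<le> J" by simp
    then have "k \<le> M" unfolding M_def using w(3) by (simp add: less_eq_div_iff_mult_less_eq mult.commute)
    moreover have "j = j0 + e2 * (M - k)"
      using \<open>e2 * k + j = J\<close> \<open>k \<le> M\<close> Jeq by (simp add: diff_mult_distrib2)
    ultimately show ?thesis using k' k by blast
  qed
  have "\<exists>q. degree q \<le> M \<and> u = y ^ i0 * z ^ j0 * (\<Sum>k\<le>M. \<kappa> (coeff q k) * (y ^ e1) ^ k * (z ^ e2) ^ (M - k))"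
    using b
  proof induction
    case bform_zero
    show ?case by (intro exI[of _ 0]) (simp add: rhomD[OF \<kappa>])
  next
    case (bform_add u v)
    then obtain p q where "degree p \<le> M" "u = y ^ i0 * z ^ j0 * (\<Sum>k\<le>M. \<kappa> (coeff p k) * (y ^ e1) ^ k * (z ^ e2) ^ (M - k))"
      "degree q \<le> M" "v = y ^ i0 * z ^ j0 * (\<Sum>k\<le>M. \<kappa> (coeff q k) * (y ^ e1) ^ k * (z ^ e2) ^ (M - k))" by blast
    then show ?case
      by (intro exI[of _ "p + q"]) (simp add: degree_add_le rhomD[OF \<kappa>] sum.distrib algebra_simps)
  next
    case (bform_mono i j c)
    from sol[OF this] obtain k where k: "k \<le> M" "i = i0 + e1 * k" "j = j0 + e2 * (M - k)" by blast
    have "(\<Sum>l\<le>M. \<kappa> (coeff (monom c k) l) * (y ^ e1) ^ l * (z ^ e2) ^ (M - l))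
       = (\<Sum>l\<le>M. if l = k then \<kappa> c * (y ^ e1) ^ k * (z ^ e2) ^ (M - k) else 0)"
      by (intro sum.cong) (auto simp: rhomD[OF \<kappa>])
    then show ?case using k(1)
      by (intro exI[of _ "monom c k"])
         (simp add: k(2,3) power_add power_mult mult_ac order_trans[OF degree_monom_le])
  qed
  then obtain q where q: "degree q \<le> M" "u = y ^ i0 * z ^ j0 * (\<Sum>k\<le>M. \<kappa> (coeff q k) * (y ^ e1) ^ k * (z ^ e2) ^ (M - k))"
    by blast
  have "g * e2 * i0 + g * e1 * j0 + M * (g * e1 * e2) = n" using J by (simp add: Jeq algebra_simps)
  with q show ?thesis by blast
qed

lemma bform_factor:
  fixes \<kappa> :: "'a::field \<Rightarrow> 'b::comm_ring_1"
  assumes ac: "alg_closed_field TYPE('a)" and \<kappa>: "rhom \<kappa>"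
    and w: "0 < g" "0 < e1" "0 < e2" "coprime e1 e2" and b: "bform \<kappa> (g * e2) (g * e1) y z n u" and u: "u \<noteq> 0"
  obtains c i j rs where "c \<noteq> 0" "u = \<kappa> c * y ^ i * z ^ j * prod_list (map (\<lambda>r. y ^ e1 - \<kappa> r * z ^ e2) rs)"
    "g * e2 * i + g * e1 * j + length rs * (g * e1 * e2) = n"
proof -
  obtain i j M q where 1: "g * e2 * i + g * e1 * j + M * (g * e1 * e2) = n" "degree q \<le> M"
    "u = y ^ i * z ^ j * (\<Sum>k\<le>M. \<kappa> (coeff q k) * (y ^ e1) ^ k * (z ^ e2) ^ (M - k))"
    using bform_normal[OF \<kappa> w b] u by blast
  obtain c rs where c: "length rs \<le> M" "q \<noteq> 0 \<longrightarrow> c \<noteq> 0"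
    "(\<Sum>k\<le>M. \<kappa> (coeff q k) * (y ^ e1) ^ k * (z ^ e2) ^ (M - k))
      = \<kappa> c * (z ^ e2) ^ (M - length rs) * prod_list (map (\<lambda>r. y ^ e1 - \<kappa> r * z ^ e2) rs)"
    using factor_homogenized[OF ac \<kappa> 1(2)] by blast
  have "q \<noteq> 0" using u 1(3) by (auto simp: rhomD[OF \<kappa>])
  moreover have "u = \<kappa> c * y ^ i * z ^ (j + e2 * (M - length rs)) * prod_list (map (\<lambda>r. y ^ e1 - \<kappa> r * z ^ e2) rs)"
    unfolding 1(3) c(3) by (simp add: power_add power_mult mult_ac)
  moreover have "g * e2 * i + g * e1 * (j + e2 * (M - length rs)) + length rs * (g * e1 * e2) = n"
  proof -
    obtain l where "M = length rs + l" using c(1) le_Suc_ex by blast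
    with 1(1) show ?thesis by (simp add: algebra_simps)
  qed
  ultimately show ?thesis using that c(2) by blast
qed

text \<open>Positive degree guarantees at least one nontrivial factor, and factors of a unit are
  units.\<close>

lemma bform_nzconst:
  fixes y z u :: "'a::field poly"
  assumes ac: "alg_closed_field TYPE('a)"
    and w: "0 < g" "0 < e1" "0 < e2" "coprime e1 e2" "w1 = g * e2" "w2 = g * e1"
    and b: "bform (\<lambda>c. [:c:]) w1 w2 y z n u" and n: "0 < n" and u: "nzconst u"
  shows "nzconst y \<or> nzconst z \<or> (\<exists>r. nzconst (y ^ e1 - [:r:] * z ^ e2))"
proof -
  have "u \<noteq> 0" using u by (simp add: nzconst_def)
  then obtain c i j rs where c: "u = [:c:] * y ^ i * z ^ j * prod_list (map (\<lambda>r. y ^ e1 - [:r:] * z ^ e2) rs)"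
    "g * e2 * i + g * e1 * j + length rs * (g * e1 * e2) = n"
    using bform_factor[OF ac rhom_pCons w(1-4) b[unfolded w(5,6)]] by metis
  have nz: "nzconst (y ^ i)" "nzconst (z ^ j)" "nzconst (prod_list (map (\<lambda>r. y ^ e1 - [:r:] * z ^ e2) rs))"
    using u unfolding c(1) nzconst_mult by auto
  have "0 < i \<or> 0 < j \<or> rs \<noteq> []" using c(2) n by auto
  moreover have "\<exists>r. nzconst (y ^ e1 - [:r:] * z ^ e2)" if "rs \<noteq> []"
    using that nz(3) by (cases rs) (auto simp only: list.map prod_list.Cons nzconst_mult)
  ultimately show ?thesis using nz(1,2) nzconst_power by metis
qed

text \<open>Modulo \<open>X\<^sup>K = G\<close> a weighted homogeneous polynomial whose \<open>X\<close>-exponents all lie in one residue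
  class modulo \<open>K\<close> becomes a power of \<open>X\<close> times a binary form.\<close>
lemma bform_reduce:
  assumes \<kappa>: "rhom \<kappa>" and G: "X ^ K = G" "bform \<kappa> w1 w2 y z (K * w3) G"
    and S: "\<And>m. m \<in> S \<Longrightarrow> w1 * i m + w2 * j m + w3 * k m = n \<and> k m mod K = \<epsilon>"
    and u: "u = (\<Sum>m\<in>S. \<kappa> (f m) * y ^ i m * z ^ j m * X ^ k m)" "u \<noteq> 0"
  shows "\<exists>v n'. n = n' + \<epsilon> * w3 \<and> u = X ^ \<epsilon> * v \<and> bform \<kappa> w1 w2 y z n' v"
proof -
  let ?t = "\<lambda>m. \<kappa> (f m) * y ^ i m * z ^ j m * G ^ (k m div K)"
  have "S \<noteq> {}" using u by auto
  then obtain m0 where m0: "m0 \<in> S" by blast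
  define n' where "n' = n - \<epsilon> * w3"
  have d: "k m = K * (k m div K) + \<epsilon>" if "m \<in> S" for m
    using S[OF that] by (metis mult_div_mod_eq)
  have "\<epsilon> * w3 \<le> n"
  proof -
    have "\<epsilon> * w3 \<le> k m0 * w3" by (rule mult_right_mono) (subst d[OF m0], auto)
    also have "\<dots> \<le> n" using S[OF m0] by (simp add: algebra_simps)
    finally show ?thesis .
  qed
  then have n: "n = n' + \<epsilon> * w3" by (simp add: n'_def)
  have "\<kappa> (f m) * y ^ i m * z ^ j m * X ^ k m = X ^ \<epsilon> * ?t m" if "m \<in> S" for m
    by (subst d[OF that]) (simp add: power_add power_mult G algebra_simps)
  then have "u = X ^ \<epsilon> * sum ?t S" unfolding u by (simp add: sum_distrib_left)
  moreover have "bform \<kappa> w1 w2 y z n' (?t m)" if "m \<in> S" for m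
  proof -
    have "w1 * i m + w2 * j m + w3 * (K * (k m div K) + \<epsilon>) = n" using S[OF that] d[OF that] by metis
    then have "(w1 * i m + w2 * j m) + (k m div K) * (K * w3) = n'" unfolding n by (simp add: algebra_simps)
    then show ?thesis
      using bform_mult[OF \<kappa> bform_mono[OF refl] bform_power[OF \<kappa> G(2) refl, of "k m div K"]] by metis
  qed
  then have "bform \<kappa> w1 w2 y z n' (sum ?t S)" by (rule bform_sum)
  ultimately show ?thesis using n by blast
qed

subsection \<open>Surfaces without polynomial curves in the level sets of a homogeneous function\<close>

lemma pev_eq:
  "pev h x y z = (\<Sum>m\<in>keys h. [:lookup h m:] * x ^ fst m * y ^ fst (snd m) * z ^ snd (snd m))"
  by (simp add: ev_def case_prod_unfold)

lemma whom_keysD: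
  assumes "whom (d1,d2,d3) (int n) h" "m \<in> keys h"
  shows "d1 * fst m + d2 * fst (snd m) + d3 * snd (snd m) = n"
proof -
  obtain a b c where m: "m = (a,b,c)" by (cases m)
  have "int (wdeg_mono (d1,d2,d3) m) = int n" using assms by (simp add: wset_def)
  then show ?thesis by (simp only: of_nat_eq_iff) (simp add: wdeg_mono_def m)
qed

lemma div_eqI_nat: "n = g * k \<Longrightarrow> 0 < g \<Longrightarrow> n div g = (k::nat)"
  by simp

lemma degree_0_power: "0 < n \<Longrightarrow> degree ((p::'a::idom poly) ^ n) = 0 \<longleftrightarrow> degree p = 0"
  by (cases "p = 0") (auto simp: degree_power_eq zero_power)

lemma degree_0_closed:
  fixes p q :: "'a::idom poly"
  assumes "degree p = 0"
  shows "degree q = 0 \<Longrightarrow> degree (p + q) = 0" "degree q = 0 \<Longrightarrow> degree (p - q) = 0"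
    "degree q = 0 \<Longrightarrow> degree (p * q) = 0" "degree (p ^ n) = 0" "degree (smult c p) = 0"
  using assms by (auto simp: poly_const_pow elim!: degree_eq_zeroE)

lemma nzconstE: assumes "nzconst p" obtains c where "c \<noteq> 0" "p = [:c:]"
  using assms by (auto simp: nzconst_iff)

lemma add3_eq_0: "a + b + c = 0 \<Longrightarrow> a = - b - c" "a + b + c = 0 \<Longrightarrow> b = - a - c"
  for a :: "'a::ab_group_add"
proof -
  have "a = (a + b + c) - b - c" "b = (a + b + c) - a - c" by simp_all
  then show "a + b + c = 0 \<Longrightarrow> a = - b - c" "a + b + c = 0 \<Longrightarrow> b = - a - c" by simp_all
qed

lemma poly_ext: "(\<And>x. poly p x = poly q x) \<Longrightarrow> p = q"
  for p q :: "'a::field_char_0 poly"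
  by (simp add: fun_eq_iff flip: poly_eq_poly_eq_iff)

lemma smult_eq_imp: "smult \<alpha> p = q \<Longrightarrow> (\<alpha>::'a::field) \<noteq> 0 \<Longrightarrow> p = smult (1 / \<alpha>) q"
  by auto

lemma bform_smult: "w1 * i + w2 * j = n \<Longrightarrow> bform (\<lambda>c. [:c:]) w1 w2 y z n (smult c (y ^ i * z ^ j))"
  using bform_mono[of w1 i w2 j n "\<lambda>c. [:c:]" y z c] by simp

locale homogeneous_curve =
  fixes x1 x2 x3 :: "'a::field_char_0 poly" and h :: "'a mpoly3" and d1 d2 d3 n :: nat
  assumes ac: "alg_closed_field TYPE('a)" and hom: "whom (d1,d2,d3) (int n) h" and n: "0 < n"
    and const: "nzconst (pev h x1 x2 x3)" and d_pos: "0 < d1"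
begin

text \<open>On the surface the function becomes \<open>X ^ \<epsilon>\<close> times a binary form.
  If \<open>\<epsilon> > 0\<close>, then \<open>X\<close> divides a unit; otherwise the binary form
  has the full degree \<open>n > 0\<close> and factors.\<close>

lemma bform_cases:
  assumes X: "X ^ K = G" "bform (\<lambda>c. [:c:]) w1 w2 y z (K * w3) G"
    and m: "\<And>m. m \<in> keys h \<Longrightarrow> w1 * i m + w2 * j m + w3 * k m = n \<and> k m mod K = \<epsilon>"
    and u: "pev h x1 x2 x3 = (\<Sum>m\<in>keys h. [:lookup h m:] * y ^ i m * z ^ j m * X ^ k m)"
    and w: "0 < g" "0 < e1" "0 < e2" "coprime e1 e2" "w1 = g * e2" "w2 = g * e1"
  obtains "nzconst X" | "nzconst y" | "nzconst z" | r where "nzconst (y ^ e1 - [:r:] * z ^ e2)"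
proof -
  have nz: "pev h x1 x2 x3 \<noteq> 0" using const by (simp add: nzconst_def)
  obtain v n' where v: "n = n' + \<epsilon> * w3" "pev h x1 x2 x3 = X ^ \<epsilon> * v" "bform (\<lambda>c. [:c:]) w1 w2 y z n' v"
    using bform_reduce[OF rhom_pCons X m u nz] by blast
  have nzv: "nzconst (X ^ \<epsilon>)" "nzconst v" using const unfolding v(2) nzconst_mult by auto
  show thesis
  proof (cases "\<epsilon> = 0")
    case True
    then have "0 < n'" using v(1) n by simp
    from bform_nzconst[OF ac w v(3) this nzv(2)] show ?thesis using that by blast
  next
    case False
    then show ?thesis using nzv(1) nzconst_power that by blast
  qed
qed

lemma bform_cases_square:
  assumes X: "x3\<^sup>2 = G" "bform (\<lambda>c. [:c:]) d2 d1 x2 x1 (2 * d3) G"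
    and m: "\<And>m. m \<in> keys h \<Longrightarrow> snd (snd m) mod 2 = \<epsilon>"
    and w: "0 < g" "0 < e1" "0 < e2" "coprime e1 e2" "d2 = g * e2" "d1 = g * e1"
  obtains "nzconst x3" | "nzconst x2" | "nzconst x1" | r where "nzconst (x2 ^ e1 - [:r:] * x1 ^ e2)"
proof (rule bform_cases[OF X _ _ w, where i = "\<lambda>m. fst (snd m)" and j = fst and k = "\<lambda>m. snd (snd m)"])
  fix m assume "m \<in> keys h"
  then show "d2 * fst (snd m) + d1 * fst m + d3 * snd (snd m) = n \<and> snd (snd m) mod 2 = \<epsilon>"
    using whom_keysD[OF hom] m by (simp add: algebra_simps)
next
  show "pev h x1 x2 x3 = (\<Sum>m\<in>keys h. [:lookup h m:] * x2 ^ fst (snd m) * x1 ^ fst m * x3 ^ snd (snd m))"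
    unfolding pev_eq by (simp only: mult_ac)
qed

lemma binomial_factor:
  assumes "nzconst (x2 ^ k - [:r:] * x1 ^ m)" and km: "2 \<le> k" "2 \<le> m"
    and c2: "nzconst x2 \<Longrightarrow> P" and P: "degree x1 = 0 \<Longrightarrow> degree x2 = 0 \<Longrightarrow> P"
  shows P
proof -
  obtain u where u: "u \<noteq> 0" "x2 ^ k - [:r:] * x1 ^ m = [:u:]" using assms(1) by (elim nzconstE)
  then have e: "x2 ^ k = smult r (x1 ^ m) + [:u:]" by (simp add: algebra_simps)
  show P
  proof (cases "r = 0")
    case False
    then show P using power_eq_binomial[OF ac km u(1) _ e] P by blast
  next
    case True
    then have "nzconst (x2 ^ k)" using e u(1) by (simp add: nzconst_def)
    then show P using c2 km by (simp add: nzconst_power)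
  qed
qed

text \<open>The singularity \<open>E8\<close>: the degree relations force weights proportional to
  (6, 10, 15). One of the coordinates, or a binomial in x1 and x2, is constant along the curve, and
  this leads to an equation y^k = g(z) with simple roots.\<close>

lemma const_E8:
  assumes eq: "x3\<^sup>2 + smult \<alpha> (x2 ^ 3) + smult \<beta> (x1 ^ 5) = 0" and nz: "\<alpha> \<noteq> 0" "\<beta> \<noteq> 0"
    and d: "5 * d1 = 3 * d2" "2 * d3 = 3 * d2"
  shows "degree x1 = 0 \<and> degree x2 = 0 \<and> degree x3 = 0"
proof -
  have "3 dvd d1" using d(1) by presburger
  then obtain k where k: "d1 = 3 * k" by (elim dvdE)
  then have "d2 = 5 * k" "even k" using d by presburger+
  then obtain g where g: "d1 = 6 * g" "d2 = 10 * g" "d3 = 15 * g" using k d(2) by (auto elim!: evenE)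
  then have g0: "0 < g" using d_pos by simp
  \<comment> \<open>Of 6, 10, 15 only the weight of x3 is odd, so \<open>n\<close> fixes the parity
    of its exponent.\<close>
  have par: "snd (snd m) mod 2 = (n div g) mod 2" if "m \<in> keys h" for m
  proof -
    have "n = g * (2 * (3 * fst m + 5 * fst (snd m) + 7 * snd (snd m)) + snd (snd m))"
      using whom_keysD[OF hom that] by (simp add: g algebra_simps)
    then have "n div g = 2 * (3 * fst m + 5 * fst (snd m) + 7 * snd (snd m)) + snd (snd m)" using g0 by (rule div_eqI_nat)
    then show ?thesis by (simp only: mod_mult_self4)
  qed
  have sq: "x3\<^sup>2 = smult (- \<alpha>) (x2 ^ 3 * x1 ^ 0) + smult (- \<beta>) (x2 ^ 0 * x1 ^ 5)"
    using add3_eq_0(1)[OF eq] by simp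
  have degree_x3: "degree x3 = 0" if "degree x1 = 0" "degree x2 = 0"
  proof -
    have "degree (x3\<^sup>2) = 0" unfolding sq by (intro degree_0_closed that)
    then show ?thesis by (simp add: degree_0_power)
  qed
  have c1: ?thesis if z: "nzconst x1"
  proof -
    obtain a where a: "a \<noteq> 0" "x1 = [:a:]" using z by (elim nzconstE)
    have "x3\<^sup>2 = smult (- \<alpha>) (x2 ^ 3) + [:- \<beta> * a ^ 5:]"
      using sq a(2) by (simp add: poly_const_pow)
    from power_eq_binomial[OF ac _ _ _ _ this] show ?thesis using nz a by auto
  qed
  have c2: ?thesis if z: "nzconst x2"
  proof -
    obtain a where a: "a \<noteq> 0" "x2 = [:a:]" using z by (elim nzconstE)
    have "x3\<^sup>2 = smult (- \<beta>) (x1 ^ 5) + [:- \<alpha> * a ^ 3:]"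
      using sq a(2) by (simp add: poly_const_pow algebra_simps)
    from power_eq_binomial[OF ac _ _ _ _ this] show ?thesis using nz a by auto
  qed
  show ?thesis
  proof (rule bform_cases_square[OF sq _ par, of "2 * g" 3 5])
    show "bform (\<lambda>c. [:c:]) d2 d1 x2 x1 (2 * d3) (smult (- \<alpha>) (x2 ^ 3 * x1 ^ 0) + smult (- \<beta>) (x2 ^ 0 * x1 ^ 5))"
      by (intro bform_add bform_smult) (simp_all add: g)
    show "coprime (3::nat) 5" by (simp add: coprime_iff_gcd_eq_1 gcd_non_0_nat)
  next
    assume "nzconst x3"
    then obtain a where a: "a \<noteq> 0" "x3 = [:a:]" by (elim nzconstE)
    have "smult \<alpha> (x2 ^ 3) = smult (- \<beta>) (x1 ^ 5) + [:- a\<^sup>2:]"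
      using add3_eq_0(2)[OF eq] a(2) by (simp add: poly_const_pow)
    from smult_eq_imp[OF this nz(1)]
    have "x2 ^ 3 = smult (- \<beta> / \<alpha>) (x1 ^ 5) + [:- a\<^sup>2 / \<alpha>:]" by (simp add: smult_add_right smult_diff_right)
    from power_eq_binomial[OF ac _ _ _ _ this] show ?thesis using nz a by auto
  next
    fix r assume "nzconst (x2 ^ 3 - [:r:] * x1 ^ 5)"
    then show ?thesis
      by (rule binomial_factor) (use c2 degree_x3 in auto)
  qed (use g g0 c1 c2 in auto)
qed

text \<open>The singularity \<open>E7\<close>, with weights proportional to (4, 6, 9). If x3 is
  constant, the equation makes x2 a factor of a unit.\<close>

lemma const_E7:
  assumes eq: "x3\<^sup>2 + smult \<alpha> (x2 ^ 3) + smult \<beta> (x1 ^ 3 * x2) = 0" and nz: "\<alpha> \<noteq> 0" "\<beta> \<noteq> 0"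
    and d: "3 * d1 = 2 * d2" "2 * d3 = 3 * d2"
  shows "degree x1 = 0 \<and> degree x2 = 0 \<and> degree x3 = 0"
proof -
  have "2 dvd d1" using d(1) by presburger
  then obtain k where k: "d1 = 2 * k" by (elim dvdE)
  then have "d2 = 3 * k" "even k" using d by presburger+
  then obtain g where g: "d1 = 4 * g" "d2 = 6 * g" "d3 = 9 * g" using k d(2) by (auto elim!: evenE)
  then have g0: "0 < g" using d_pos by simp
  have par: "snd (snd m) mod 2 = (n div g) mod 2" if "m \<in> keys h" for m
  proof -
    have "n = g * (2 * (2 * fst m + 3 * fst (snd m) + 4 * snd (snd m)) + snd (snd m))"
      using whom_keysD[OF hom that] by (simp add: g algebra_simps)
    then have "n div g = 2 * (2 * fst m + 3 * fst (snd m) + 4 * snd (snd m)) + snd (snd m)" using g0 by (rule div_eqI_nat)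
    then show ?thesis by (simp only: mod_mult_self4)
  qed
  have sq: "x3\<^sup>2 = smult (- \<alpha>) (x2 ^ 3 * x1 ^ 0) + smult (- \<beta>) (x2 ^ 1 * x1 ^ 3)"
    using add3_eq_0(1)[OF eq] by (simp add: mult.commute)
  have degree_x3: "degree x3 = 0" if "degree x1 = 0" "degree x2 = 0"
  proof -
    have "degree (x3\<^sup>2) = 0" unfolding sq by (intro degree_0_closed that)
    then show ?thesis by (simp add: degree_0_power)
  qed
  have c1: ?thesis if z: "nzconst x1"
  proof -
    obtain a where a: "a \<noteq> 0" "x1 = [:a:]" using z by (elim nzconstE)
    have "x3\<^sup>2 = x2 * (smult 0 (x2 ^ (2 * 2)) + smult (- \<alpha>) (x2 ^ 2) + [:- \<beta> * a ^ 3:])"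
      unfolding sq a(2) by (rule poly_ext) (simp add: algebra_simps power2_eq_square power3_eq_cube)
    from power_eq_times_quadratic[OF ac _ _ _ _ this] show ?thesis using nz a by auto
  qed
  have c2: ?thesis if z: "nzconst x2"
  proof -
    obtain a where a: "a \<noteq> 0" "x2 = [:a:]" using z by (elim nzconstE)
    have "x3\<^sup>2 = smult (- \<beta> * a) (x1 ^ 3) + [:- \<alpha> * a ^ 3:]"
      using sq a(2) by (simp add: poly_const_pow algebra_simps)
    from power_eq_binomial[OF ac _ _ _ _ this] show ?thesis using nz a by auto
  qed
  show ?thesis
  proof (rule bform_cases_square[OF sq _ par, of "2 * g" 2 3])
    show "bform (\<lambda>c. [:c:]) d2 d1 x2 x1 (2 * d3) (smult (- \<alpha>) (x2 ^ 3 * x1 ^ 0) + smult (- \<beta>) (x2 ^ 1 * x1 ^ 3))"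
      by (intro bform_add bform_smult) (simp_all add: g)
    show "coprime (2::nat) 3" by simp
  next
    assume "nzconst x3"
    then have "nzconst (x3\<^sup>2)" by (simp add: nzconst_power)
    also have "x3\<^sup>2 = x2 * (smult (- \<alpha>) (x2\<^sup>2) + smult (- \<beta>) (x1 ^ 3))"
      unfolding sq by (simp add: algebra_simps power2_eq_square power3_eq_cube)
    finally have "nzconst x2" by (simp add: nzconst_mult)
    then show ?thesis by (rule c2)
  next
    fix r assume "nzconst (x2\<^sup>2 - [:r:] * x1 ^ 3)"
    then show ?thesis
      by (rule binomial_factor) (use c2 degree_x3 in auto)
  qed (use g g0 c1 c2 in auto)
qed

text \<open>The singularity \<open>E6\<close>, with weights proportional to (3, 4, 6). They fix the
  exponent of x2 modulo 3 but not that of x3 modulo 2, so here the cube of x2 is eliminated.\<close>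

lemma const_E6:
  assumes eq: "x3\<^sup>2 + smult \<alpha> (x2 ^ 3) + smult \<beta> (x1 ^ 4) = 0" and nz: "\<alpha> \<noteq> 0" "\<beta> \<noteq> 0"
    and d: "4 * d1 = 3 * d2" "2 * d3 = 3 * d2"
  shows "degree x1 = 0 \<and> degree x2 = 0 \<and> degree x3 = 0"
proof -
  have "3 dvd d1" using d(1) by presburger
  then obtain g where "d1 = 3 * g" by (elim dvdE)
  then have g: "d1 = 3 * g" "d2 = 4 * g" "d3 = 6 * g" using d by presburger+
  then have g0: "0 < g" using d_pos by simp
  have par: "fst (snd m) mod 3 = (n div g) mod 3" if "m \<in> keys h" for m
  proof -
    have "n = g * (3 * (fst m + fst (snd m) + 2 * snd (snd m)) + fst (snd m))"
      using whom_keysD[OF hom that] by (simp add: g algebra_simps)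
    then have "n div g = 3 * (fst m + fst (snd m) + 2 * snd (snd m)) + fst (snd m)" using g0 by (rule div_eqI_nat)
    then show ?thesis by (simp only: mod_mult_self4)
  qed
  have "smult \<alpha> (x2 ^ 3) = - (x3\<^sup>2) - smult \<beta> (x1 ^ 4)" using add3_eq_0(2)[OF eq] .
  from smult_eq_imp[OF this nz(1)]
  have cub: "x2 ^ 3 = smult (- 1 / \<alpha>) (x3 ^ 2 * x1 ^ 0) + smult (- \<beta> / \<alpha>) (x3 ^ 0 * x1 ^ 4)"
    by (simp add: smult_diff_right)
  have c1: ?thesis if z: "nzconst x1"
  proof -
    obtain a where a: "a \<noteq> 0" "x1 = [:a:]" using z by (elim nzconstE)
    have "x2 ^ 3 = smult (- 1 / \<alpha>) (x3 ^ 2) + [:- \<beta> / \<alpha> * a ^ 4:]"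
      using cub a(2) by (simp add: poly_const_pow)
    from power_eq_binomial[OF ac _ _ _ _ this] show ?thesis using nz a by auto
  qed
  have c3: ?thesis if z: "nzconst x3"
  proof -
    obtain a where a: "a \<noteq> 0" "x3 = [:a:]" using z by (elim nzconstE)
    have "x2 ^ 3 = smult (- \<beta> / \<alpha>) (x1 ^ 4) + [:- 1 / \<alpha> * a\<^sup>2:]"
      using cub a(2) by (simp add: poly_const_pow)
    from power_eq_binomial[OF ac _ _ _ _ this] show ?thesis using nz a by auto
  qed
  have c2: ?thesis if z: "nzconst x2"
  proof -
    obtain a where a: "a \<noteq> 0" "x2 = [:a:]" using z by (elim nzconstE)
    have "x3\<^sup>2 = smult (- \<beta>) (x1 ^ 4) + [:- \<alpha> * a ^ 3:]"
      using add3_eq_0(1)[OF eq] a(2) by (simp add: poly_const_pow)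
    from power_eq_binomial[OF ac _ _ _ _ this] show ?thesis using nz a by auto
  qed
  show ?thesis
  proof (rule bform_cases[OF cub, where ?w1.0 = d3 and ?w2.0 = d1 and ?w3.0 = d2 and i = "\<lambda>m. snd (snd m)" and j = fst
        and k = "\<lambda>m. fst (snd m)" and \<epsilon> = "(n div g) mod 3" and g = "3 * g" and ?e1.0 = 1 and ?e2.0 = 2])
    show "bform (\<lambda>c. [:c:]) d3 d1 x3 x1 (3 * d2) (smult (- 1 / \<alpha>) (x3 ^ 2 * x1 ^ 0) + smult (- \<beta> / \<alpha>) (x3 ^ 0 * x1 ^ 4))"
      by (intro bform_add bform_smult) (simp_all add: g)
    show "d3 * snd (snd m) + d1 * fst m + d2 * fst (snd m) = n \<and> fst (snd m) mod 3 = n div g mod 3"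
      if "m \<in> keys h" for m
      using whom_keysD[OF hom that] par[OF that] by (simp add: algebra_simps)
    show "pev h x1 x2 x3 = (\<Sum>m\<in>keys h. [:lookup h m:] * x3 ^ snd (snd m) * x1 ^ fst m * x2 ^ fst (snd m))"
      unfolding pev_eq by (simp only: mult_ac)
  next
    \<comment> \<open>Now x3 is a polynomial in x1^2; inserting it gives a quadratic in x1^2 whose
      discriminant is a nonzero multiple of \<open>\<beta> u^2\<close>.\<close>
    fix r assume "nzconst (x3 ^ 1 - [:r:] * x1\<^sup>2)"
    then obtain u where u: "u \<noteq> 0" "x3 ^ 1 - [:r:] * x1\<^sup>2 = [:u:]" by (elim nzconstE)
    have e: "x3 = smult r (x1\<^sup>2) + [:u:]" using u(2) by (simp add: algebra_simps)
    have q: "x2 ^ 3 = smult (- (r\<^sup>2 + \<beta>) / \<alpha>) (x1 ^ (2 * 2)) + smult (- 2 * u * r / \<alpha>) (x1\<^sup>2) + [:- u\<^sup>2 / \<alpha>:]"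
      unfolding cub e
      using nz by (intro poly_ext) (simp add: power2_eq_square power4_eq_xxxx field_simps)
    have disc: "(- 2 * u * r / \<alpha>)\<^sup>2 \<noteq> 4 * (- (r\<^sup>2 + \<beta>) / \<alpha>) * (- u\<^sup>2 / \<alpha>)"
    proof -
      have "(- 2 * u * r / \<alpha>)\<^sup>2 - 4 * (- (r\<^sup>2 + \<beta>) / \<alpha>) * (- u\<^sup>2 / \<alpha>) = - 4 * \<beta> * u\<^sup>2 / \<alpha>\<^sup>2"
        using nz by (simp add: field_simps power2_eq_square)
      then show ?thesis using nz u(1) by auto
    qed
    have "degree x1 = 0 \<and> degree x2 = 0"
      by (rule power_eq_quadratic[OF ac _ _ _ disc q]) (use nz u(1) in simp_all)
    moreover from this have "degree x3 = 0" unfolding e by (intro degree_0_closed) auto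
    ultimately show ?thesis by simp
  qed (use g g0 c1 c2 c3 in auto)
qed

text \<open>Weights proportional to (2, 2e, 2e + 1), so the parity of the exponent of x3 is
  fixed.\<close>

lemma const_D_even:
  assumes eq: "x3\<^sup>2 + smult \<alpha> (x1 * (x2\<^sup>2 + smult \<gamma> (x1 ^ (2 * e)))) = 0" and nz: "\<alpha> \<noteq> 0" "\<gamma> \<noteq> 0" and e: "1 \<le> e"
    and d: "e * d1 = d2" "2 * d3 = d1 + 2 * d2"
  shows "degree x1 = 0 \<and> degree x2 = 0 \<and> degree x3 = 0"
proof -
  have "even d1" using d(2) by presburger
  then obtain g where g: "d1 = 2 * g" by (elim evenE)
  have g0: "0 < g" using g d_pos by simp
  have d2: "d2 = 2 * g * e" using d(1) g by (simp add: algebra_simps)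
  have d3: "d3 = g + 2 * g * e" using d(2) g d2 by simp
  have par: "snd (snd m) mod 2 = (n div g) mod 2" if "m \<in> keys h" for m
  proof -
    have "n = g * (2 * (fst m + e * fst (snd m) + e * snd (snd m)) + snd (snd m))"
      using whom_keysD[OF hom that] by (simp add: g d2 d3 algebra_simps)
    then have "n div g = 2 * (fst m + e * fst (snd m) + e * snd (snd m)) + snd (snd m)" using g0 by (rule div_eqI_nat)
    then show ?thesis by (simp only: mod_mult_self4)
  qed
  have sq': "x3\<^sup>2 = x1 * (smult (- \<alpha>) (x2\<^sup>2) + smult (- \<alpha> * \<gamma>) (x1 ^ (2 * e)))"
    using iffD2[OF eq_neg_iff_add_eq_0 eq] by (simp add: smult_add_right algebra_simps)
  have sq: "x3\<^sup>2 = smult (- \<alpha>) (x2 ^ 2 * x1 ^ 1) + smult (- \<alpha> * \<gamma>) (x2 ^ 0 * x1 ^ (Suc (2 * e)))"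
    unfolding sq' by (simp add: algebra_simps)
  have c1: ?thesis if z: "nzconst x1"
  proof -
    obtain a where a: "a \<noteq> 0" "x1 = [:a:]" using z by (elim nzconstE)
    have "x3\<^sup>2 = smult (- \<alpha> * a) (x2 ^ 2) + [:- \<alpha> * \<gamma> * a ^ Suc (2 * e):]"
      using sq a(2) by (simp add: poly_const_pow)
    from power_eq_binomial[OF ac _ _ _ _ this] show ?thesis using nz a by auto
  qed
  have c2: ?thesis if z: "nzconst x2"
  proof -
    obtain a where a: "a \<noteq> 0" "x2 = [:a:]" using z by (elim nzconstE)
    have "x3\<^sup>2 = x1 * (smult 0 (x1 ^ (2 * (2 * e))) + smult (- \<alpha> * \<gamma>) (x1 ^ (2 * e)) + [:- \<alpha> * a\<^sup>2:])"
      using sq' a(2) by (simp add: poly_const_pow algebra_simps)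
    from power_eq_times_quadratic[OF ac _ _ _ _ this] show ?thesis using nz a e by auto
  qed
  show ?thesis
  proof (rule bform_cases_square[OF sq _ par, of "2 * g" 1 e])
    show "bform (\<lambda>c. [:c:]) d2 d1 x2 x1 (2 * d3) (smult (- \<alpha>) (x2 ^ 2 * x1 ^ 1) + smult (- \<alpha> * \<gamma>) (x2 ^ 0 * x1 ^ (Suc (2 * e))))"
      by (intro bform_add bform_smult) (simp_all add: g d2 d3)
  next
    assume "nzconst x3"
    then have "nzconst (x3\<^sup>2)" by (simp add: nzconst_power)
    then have "nzconst x1" unfolding sq' by (simp add: nzconst_mult)
    then show ?thesis by (rule c1)
  next
    fix r assume "nzconst (x2 ^ 1 - [:r:] * x1 ^ e)"
    then obtain u where u: "u \<noteq> 0" "x2 ^ 1 - [:r:] * x1 ^ e = [:u:]" by (elim nzconstE)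
    have e2: "x2 = smult r (x1 ^ e) + [:u:]" using u(2) by (simp add: algebra_simps)
    have q: "x3\<^sup>2 = x1 * (smult (- \<alpha> * (r\<^sup>2 + \<gamma>)) (x1 ^ (2 * e)) + smult (- 2 * \<alpha> * u * r) (x1 ^ e) + [:- \<alpha> * u\<^sup>2:])"
      unfolding sq' e2 power_even_eq
      by (rule poly_ext) (simp add: power2_eq_square algebra_simps)
    have disc: "(- 2 * \<alpha> * u * r)\<^sup>2 \<noteq> 4 * (- \<alpha> * (r\<^sup>2 + \<gamma>)) * (- \<alpha> * u\<^sup>2)"
    proof -
      have "(- 2 * \<alpha> * u * r)\<^sup>2 - 4 * (- \<alpha> * (r\<^sup>2 + \<gamma>)) * (- \<alpha> * u\<^sup>2) = - 4 * \<alpha>\<^sup>2 * u\<^sup>2 * \<gamma>"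
        by (simp add: algebra_simps power2_eq_square)
      then show ?thesis using nz u(1) by auto
    qed
    have "degree x1 = 0 \<and> degree x3 = 0"
      by (rule power_eq_times_quadratic[OF ac _ e _ disc q]) (use nz u(1) in simp_all)
    moreover from this have "degree x2 = 0" unfolding e2 by (intro degree_0_closed) auto
    ultimately show ?thesis by simp
  qed (use g g0 d2 e c1 c2 in auto)
qed

text \<open>With \<open>x1 = s\<^sup>2\<close> and \<open>x3 = s r\<close> the equation becomes \<open>r\<^sup>2 + \<alpha> (x2\<^sup>2 + \<gamma> s\<^bsup>2m\<^esup>) = 0\<close>.
  The square roots exist because \<open>x1\<close> and \<open>x2\<close> have no common zero: \<open>h\<close> vanishes at the origin.\<close>
lemma const_D_odd:
  assumes eq: "x3\<^sup>2 + smult \<alpha> (x1 * (x2\<^sup>2 + smult \<gamma> (x1 ^ m))) = 0" and nz: "\<alpha> \<noteq> 0" "\<gamma> \<noteq> 0" and m: "odd m" "2 \<le> m"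
    and d: "m * d1 = 2 * d2" "2 * d3 = d1 + 2 * d2"
  shows "degree x1 = 0 \<and> degree x2 = 0 \<and> degree x3 = 0"
proof -
  have "even d1" using d(2) by presburger
  then obtain g where g: "d1 = 2 * g" by (elim evenE)
  have g0: "0 < g" using g d_pos by simp
  have d2: "d2 = m * g" using d(1) g by simp
  have d3: "d3 = (m + 1) * g" using d(2) g d2 by (simp add: algebra_simps)
  let ?W = "x2\<^sup>2 + smult \<gamma> (x1 ^ m)"
  have sq: "x1 * smult (- \<alpha>) ?W = x3\<^sup>2"
    using iffD2[OF eq_neg_iff_add_eq_0 eq] by simp
  have x12: "poly x2 t \<noteq> 0" if "poly x1 t = 0" for t
  proof
    assume "poly x2 t = 0"
    have "poly (x3\<^sup>2) t = 0" unfolding sq[symmetric] using that by simp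
    then have "poly x3 t = 0" by simp
    have "fst a + fst (snd a) + snd (snd a) \<noteq> 0" if "a \<in> keys h" for a
      using whom_keysD[OF hom that] n by auto
    then have "poly (pev h x1 x2 x3) t = 0"
      unfolding pev_eq poly_sum using \<open>poly x1 t = 0\<close> \<open>poly x2 t = 0\<close> \<open>poly x3 t = 0\<close>
      by (intro sum.neutral) (auto simp: poly_power zero_power)
    then show False using const by (auto elim!: nzconstE)
  qed
  have nc: "poly (smult (- \<alpha>) ?W) t \<noteq> 0" if "poly x1 t = 0" for t
    using x12[OF that] that nz m by (simp add: zero_power)
  obtain s where s: "x1 = s\<^sup>2" using coprime_factor_of_square[OF ac sq nc] by blast
  obtain r where r: "smult (- \<alpha>) ?W = r\<^sup>2"
    using coprime_factor_of_square[OF ac sq[unfolded mult.commute[of x1]]] nc by blast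
  have "x1 * r\<^sup>2 = x3\<^sup>2" using sq unfolding r .
  then have "x3\<^sup>2 = (s * r)\<^sup>2" by (simp add: s power_mult_distrib)
  \<comment> \<open>The sign ambiguity of the square root is absorbed into
    \<open>\<rho>\<close>.\<close>
  then have "\<exists>\<rho>. x3 = s * \<rho> \<and> \<rho>\<^sup>2 = r\<^sup>2" unfolding power2_eq_iff by (metis minus_mult_right power2_minus)
  then obtain \<rho> where \<rho>: "x3 = s * \<rho>" "smult (- \<alpha>) ?W = \<rho>\<^sup>2" using r by metis
  have q: "x2\<^sup>2 = smult (- 1 / \<alpha>) (\<rho> ^ 2 * s ^ 0) + smult (- \<gamma>) (\<rho> ^ 0 * s ^ (2 * m))"
  proof -
    have "?W = smult (1 / - \<alpha>) (\<rho>\<^sup>2)" by (rule smult_eq_imp[OF \<rho>(2)]) (use nz in simp)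
    then have "x2\<^sup>2 = smult (1 / - \<alpha>) (\<rho>\<^sup>2) - smult \<gamma> (x1 ^ m)" by (simp only: eq_diff_eq)
    then show ?thesis by (simp add: s power_mult)
  qed
  \<comment> \<open>The weights are proportional to (2, m, m + 1) with \<open>m\<close> odd, so it
    is the exponent of x2 whose parity is fixed.\<close>
  have par: "fst (snd a) mod 2 = (n div g) mod 2" if "a \<in> keys h" for a
  proof -
    have "n = g * (2 * fst a + m * fst (snd a) + (m + 1) * snd (snd a))"
      using whom_keysD[OF hom that] by (simp add: g d2 d3 algebra_simps)
    then have "n div g = 2 * fst a + m * fst (snd a) + (m + 1) * snd (snd a)" using g0 by (rule div_eqI_nat)
    moreover obtain l where "m = 2 * l + 1" using m by (elim oddE)
    ultimately have "n div g = 2 * (fst a + l * fst (snd a) + (l + 1) * snd (snd a)) + fst (snd a)"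
      by (simp add: algebra_simps)
    then show ?thesis by (simp only: mod_mult_self4)
  qed
  have fin: ?thesis if "degree s = 0" "degree \<rho> = 0" "degree x2 = 0"
    unfolding s \<rho>(1) using that by (auto intro!: degree_0_closed)
  show ?thesis
  \<comment> \<open>\<open>s\<close> has weight \<open>g\<close> and \<open>\<rho>\<close> has
    weight \<open>d3 - g = m g\<close>; each x1 contributes two factors \<open>s\<close>, each x3
    one \<open>s\<close> and one \<open>\<rho>\<close>.\<close>
  proof (rule bform_cases[OF q, where ?w1.0 = "m * g" and ?w2.0 = g and ?w3.0 = "m * g" and i = "\<lambda>a. snd (snd a)"
        and j = "\<lambda>a. 2 * fst a + snd (snd a)" and k = "\<lambda>a. fst (snd a)" and \<epsilon> = "(n div g) mod 2"
        and g = g and ?e1.0 = 1 and ?e2.0 = m])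
    show "bform (\<lambda>c. [:c:]) (m * g) g \<rho> s (2 * (m * g)) (smult (- 1 / \<alpha>) (\<rho> ^ 2 * s ^ 0) + smult (- \<gamma>) (\<rho> ^ 0 * s ^ (2 * m)))"
      by (intro bform_add bform_smult) simp_all
    show "m * g * snd (snd a) + g * (2 * fst a + snd (snd a)) + m * g * fst (snd a) = n \<and> fst (snd a) mod 2 = n div g mod 2"
      if "a \<in> keys h" for a
      using whom_keysD[OF hom that] par[OF that] by (simp add: g d2 d3 algebra_simps)
    show "pev h x1 x2 x3 = (\<Sum>a\<in>keys h. [:lookup h a:] * \<rho> ^ snd (snd a) * s ^ (2 * fst a + snd (snd a)) * x2 ^ fst (snd a))"
      unfolding pev_eq s \<rho>(1) by (simp only: power_mult_distrib power_add power_mult) (simp only: mult_ac)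
  next
    assume "nzconst x2"
    then obtain a where a: "a \<noteq> 0" "x2 = [:a:]" by (elim nzconstE)
    have "x3\<^sup>2 = x1 * (smult 0 (x1 ^ (2 * m)) + smult (- \<alpha> * \<gamma>) (x1 ^ m) + [:- \<alpha> * a\<^sup>2:])"
      using sq a(2) by (simp add: poly_const_pow smult_add_right algebra_simps)
    from power_eq_times_quadratic[OF ac _ _ _ _ this] show ?thesis using nz a m by auto
  next
    assume "nzconst \<rho>"
    then obtain a where a: "a \<noteq> 0" "\<rho> = [:a:]" by (elim nzconstE)
    have "x2\<^sup>2 = smult (- \<gamma>) (s ^ (2 * m)) + [:- 1 / \<alpha> * a\<^sup>2:]"
      using q a(2) by (simp add: poly_const_pow)
    from power_eq_binomial[OF ac _ _ _ _ this] show ?thesis using nz a m fin by auto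
  next
    assume "nzconst s"
    then obtain a where a: "a \<noteq> 0" "s = [:a:]" by (elim nzconstE)
    have "x2\<^sup>2 = smult (- 1 / \<alpha>) (\<rho>\<^sup>2) + [:- \<gamma> * a ^ (2 * m):]"
      using q a(2) by (simp add: poly_const_pow)
    from power_eq_binomial[OF ac _ _ _ _ this] show ?thesis using nz a fin by auto
  next
    fix c assume "nzconst (\<rho> ^ 1 - [:c:] * s ^ m)"
    then obtain u where u: "u \<noteq> 0" "\<rho> ^ 1 - [:c:] * s ^ m = [:u:]" by (elim nzconstE)
    have e: "\<rho> = smult c (s ^ m) + [:u:]" using u(2) by (simp add: algebra_simps)
    have q': "x2\<^sup>2 = smult (- (c\<^sup>2 / \<alpha> + \<gamma>)) (s ^ (2 * m)) + smult (- 2 * u * c / \<alpha>) (s ^ m) + [:- u\<^sup>2 / \<alpha>:]"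
      unfolding q e power_even_eq
      using nz by (intro poly_ext) (simp add: power2_eq_square field_simps)
    have disc: "(- 2 * u * c / \<alpha>)\<^sup>2 \<noteq> 4 * (- (c\<^sup>2 / \<alpha> + \<gamma>)) * (- u\<^sup>2 / \<alpha>)"
    proof -
      have "(- 2 * u * c / \<alpha>)\<^sup>2 - 4 * (- (c\<^sup>2 / \<alpha> + \<gamma>)) * (- u\<^sup>2 / \<alpha>) = - 4 * \<gamma> * u\<^sup>2 / \<alpha>"
        using nz by (simp add: field_simps power2_eq_square)
      then show ?thesis using nz u(1) by auto
    qed
    have "degree s = 0 \<and> degree x2 = 0"
      by (rule power_eq_quadratic[OF ac _ m(2) _ disc q']) (use nz u(1) in simp_all)
    moreover from this have "degree \<rho> = 0" unfolding e by (intro degree_0_closed) auto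
    ultimately show ?thesis using fin by simp
  qed (use g0 m in auto)
qed

lemma const_D:
  assumes "x3\<^sup>2 + smult \<alpha> (x1 * (x2\<^sup>2 + smult \<gamma> (x1 ^ m))) = 0" "\<alpha> \<noteq> 0" "\<gamma> \<noteq> 0" "2 \<le> m"
    "m * d1 = 2 * d2" "2 * d3 = d1 + 2 * d2"
  shows "degree x1 = 0 \<and> degree x2 = 0 \<and> degree x3 = 0"
proof (cases "even m")
  case True
  then obtain e where "m = 2 * e" by (elim evenE)
  then show ?thesis using const_D_even[of \<alpha> \<gamma> e] assms by simp
next
  case False
  then show ?thesis using const_D_odd[of \<alpha> \<gamma> m] assms by simp
qed

end

subsection \<open>Classification of the relation\<close>

lemma in_x1x2_iff: "in_x1x2 P \<longleftrightarrow> wle (0,0,1) 0 P"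
  by (force simp: in_x1x2_def wset_def wdeg_mono_def)

lemma in_x1x2_simps:
  "in_x1x2 (0::'a::comm_ring_1 mpoly3)" "in_x1x2 (X1::'a mpoly3)" "in_x1x2 (X2::'a mpoly3)" "in_x1x2 (C3 (c::'a))"
  "in_x1x2 (P::'a mpoly3) \<Longrightarrow> in_x1x2 Q \<Longrightarrow> in_x1x2 (P + Q)"
  "in_x1x2 (P::'a mpoly3) \<Longrightarrow> in_x1x2 Q \<Longrightarrow> in_x1x2 (P - Q)"
  "in_x1x2 (P::'a mpoly3) \<Longrightarrow> in_x1x2 Q \<Longrightarrow> in_x1x2 (P * Q)"
  "in_x1x2 (P::'a mpoly3) \<Longrightarrow> in_x1x2 (P ^ n)"
proof -
  show m: "in_x1x2 (P * Q)" if "in_x1x2 P" "in_x1x2 Q" for P Q :: "'a mpoly3"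
    using that unfolding in_x1x2_iff by (rule wle_mult) simp
  show "in_x1x2 (P ^ n)" if "in_x1x2 P" for P :: "'a mpoly3"
  proof (induction n)
    case 0 then show ?case by (simp add: in_x1x2_iff wset_one)
  next
    case (Suc n) then show ?case by (simp add: m[OF that])
  qed
qed (auto simp: in_x1x2_iff wset_X wset_C3 intro: wset_add wset_diff)

lemma ev_x1x2: "in_x1x2 P \<Longrightarrow> ev \<kappa> P x y z = ev \<kappa> P x y z'"
  unfolding ev_def by (intro sum.cong) (auto simp: in_x1x2_def)

lemma bform_of_x1x2:
  assumes "in_x1x2 P" "whom (d1,d2,d3) (int n) P"
  shows "bform C3 d2 d1 X2 X1 n P"
proof -
  have "bform C3 d2 d1 X2 X1 n (\<Sum>m\<in>keys P. single m (lookup P m))"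
  proof (rule bform_sum)
    fix m assume m: "m \<in> keys P"
    obtain a b c where abc: "m = (a,b,c)" by (cases m)
    have c: "c = 0" using assms(1) m abc by (auto simp: in_x1x2_def)
    have "d2 * b + d1 * a = n" using whom_keysD[OF assms(2) m] by (simp add: abc c)
    from bform_mono[OF this, of C3 X2 X1 "lookup P m"]
    show "bform C3 d2 d1 X2 X1 n (single m (lookup P m))"
      by (simp add: abc c single_eq_monomial mult_ac)
  qed
  then show ?thesis by (simp flip: mpoly3_expand)
qed

lemma slice_x3:
  fixes P :: "'a::comm_ring_1 mpoly3"
  assumes P: "whom (w1,w2,w3) n P" and c: "\<And>m. m \<in> keys P \<Longrightarrow> snd (snd m) \<le> 2"
  obtains A0 A1 A2 where "P = A0 + A1 * X3 + A2 * X3\<^sup>2" "in_x1x2 A0" "in_x1x2 A1" "in_x1x2 A2"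
    "whom (w1,w2,w3) n A0" "whom (w1,w2,w3) (n - int w3) A1" "whom (w1,w2,w3) (n - 2 * int w3) A2"
proof -
  define K where "K c = {m \<in> keys P. snd (snd m) = c}" for c
  define A :: "nat \<Rightarrow> 'a mpoly3" where "A c = (\<Sum>m\<in>K c. single (fst m, fst (snd m), 0) (lookup P m))" for c
  have h: "whom (w1,w2,w3) (n - int c * int w3) (A c)" for c
    unfolding A_def
  proof (rule wset_sum)
    fix m assume m: "m \<in> K c"
    obtain a b where abc: "m = (a,b,c)" using m by (cases m) (auto simp: K_def)
    have "int (wdeg_mono (w1,w2,w3) m) = n" using m P by (simp add: K_def wset_def)
    then show "whom (w1,w2,w3) (n - int c * int w3) (single (fst m, fst (snd m), 0) (lookup P m))"
      by (auto simp: wset_single abc wdeg_mono_def algebra_simps)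
  qed
  have i: "in_x1x2 (A c)" for c
    unfolding A_def in_x1x2_iff by (rule wset_sum) (simp add: wset_single wdeg_mono_def)
  have m: "A c * X3 ^ c = (\<Sum>m\<in>K c. single m (lookup P m))" for c
    unfolding A_def sum_distrib_right X_power
    by (intro sum.cong) (auto simp: mult_single K_def)
  have "keys P = K 0 \<union> K 1 \<union> K 2" using c by (force simp: K_def le_Suc_eq numeral_2_eq_2)
  moreover have "K 0 \<inter> K 1 = {}" "(K 0 \<union> K 1) \<inter> K 2 = {}" "finite (K c)" for c by (auto simp: K_def)
  ultimately have "(\<Sum>m\<in>keys P. single m (lookup P m)) = A 0 * X3 ^ 0 + A 1 * X3 ^ 1 + A 2 * X3 ^ 2"
    unfolding m by (simp add: sum.union_disjoint)
  then have "P = A 0 + A 1 * X3 + A 2 * X3\<^sup>2" by (simp flip: mpoly3_expand)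
  then show ?thesis using that i h[of 0] h[of 1] h[of 2] by simp
qed

lemma quadratic_roots:
  assumes ac: "alg_closed_field TYPE('a::field)" and "c2 \<noteq> (0::'a)"
  obtains r s where "c1 = - c2 * (r + s)" "c0 = c2 * r * s"
proof -
  have "2 \<le> degree [:c0, c1, c2:]" using degree_ge_2I[of "[:c0, c1, c2:]" 2] assms(2) by (simp add: numeral_2_eq_2)
  then have "1 \<le> degree [:c0, c1, c2:]" by linarith
  then obtain r where r: "poly [:c0, c1, c2:] r = 0" using ac unfolding alg_closed_field_def by blast
  show thesis
  proof (rule that)
    show "c1 = - c2 * (r + (- c1 / c2 - r))" using assms(2) by (simp add: field_simps)
    have "c0 + r * (c1 + r * c2) = 0" using r by simp
    then have c0: "c0 = - (r * (c1 + r * c2))" by (simp only: eq_neg_iff_add_eq_0)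
    show "c0 = c2 * r * (- c1 / c2 - r)" unfolding c0 using assms(2) by (simp add: field_simps)
  qed
qed

lemma cubic_roots:
  assumes ac: "alg_closed_field TYPE('a::field)" and "c3 \<noteq> (0::'a)"
  obtains r s t where "c2 = - c3 * (r + s + t)" "c1 = c3 * (r * s + r * t + s * t)" "c0 = - c3 * r * s * t"
proof -
  have "coeff [:c0, c1, c2, c3:] 3 \<noteq> 0" using assms(2) by (simp add: numeral_3_eq_3)
  then have "2 \<le> degree [:c0, c1, c2, c3:]" by (rule degree_ge_2I) simp
  then have "1 \<le> degree [:c0, c1, c2, c3:]" by linarith
  then obtain r where "poly [:c0, c1, c2, c3:] r = 0" using ac unfolding alg_closed_field_def by blast
  then have r: "c0 + r * (c1 + r * (c2 + r * c3)) = 0" by simp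
  obtain s t where st: "c2 + c3 * r = - c3 * (s + t)" "c1 + r * (c2 + r * c3) = c3 * s * t"
    using quadratic_roots[OF ac assms(2)] by blast
  have c2: "c2 = - c3 * (r + s + t)" using st(1) by (simp add: algebra_simps eq_neg_iff_add_eq_0)
  have "c1 = c3 * s * t - r * (c2 + r * c3)" using st(2) by (simp add: algebra_simps)
  then have c1: "c1 = c3 * (r * s + r * t + s * t)" unfolding c2 by (simp add: algebra_simps)
  have "c0 = - (r * (c1 + r * (c2 + r * c3)))" using r by (simp add: eq_neg_iff_add_eq_0)
  then have "c0 = - c3 * r * s * t" unfolding st(2) by (simp add: algebra_simps)
  with c2 c1 show ?thesis by (rule that)
qed

lemma unit_mpoly3:
  assumes "T * S = (1::'a::idom mpoly3)"
  obtains t where "T = C3 t" "t \<noteq> 0"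
proof -
  have "S \<noteq> 0" using assms by auto
  then obtain n S' where S': "top (1,1,1) (int n) S S'" "S' \<noteq> 0" using ex_top_nonzero by metis
  have "wle (1,1,1) (0 - int n) T"
    using wle_mult_cancel[OF S', of 0 T] assms by (simp add: mult.commute wset_one)
  then have "wle (1,1,1) 0 T" by (rule wle_mono) simp
  then obtain t where t: "T = C3 t" using wle_const[of 1 1 1 T] by auto
  have "t \<noteq> 0" using assms by (auto simp: t C3_simps)
  with t show ?thesis by (rule that)
qed

context principal_relation
begin

text \<open>Lets rigidity be proved in other weighted homogeneous coordinates: \<open>E1\<close>,
  \<open>E2\<close> are the new x1, x2 with inverse \<open>G1\<close>, \<open>G2\<close>, and the
  new x3 absorbs \<open>H\<close>. The homogeneous function keeps its degree when rewritten, and a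
  curve constant in the new coordinates is constant in the old ones.\<close>

lemma rigid_square:
  assumes ac: "alg_closed_field TYPE('a)"
    and R: "R = C3 c * ((X3 + H)\<^sup>2 + B)" and c: "c \<noteq> 0"
    and HB: "in_x1x2 H" "in_x1x2 B" "whom d (int d3) H"
    and EG: "in_x1x2 E1" "in_x1x2 E2" "in_x1x2 G1" "in_x1x2 G2"
      "whom d (int d1) E1" "whom d (int d2) E2" "whom d (int d1) G1" "whom d (int d2) G2"
      "ev C3 G1 E1 E2 0 = X1" "ev C3 G2 E1 E2 0 = X2"
    and rigid: "\<And>y1 y2 y3 h n. homogeneous_curve y1 y2 y3 h d1 d2 d3 n \<Longrightarrow>
      y3\<^sup>2 + pev B (pev G1 y1 y2 0) (pev G2 y1 y2 0) 0 = 0 \<Longrightarrow> degree y1 = 0 \<and> degree y2 = 0 \<and> degree y3 = 0"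
  shows False
proof -
  have "top (0,0,1) 1 (X3 + H) X3"
    using HB(1) by (simp add: top_def wset_X in_x1x2_iff)
  from top_power[OF this, of 2] have "top (0,0,1) 2 ((X3 + H)\<^sup>2) (X3\<^sup>2)" by simp
  moreover have "top (0,0,1) 2 B 0" using HB(2) by (intro top_lower) (auto simp: in_x1x2_iff elim: wle_mono)
  ultimately have "top (0,0,1) 2 ((X3 + H)\<^sup>2 + B) (X3\<^sup>2 + 0)" by (rule top_add)
  from top_mult[OF top_self[of "(0,0,1)" 0 "C3 c"] this] have tR: "top (0,0,1) 2 R (C3 c * X3\<^sup>2)"
    by (simp add: R wset_C3)
  have R3: "\<not> wle (0,0,1) 0 R"
  proof
    assume "wle (0,0,1) 0 R"
    then have "top (0,0,1) 2 R 0" by (intro top_lower) (auto elim: wle_mono)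
    with tR have "C3 c * X3\<^sup>2 = 0" by (rule top_unique)
    then show False using c by (simp add: X_nonzero)
  qed
  obtain x1 x2 x3 h n k where cv: "pev R x1 x2 x3 = 0" "whom d (int n) h" "0 < n" "pev h x1 x2 x3 = [:k:]" "k \<noteq> 0"
    "\<not> (degree x1 = 0 \<and> degree x2 = 0 \<and> degree x3 = 0)"
    by (rule ex_curve[OF R3])
  note pe = ev_simps[OF rhom_pCons] and pb = ev_basic[OF rhom_pCons]
  define y1 y2 y3 where "y1 = pev E1 x1 x2 0" and "y2 = pev E2 x1 x2 0" and "y3 = x3 + pev H x1 x2 0"
  have z: "pev P u v w = pev P u v 0" if "in_x1x2 P" for P u v w by (rule ev_x1x2[OF that])
  have xG: "pev G1 y1 y2 0 = x1" "pev G2 y1 y2 0 = x2"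
    using ev_ev[OF rhom_pCons, of G1 E1 E2 0 x1 x2 0] ev_ev[OF rhom_pCons, of G2 E1 E2 0 x1 x2 0] EG(9,10)
    by (simp_all add: y1_def y2_def pb)
  \<comment> \<open>The old x3 in terms of the new coordinates.\<close>
  define G3 where "G3 = X3 - ev C3 H G1 G2 0"
  have "whom d (int d3) (ev C3 H G1 G2 0)" by (rule whom_ev[OF EG(7,8) _ HB(3)]) simp
  then have G3h: "whom d (int d3) G3" unfolding G3_def by (intro wset_diff) (simp_all add: wset_X)
  have "pev (ev C3 H G1 G2 0) y1 y2 y3 = pev H (pev G1 y1 y2 y3) (pev G2 y1 y2 y3) 0"
    unfolding ev_ev[OF rhom_pCons] by simp
  also have "\<dots> = pev H x1 x2 0" using z[OF EG(3)] z[OF EG(4)] xG by metis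
  finally have xG3: "pev G3 y1 y2 y3 = x3" by (simp add: G3_def pe pb y3_def)
  have "homogeneous_curve y1 y2 y3 (ev C3 h G1 G2 G3) d1 d2 d3 n"
  proof
    have "pev (ev C3 h G1 G2 G3) y1 y2 y3 = pev h (pev G1 y1 y2 0) (pev G2 y1 y2 0) (pev G3 y1 y2 y3)"
      unfolding ev_ev[OF rhom_pCons] using z[OF EG(3), of y1 y2 y3] z[OF EG(4), of y1 y2 y3] by simp
    then show "nzconst (pev (ev C3 h G1 G2 G3) y1 y2 y3)"
      using cv(4,5) by (simp add: xG xG3 nzconst_def)
    show "whom d (int n) (ev C3 h G1 G2 G3)" by (rule whom_ev[OF EG(7,8) G3h cv(2)])
  qed (use ac cv(3) d_pos in auto)
  moreover have "y3\<^sup>2 + pev B (pev G1 y1 y2 0) (pev G2 y1 y2 0) 0 = 0"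
  proof -
    have "[:c:] * ((x3 + pev H x1 x2 x3)\<^sup>2 + pev B x1 x2 x3) = 0" using cv(1) unfolding R by (simp add: pe pb)
    then have "(x3 + pev H x1 x2 x3)\<^sup>2 + pev B x1 x2 x3 = 0" using c by simp
    then show ?thesis unfolding xG y3_def using z[OF HB(1), of x1 x2 x3] z[OF HB(2), of x1 x2 x3] by simp
  qed
  ultimately have dy: "degree y1 = 0" "degree y2 = 0" "degree y3 = 0" using rigid by blast+
  have cst: "degree (pev P u v w) = 0" if "degree u = 0" "degree v = 0" "degree w = 0"
    for P :: "'a mpoly3" and u v w
  proof -
    have s: "degree (\<Sum>m\<in>A. f m) = 0" if "\<And>m. m \<in> A \<Longrightarrow> degree (f m) = 0" for A and f :: "nat \<times> nat \<times> nat \<Rightarrow> 'a poly"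
      using that by (induction A rule: infinite_finite_induct) (auto intro: degree_0_closed)
    show ?thesis
      unfolding pev_eq
    proof (rule s)
      fix m
      show "degree ([:lookup P m:] * u ^ fst m * v ^ fst (snd m) * w ^ snd (snd m)) = 0"
        using that by (intro degree_0_closed(3,4)) simp_all
    qed
  qed
  have "degree x1 = 0" "degree x2 = 0" "degree x3 = 0"
    using cst[OF dy(1,2), of 0 G1] cst[OF dy(1,2), of 0 G2] cst[OF dy, of G3] by (simp_all add: xG xG3)
  with cv(6) show False by simp
qed

text \<open>\<open>\<psi> R = 0\<close> while \<open>h1\<close> and \<open>h2\<close> are nonzero,
  so some binomial factor of \<open>R\<close> lies in the kernel. It divides \<open>R\<close> and is
  divisible by \<open>R\<close>, hence agrees with it up to a unit.\<close>

lemma binary_case: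
  assumes ac: "alg_closed_field TYPE('a)" and R: "in_x1x2 R"
  shows "\<exists>c k e1 e2. c \<noteq> 0 \<and> k \<noteq> 0 \<and> gcd e1 e2 = 1 \<and> R = C3 k * (X1 ^ e1 + C3 c * X2 ^ e2)"
proof -
  define g where "g = gcd d1 d2"
  have g: "0 < g" using d_pos by (simp add: g_def)
  obtain e1 e2 where e: "d1 = g * e1" "d2 = g * e2" "coprime e1 e2"
    using gcd_coprime_exists[of d1 d2] g by (metis g_def mult.commute not_less0)
  have e0: "0 < e1" "0 < e2" using e d_pos d_le by (auto intro: Nat.gr0I)
  obtain c i j rs where R': "c \<noteq> 0" "R = C3 c * X2 ^ i * X1 ^ j * prod_list (map (\<lambda>r. X2 ^ e1 - C3 r * X1 ^ e2) rs)"
    using bform_factor[OF ac rhom_C3 g e0 e(3) bform_of_x1x2[OF R R_hom, unfolded e(1,2)] R_nonzero] by metis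
  have "\<psi> (prod_list ps) = prod_list (map \<psi> ps)" for ps by (induction ps) (simp_all add: \<psi>_simps)
  then have "C3 c * h2 ^ i * h1 ^ j * prod_list (map (\<lambda>r. h2 ^ e1 - C3 r * h1 ^ e2) rs) = 0"
    using \<psi>_R unfolding R'(2) by (simp add: \<psi>_simps comp_def)
  then obtain r where r: "r \<in> set rs" "h2 ^ e1 - C3 r * h1 ^ e2 = 0"
    using R'(1) h_nonzero by (auto simp: prod_list_zero_iff)
  have r0: "r \<noteq> 0" using r(2) h_nonzero by (auto simp: C3_simps)
  let ?F = "X2 ^ e1 - C3 r * X1 ^ e2 :: 'a mpoly3"
  have "R dvd ?F" using r(2) by (simp add: \<psi>_simps flip: \<psi>_eq_0)
  then obtain T where T: "?F = R * T" ..
  have "?F dvd prod_list (map (\<lambda>r. X2 ^ e1 - C3 r * X1 ^ e2) rs)" using r(1) by (intro prod_list_dvd) auto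
  then have "?F dvd R" unfolding R'(2) by simp
  then obtain S where S: "R = ?F * S" ..
  have "R * (T * S) = R * 1" using S unfolding T by (simp add: mult.assoc)
  then have "T * S = 1" using R_nonzero by (subst (asm) mult_left_cancel) auto
  then have "S * T = 1" by (simp add: mult.commute)
  then obtain s where s: "S = C3 s" "s \<noteq> 0" by (rule unit_mpoly3)
  have "R = C3 (- s * r) * (X1 ^ e2 + C3 (- 1 / r) * X2 ^ e1)"
  proof -
    have "C3 (- s * r) * C3 (- 1 / r) = C3 s" using r0 by (simp flip: C3_mult)
    then have "C3 (- s * r) * (X1 ^ e2 + C3 (- 1 / r) * X2 ^ e1) = C3 (- s * r) * X1 ^ e2 + C3 s * X2 ^ e1"
      by (simp add: distrib_left flip: mult.assoc)
    also have "\<dots> = R" unfolding S s(1) by (simp add: C3_mult C3_uminus algebra_simps)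
    finally show ?thesis by simp
  qed
  then show ?thesis using s(2) r0 e(3)
    by (intro exI[of _ "- 1 / r"] exI[of _ "- s * r"] exI[of _ e2] exI[of _ e1]) (simp add: gcd.commute coprime_iff_gcd_eq_1)
qed

text \<open>Division by \<open>L\<close>, which is monic in x2: the remainder involves x1 alone, and
  homogeneity reduces it to one monomial. A zero remainder puts no condition on
  \<open>k\<close>.\<close>

lemma divide_linear:
  assumes "bform C3 d2 d1 X2 X1 n P" and L: "L = X2 + C3 a * X1 ^ e" "a \<noteq> 0 \<longrightarrow> e * d1 = d2"
  shows "\<exists>H c k. P = L * H + C3 c * X1 ^ k \<and> in_x1x2 H \<and> whom d (int n - int d2) H \<and> (c \<noteq> 0 \<longrightarrow> k * d1 = n)"
  using assms(1)
proof induction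
  case bform_zero
  show ?case by (intro exI[of _ 0]) (simp add: in_x1x2_simps C3_simps)
next
  case (bform_add u v)
  then obtain H c k H' c' k' where
    1: "u = L * H + C3 c * X1 ^ k" "in_x1x2 H" "whom d (int n - int d2) H" "c \<noteq> 0 \<longrightarrow> k * d1 = n" and
    2: "v = L * H' + C3 c' * X1 ^ k'" "in_x1x2 H'" "whom d (int n - int d2) H'" "c' \<noteq> 0 \<longrightarrow> k' * d1 = n"
    by blast
  have H: "in_x1x2 (H + H')" "whom d (int n - int d2) (H + H')"
    using 1 2 by (auto intro: in_x1x2_simps wset_add)
  show ?case
  proof (cases "c = 0")
    case True
    then have "u + v = L * (H + H') + C3 c' * X1 ^ k'" by (simp add: 1 2 C3_simps algebra_simps)
    then show ?thesis using H 2(4) by blast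
  next
    case False
    have "C3 c' * X1 ^ k' = C3 c' * X1 ^ k"
    proof (cases "c' = 0")
      case nz: False
      then have "k' * d1 = k * d1" using 1(4) 2(4) False by simp
      then show ?thesis using d_pos by simp
    qed (simp add: C3_simps)
    then have "u + v = L * (H + H') + C3 (c + c') * X1 ^ k" by (simp add: 1 2 C3_add algebra_simps)
    then show ?thesis using H 1(4) False by blast
  qed
next
  case (bform_mono i j q)
  then show ?case
  proof (induction i arbitrary: j q)
    case 0
    then show ?case by (intro exI[of _ 0] exI[of _ q] exI[of _ j]) (simp add: in_x1x2_simps mult.commute)
  next
    case (Suc i)
    let ?M = "C3 q * X2 ^ i * X1 ^ j"
    have M: "in_x1x2 ?M" by (intro in_x1x2_simps)
    have Mh: "whom d (int n - int d2) ?M"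
    proof (rule whom_mult[OF whom_C3_mult[OF whom_power[of d "int d2" X2 i]] whom_power[of d "int d1" X1 j]])
      show "int i * int d2 + int j * int d1 = int n - int d2"
        using Suc.prems by (simp add: algebra_simps flip: of_nat_mult of_nat_add)
    qed (simp_all add: wset_X)
    show ?case
    proof (cases "a = 0")
      case True
      then show ?thesis using M Mh by (intro exI[of _ ?M] exI[of _ 0]) (simp add: L C3_simps algebra_simps)
    next
      case False
      then have "d2 * i + d1 * (j + e) = n" using L(2) Suc.prems by (simp add: algebra_simps)
      from Suc.IH[OF this, of "- q * a"] obtain H c k where
        1: "C3 (- q * a) * X2 ^ i * X1 ^ (j + e) = L * H + C3 c * X1 ^ k" "in_x1x2 H" "whom d (int n - int d2) H" "c \<noteq> 0 \<longrightarrow> k * d1 = n"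
        by blast
      have "C3 q * X2 ^ Suc i * X1 ^ j = L * ?M + C3 (- q * a) * X2 ^ i * X1 ^ (j + e)"
        by (simp add: L C3_mult C3_uminus power_add algebra_simps)
      also have "\<dots> = L * (?M + H) + C3 c * X1 ^ k" unfolding 1(1) by (simp add: algebra_simps)
      finally show ?thesis using 1 M Mh by (blast intro: in_x1x2_simps wset_add)
    qed
  qed
qed

end

section \<open>Membership in the normal forms\<close>

lemma C3_numeral: "C3 (numeral n :: 'a::comm_ring_1) = numeral n"
proof -
  have "C3 (of_nat (numeral n) :: 'a) = of_nat (numeral n)" by (rule C3_of_nat)
  then show ?thesis by (simp only: of_nat_numeral)
qed

lemma odd_ge_2: "odd a \<Longrightarrow> 2 \<le> a \<Longrightarrow> \<exists>k. a = 3 + 2 * (k::nat)"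
proof -
  assume "odd a" "2 \<le> a"
  then obtain k where k: "a = 2 * k + 1" "k \<noteq> 0" by (elim oddE) auto
  then show ?thesis by (intro exI[of _ "k - 1"]) simp
qed

lemma whom_X1_power: "k * d1 = n \<Longrightarrow> whom (d1,d2,d3) (int n) ((X1::'a::comm_ring_1 mpoly3) ^ k)"
proof (rule whom_power)
  show "whom (d1,d2,d3) (int d1) (X1::'a mpoly3)" by (simp add: wset_X)
qed (simp flip: of_nat_mult)

lemma normal_form_2: "normal_form w Y Y"
  unfolding normal_form_def
  by (rule disjI2, rule disjI1, rule refl)

lemma normal_form_3:
  assumes "c \<noteq> 0" "gcd e1 e2 = 1"
  shows "normal_form w Y (X1 ^ e1 + C3 c * X2 ^ e2)"
  unfolding normal_form_def
  by ((rule disjI1, intro exI conjI, rule assms(1), rule assms(2), rule refl) | rule disjI2)+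

lemma normal_form_4:
  assumes "c \<noteq> 0" "k \<ge> 2" "e1 \<ge> 1"
  shows "normal_form w Y ((X2 + C3 a * X1 ^ e1) * Y + C3 c * X1 ^ k)"
  unfolding normal_form_def
  by ((rule disjI1, intro exI conjI, rule assms(1), rule assms(2), rule assms(3), rule refl) | rule disjI2)+

lemma normal_form_5:
  assumes "k \<ge> 1" "in_x1x2 P" "whomog w m P"
  shows "normal_form w Y (X1 ^ k * Y + P)"
  unfolding normal_form_def
  by ((rule disjI1, intro exI conjI, rule assms(1), rule assms(2), rule assms(3), rule refl) | rule disjI2)+

lemma normal_form_6:
  assumes "c \<noteq> 0"
  shows "normal_form w Y (Y ^ 2 + C3 c * X2 ^ 3)"
  unfolding normal_form_def
  by ((rule disjI1, intro exI conjI, rule assms, rule refl) | rule disjI2)+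

lemma normal_form_7:
  assumes "c \<noteq> 0"
  shows "normal_form w Y (Y ^ 2 + C3 c * X1 * X2 ^ 2)"
  unfolding normal_form_def
  by ((rule disjI1, intro exI conjI, rule assms, rule refl) | rule disjI2)+

lemma normal_form_8:
  assumes "c \<noteq> 0"
  shows "normal_form w Y (Y ^ 2 + C3 c * X1 ^ (3 + 2 * n))"
  unfolding normal_form_def
  by ((rule disjI1, intro exI conjI, rule assms, rule refl) | rule disjI2)+

lemma normal_form_9:
  assumes "c \<noteq> 0" "k \<ge> 1"
  shows "normal_form w Y (Y ^ 2 + C3 c * X1 ^ k * X2)"
  unfolding normal_form_def
  by ((rule disjI1, intro exI conjI, rule assms(1), rule assms(2), rule refl) | rule disjI2)+

lemma normal_form_10:
  assumes "a * b \<noteq> 0"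
  shows "normal_form w Y (Y ^ 2 + C3 a * X1 ^ (3 + 2 * n) + C3 b * X2 ^ 2)"
  unfolding normal_form_def
  by ((rule disjI1, intro exI conjI, rule assms, rule refl) | rule disjI2)+

lemma normal_form_11:
  assumes "a * b \<noteq> 0" "e1 \<ge> 1"
  shows "normal_form w Y (Y ^ 2 + (C3 a * X1 ^ e1 + C3 b * X2) * X1 ^ k)"
  unfolding normal_form_def
  by ((rule disjI1, intro exI conjI, rule assms(1), rule assms(2), rule refl) | rule disjI2)+

lemma normal_form_12:
  assumes "a1 * b2 - b1 * a2 \<noteq> 0" "e1 \<ge> 1"
  shows "normal_form w Y (Y ^ 2 + (C3 a1 * X1 ^ e1 + C3 b1 * X2) * (C3 a2 * X1 ^ e1 + C3 b2 * X2))"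
  unfolding normal_form_def
  by ((rule disjI1, intro exI conjI, rule assms(1), rule assms(2), rule refl) | rule disjI2)+

lemma normal_form_13:
  assumes "(a1, b1) \<noteq> (0, 0)" "(a2, b2) \<noteq> (0, 0)"
  shows "normal_form w Y (Y ^ 2 + (C3 a1 * X1 + C3 b1 * X2) * (C3 a2 * X1 + C3 b2 * X2) ^ 2)"
  unfolding normal_form_def
  by ((rule disjI1, intro exI conjI, rule assms(1), rule assms(2), rule refl) | rule disjI2)+

lemma normal_form_14:
  assumes "a * b \<noteq> 0" "e1 \<ge> 2"
  shows "normal_form w Y (Y ^ 2 + (C3 a * X1 ^ e1 + C3 b * X2) ^ 2 * X1)"
  unfolding normal_form_def
  by (rule disjI2, rule disjI2, rule disjI2, rule disjI2, rule disjI2, rule disjI2, rule disjI2, rule disjI2, rule disjI2, rule disjI2, rule disjI2, rule disjI2, rule disjI2, intro exI conjI, rule assms(1), rule assms(2), rule refl)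

context automorphism3
begin

text \<open>\<open>n < 4 * d2\<close> bounds the exponent of x2 by 3, and the degree then determines
  the exponent of x1.\<close>

lemma binary_expansion:
  assumes B: "in_x1x2 B" "whom d (int n) B" "n < 4 * d2"
  obtains c0 c1 c2 c3 :: 'a and a0 a1 a2 a3 where
    "B = C3 c0 * X1 ^ a0 + C3 c1 * X1 ^ a1 * X2 + C3 c2 * X1 ^ a2 * X2\<^sup>2 + C3 c3 * X1 ^ a3 * X2 ^ 3"
    "c0 \<noteq> 0 \<longrightarrow> a0 * d1 = n" "c1 \<noteq> 0 \<longrightarrow> a1 * d1 + d2 = n" "c2 \<noteq> 0 \<longrightarrow> a2 * d1 + 2 * d2 = n" "c3 \<noteq> 0 \<longrightarrow> a3 * d1 + 3 * d2 = n"
proof -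
  \<comment> \<open>Where the division is inexact or the subtraction truncated, no such monomial
    occurs and \<open>f b\<close> is 0.\<close>
  define e where "e b = (n - b * d2) div d1" for b
  define f where "f b = lookup B (e b, b, 0)" for b
  have f: "e b * d1 + b * d2 = n" if "f b \<noteq> 0" for b
    using whom_keysD[OF B(2), of "(e b, b, 0)"] that by (simp add: f_def in_keys_iff algebra_simps)
  have k: "c = 0 \<and> b < 4 \<and> a = e b" if "(a,b,c) \<in> keys B" for a b c
  proof -
    have c: "c = 0" using B(1) that by (auto simp: in_x1x2_def)
    have n: "d1 * a + d2 * b = n" using whom_keysD[OF B(2) that] c by simp
    then have "d2 * b < d2 * 4" using B(3) by linarith
    then have "b < 4" by simp
    moreover have "n - b * d2 = d1 * a" using n by (simp add: mult.commute[of b])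
    then have "e b = a" using d_pos by (simp add: e_def)
    ultimately show ?thesis using c by simp
  qed
  have "B = (\<Sum>b<4. single (e b, b, 0) (f b))"
  proof (rule poly_mapping_eqI)
    fix m :: "nat \<times> nat \<times> nat"
    obtain a b c where m: "m = (a,b,c)" by (cases m)
    have "lookup (\<Sum>b<4. single (e b, b, 0) (f b)) m
        = (\<Sum>b'<4. if b' = b then (if a = e b \<and> c = 0 then f b else 0) else 0)"
      unfolding lookup_sum by (intro sum.cong) (auto simp: m lookup_single when_def)
    also have "\<dots> = (if b < 4 \<and> a = e b \<and> c = 0 then f b else 0)" by simp
    also have "\<dots> = lookup B m"
      using k[of a b c] by (auto simp: m f_def in_keys_iff)
    finally show "lookup B m = lookup (\<Sum>b<4. single (e b, b, 0) (f b)) m" by simp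
  qed
  also have "\<dots> = C3 (f 0) * X1 ^ e 0 + C3 (f 1) * X1 ^ e 1 * X2 + C3 (f 2) * X1 ^ e 2 * X2\<^sup>2 + C3 (f 3) * X1 ^ e 3 * X2 ^ 3"
    by (simp add: eval_nat_numeral single_eq_monomial)
  finally show ?thesis using that f[of 0] f[of 1] f[of 2] f[of 3] by simp
qed

end

section \<open>Relations of degree two in x3\<close>

locale square_relation = principal_relation +
  fixes H B :: "'a mpoly3" and \<kappa> :: 'a
  assumes ac: "alg_closed_field TYPE('a)" and R_square: "R = C3 \<kappa> * ((X3 + H)\<^sup>2 + B)" and \<kappa>: "\<kappa> \<noteq> 0"
    and HB: "in_x1x2 H" "in_x1x2 B" "whom d (int d3) H" and N_eq: "N = 2 * d3"
begin

text \<open>A multiple of a square would split \<open>R\<close>, as a difference of squares, into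
  two factors of degree \<open>d3 < N\<close>.\<close>

lemma not_square: "B = C3 \<alpha> * Q\<^sup>2 \<Longrightarrow> whom d (int d3) Q \<Longrightarrow> False"
proof -
  assume B: "B = C3 \<alpha> * Q\<^sup>2" and Q: "whom d (int d3) Q"
  obtain s where s: "s\<^sup>2 = - \<alpha>" using ex_sqrt[OF ac] by blast
  have "C3 \<alpha> = - (C3 s)\<^sup>2" by (simp add: s C3_uminus flip: C3_power)
  then have "(X3 + H)\<^sup>2 + B = (X3 + H - C3 s * Q) * (X3 + H + C3 s * Q)"
    unfolding B by (simp add: power2_eq_square algebra_simps)
  then have "R = C3 \<kappa> * (X3 + H - C3 s * Q) * (X3 + H + C3 s * Q)" by (simp add: R_square mult.assoc)
  moreover have "whom d (int d3) (C3 \<kappa> * (X3 + H - C3 s * Q))" "whom d (int d3) (X3 + H + C3 s * Q)"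
    using Q HB(3) by (auto intro!: whom_C3_mult wset_add wset_diff simp: wset_X)
  then have "wle d (int d3) (C3 \<kappa> * (X3 + H - C3 s * Q))" "wle d (int d3) (X3 + H + C3 s * Q)"
    by (auto elim: whom_wle)
  ultimately show False using R_not_product[of _ _ "int d3" "int d3"] N_eq d_pos d_le by auto
qed

lemma rigid_id:
  assumes "\<And>y1 y2 y3 h n. homogeneous_curve y1 y2 y3 h d1 d2 d3 n \<Longrightarrow> y3\<^sup>2 + pev B y1 y2 0 = 0 \<Longrightarrow>
      degree y1 = 0 \<and> degree y2 = 0 \<and> degree y3 = 0"
  shows False
  by (rule rigid_square[OF ac R_square \<kappa> HB, of X1 X2 X1 X2])
     (use assms in \<open>auto simp: in_x1x2_simps wset_X rhom_C3 rhom_pCons\<close>)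

lemmas pev_simps = ev_simps[OF rhom_pCons] ev_basic[OF rhom_pCons]

text \<open>Three distinct linear factors (\<open>D\<^sub>4\<close>): one of them becomes the new \<open>x1\<close>, and completing the
  square in the product of the other two gives the new \<open>x2\<close>.\<close>
lemma not_D4:
  assumes d: "d1 = d2" "2 * d3 = 3 * d1" and c: "c \<noteq> 0" and rst: "r \<noteq> s" "r \<noteq> t" "s \<noteq> t"
    and B: "B = C3 c * (X2 - C3 r * X1) * (X2 - C3 s * X1) * (X2 - C3 t * X1)"
  shows False
proof -
  \<comment> \<open>With p = X2 - r X1 the other factors are p - u X1 and p - v X1. Substituting X1
    = q + w p removes the cross term of their product; \<open>\<gamma>\<close> is the coefficient of
    p^2 after division by u v, nonzero because u \<noteq> v.\<close>
  define u v w where "u = s - r" and "v = t - r" and "w = (u + v) / (2 * u * v)"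
  have uv: "u \<noteq> 0" "v \<noteq> 0" "u \<noteq> v" using rst by (auto simp: u_def v_def)
  define \<gamma> where "\<gamma> = - ((u - v) / (2 * u * v))\<^sup>2"
  have \<gamma>: "\<gamma> \<noteq> 0" using uv by (simp add: \<gamma>_def)
  let ?E1 = "X2 - C3 r * X1 :: 'a mpoly3" and ?G1 = "X2 + C3 w * X1 :: 'a mpoly3"
  let ?E2 = "X1 - C3 w * ?E1" and ?G2 = "X1 + C3 r * ?G1"
  have lin: "in_x1x2 ?E1" "in_x1x2 ?E2" "in_x1x2 ?G1" "in_x1x2 ?G2" by (intro in_x1x2_simps)+
  have hom: "whom d (int d1) ?E1" "whom d (int d2) ?E2" "whom d (int d1) ?G1" "whom d (int d2) ?G2"
    using d(1) by (auto intro!: wset_add wset_diff whom_C3_mult simp: wset_X)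
  show False
  proof (rule rigid_square[OF ac R_square \<kappa> HB lin hom])
    show "ev C3 ?G1 ?E1 ?E2 0 = X1" "ev C3 ?G2 ?E1 ?E2 0 = X2"
      by (simp_all add: ev_simps[OF rhom_C3] rhom_C3)
  next
    fix y1 y2 y3 :: "'a poly" and h n
    assume hc: "homogeneous_curve y1 y2 y3 h d1 d2 d3 n"
      and eq: "y3\<^sup>2 + pev B (pev ?G1 y1 y2 0) (pev ?G2 y1 y2 0) 0 = 0"
    have "pev B (pev ?G1 y1 y2 0) (pev ?G2 y1 y2 0) 0 = smult (c * u * v) (y1 * (y2\<^sup>2 + smult \<gamma> (y1\<^sup>2)))"
    proof (rule poly_ext)
      fix x
      define p q where "p = poly y1 x" and "q = poly y2 x"
      have s: "s = r + u" "t = r + v" by (simp_all add: u_def v_def)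
      have "poly (pev B (pev ?G1 y1 y2 0) (pev ?G2 y1 y2 0) 0) x
        = c * p * (p - u * (q + w * p)) * (p - v * (q + w * p))"
        by (simp add: B pev_simps s p_def q_def algebra_simps)
      also have "\<dots> = c * u * v * (p * (q\<^sup>2 + \<gamma> * p\<^sup>2))"
        using uv unfolding w_def \<gamma>_def by (simp add: field_simps power2_eq_square)
      finally show "poly (pev B (pev ?G1 y1 y2 0) (pev ?G2 y1 y2 0) 0) x
        = poly (smult (c * u * v) (y1 * (y2\<^sup>2 + smult \<gamma> (y1\<^sup>2)))) x"
        by (simp add: p_def q_def)
    qed
    with eq have "y3\<^sup>2 + smult (c * u * v) (y1 * (y2\<^sup>2 + smult \<gamma> (y1 ^ 2))) = 0" by simp
    then show "degree y1 = 0 \<and> degree y2 = 0 \<and> degree y3 = 0"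
      by (rule homogeneous_curve.const_D[OF hc]) (use c uv \<gamma> d in auto)
  qed
qed

text \<open>Type \<open>D\<close> after the shift of x2 that completes the square. With
  \<open>\<rho> = 0\<close> nothing is shifted, which covers weights where d1 does not divide
  d2.\<close>

lemma not_D:
  assumes d: "m * d1 = 2 * d2" "2 * d3 = d1 + 2 * d2" "2 \<le> m" and \<alpha>: "\<alpha> \<noteq> 0" "\<gamma> \<noteq> 0"
    and \<rho>: "\<rho> \<noteq> 0 \<longrightarrow> e * d1 = d2"
    and B: "B = C3 \<alpha> * (X1 * ((X2 - C3 \<rho> * X1 ^ e)\<^sup>2 + C3 \<gamma> * X1 ^ m))"
  shows False
proof -
  let ?E2 = "X2 - C3 \<rho> * X1 ^ e :: 'a mpoly3" and ?G2 = "X2 + C3 \<rho> * X1 ^ e :: 'a mpoly3"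
  have lin: "in_x1x2 (X1::'a mpoly3)" "in_x1x2 ?E2" "in_x1x2 (X1::'a mpoly3)" "in_x1x2 ?G2" by (intro in_x1x2_simps)+
  have "whom d (int d2) (C3 \<rho> * X1 ^ e :: 'a mpoly3)"
    using \<rho> by (cases "\<rho> = 0") (auto simp: C3_simps intro!: whom_C3_mult whom_X1_power)
  then have hom: "whom d (int d1) (X1::'a mpoly3)" "whom d (int d2) ?E2" "whom d (int d1) (X1::'a mpoly3)" "whom d (int d2) ?G2"
    by (auto intro!: wset_add wset_diff simp: wset_X)
  show False
  proof (rule rigid_square[OF ac R_square \<kappa> HB lin hom])
    show "ev C3 X1 X1 ?E2 0 = X1" "ev C3 ?G2 X1 ?E2 0 = X2"
      by (simp_all add: ev_simps[OF rhom_C3] rhom_C3)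
  next
    fix y1 y2 y3 :: "'a poly" and h n
    assume hc: "homogeneous_curve y1 y2 y3 h d1 d2 d3 n"
      and eq: "y3\<^sup>2 + pev B (pev X1 y1 y2 0) (pev ?G2 y1 y2 0) 0 = 0"
    have "y3\<^sup>2 + smult \<alpha> (y1 * (y2\<^sup>2 + smult \<gamma> (y1 ^ m))) = 0"
      using eq by (simp add: B pev_simps)
    then show "degree y1 = 0 \<and> degree y2 = 0 \<and> degree y3 = 0"
      by (rule homogeneous_curve.const_D[OF hc]) (use \<alpha> d in auto)
  qed
qed

text \<open>For d1 = d2 this is a binary cubic: a repeated root gives form (13), three distinct
  roots are type \<open>D4\<close>.\<close>

lemma cubic_case_equal:
  assumes d: "d1 = d2" "2 * d3 = 3 * d2" and c3: "c3 \<noteq> 0"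
    and B: "B = C3 c0 * X1 ^ 3 + C3 c1 * X1\<^sup>2 * X2 + C3 c2 * X1 * X2\<^sup>2 + C3 c3 * X2 ^ 3"
  shows "normal_form d (X3 + H) ((X3 + H)\<^sup>2 + B)"
proof -
  obtain r s t where rst: "c2 = - c3 * (r + s + t)" "c1 = c3 * (r * s + r * t + s * t)" "c0 = - c3 * r * s * t"
    using cubic_roots[OF ac c3] by blast
  have B1: "B = C3 c3 * (X2 - C3 r * X1) * (X2 - C3 s * X1) * (X2 - C3 t * X1)"
    unfolding B rst by (simp add: C3_mult C3_add C3_uminus C3_diff power2_eq_square power3_eq_cube algebra_simps)
  have two: ?thesis if "B = C3 c3 * (X2 - C3 p * X1) * (X2 - C3 q * X1)\<^sup>2" for p q
  proof -
    have "B = (C3 (- c3 * p) * X1 + C3 c3 * X2) * (C3 (- q) * X1 + C3 1 * X2)\<^sup>2"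
      unfolding that by (simp add: C3_mult C3_uminus C3_simps power2_eq_square algebra_simps)
    then show ?thesis using normal_form_13[of "- c3 * p" c3 "- q" 1] c3 by simp
  qed
  consider "r = s" | "r = t" | "s = t" | "r \<noteq> s" "r \<noteq> t" "s \<noteq> t" by blast
  then show ?thesis
  proof cases
    case 1 then show ?thesis using two[of t s] B1 by (simp add: power2_eq_square mult_ac)
  next
    case 2 then show ?thesis using two[of s t] B1 by (simp add: power2_eq_square mult_ac)
  next
    case 3 then show ?thesis using two[of r t] B1 by (simp add: power2_eq_square mult_ac)
  next
    case 4 then show ?thesis using not_D4[OF _ _ c3 4 B1] d by simp
  qed
qed

text \<open>When d1 < d2, the bound d2 < 2 d1 leaves only the additional monomials of
  \<open>E6\<close>, \<open>E7\<close> and \<open>E8\<close> beside x2^3.\<close>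

lemma cubic_case:
  assumes d3: "d3 < d1 + d2" and d: "2 * d3 = 3 * d2" and c3: "c3 \<noteq> 0"
    and B: "B = C3 c0 * X1 ^ a0 + C3 c1 * X1 ^ a1 * X2 + C3 c2 * X1 ^ a2 * X2\<^sup>2 + C3 c3 * X2 ^ 3"
    and a: "c0 \<noteq> 0 \<longrightarrow> a0 * d1 = 2 * d3" "c1 \<noteq> 0 \<longrightarrow> a1 * d1 + d2 = 2 * d3" "c2 \<noteq> 0 \<longrightarrow> a2 * d1 + 2 * d2 = 2 * d3"
  shows "normal_form d (X3 + H) ((X3 + H)\<^sup>2 + B)"
proof (cases "d1 = d2")
  case True
  have "c0 \<noteq> 0 \<longrightarrow> a0 * d1 = 3 * d1" "c1 \<noteq> 0 \<longrightarrow> a1 * d1 = 2 * d1" "c2 \<noteq> 0 \<longrightarrow> a2 * d1 = 1 * d1"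
    using a d True by simp_all
  then have "c0 \<noteq> 0 \<longrightarrow> a0 = 3" "c1 \<noteq> 0 \<longrightarrow> a1 = 2" "c2 \<noteq> 0 \<longrightarrow> a2 = 1"
    using d_pos by simp_all
  then have "B = C3 c0 * X1 ^ 3 + C3 c1 * X1\<^sup>2 * X2 + C3 c2 * X1 * X2\<^sup>2 + C3 c3 * X2 ^ 3"
    unfolding B by (cases "c0 = 0"; cases "c1 = 0"; cases "c2 = 0") (simp_all add: C3_simps)
  from cubic_case_equal[OF True d c3 this] show ?thesis .
next
  case False
  then have lt: "d1 < d2" "d2 < 2 * d1" using d_le d d3 by auto
  have c2: "c2 = 0"
  proof (rule ccontr)
    assume "c2 \<noteq> 0"
    then have "a2 * d1 = d2" using a(3) d by simp
    then have "a2 * d1 < 2 * d1" "1 * d1 < a2 * d1" using lt by simp_all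
    then have "a2 < 2" "1 < a2" by (simp_all only: mult_less_cancel2)
    then show False by simp
  qed
  have c1: "a1 = 3 \<and> 3 * d1 = 2 * d2" if "c1 \<noteq> 0"
  proof -
    have e: "a1 * d1 = 2 * d2" using a(2) that d by simp
    then have "a1 * d1 < 4 * d1" "2 * d1 < a1 * d1" using lt by simp_all
    then have "a1 < 4" "2 < a1" by (simp_all only: mult_less_cancel2)
    then have "a1 = 3" by simp
    with e show ?thesis by simp
  qed
  have c0: "(a0 = 4 \<or> a0 = 5) \<and> a0 * d1 = 3 * d2" if "c0 \<noteq> 0"
  proof -
    have e: "a0 * d1 = 3 * d2" using a(1) that d by simp
    then have "a0 * d1 < 6 * d1" "3 * d1 < a0 * d1" using lt by simp_all
    then have "a0 < 6" "3 < a0" by (simp_all only: mult_less_cancel2)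
    then have "a0 = 4 \<or> a0 = 5" by auto
    with e show ?thesis by simp
  qed
  consider "c0 = 0" "c1 = 0" | "c1 \<noteq> 0" "c0 = 0" | "c1 \<noteq> 0" "c0 \<noteq> 0" | "c1 = 0" "c0 \<noteq> 0" "a0 = 4" | "c1 = 0" "c0 \<noteq> 0" "a0 = 5"
    using c0 by blast
  then show ?thesis
  proof cases
    case 1
    then show ?thesis using normal_form_6[OF c3] by (simp add: B c2 C3_simps)
  next
    case 2
    then have e: "a1 = 3" "3 * d1 = 2 * d2" using c1 by auto
    have False
    proof (rule rigid_id)
      fix y1 y2 y3 :: "'a poly" and h n
      assume hc: "homogeneous_curve y1 y2 y3 h d1 d2 d3 n" and eq: "y3\<^sup>2 + pev B y1 y2 0 = 0"
      have "y3\<^sup>2 + smult c3 (y2 ^ 3) + smult c1 (y1 ^ 3 * y2) = 0"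
        using eq by (simp add: B c2 2 e pev_simps C3_simps algebra_simps)
      then show "degree y1 = 0 \<and> degree y2 = 0 \<and> degree y3 = 0"
        by (rule homogeneous_curve.const_E7[OF hc]) (use c3 2 d e in auto)
    qed
    then show ?thesis ..
  next
    case 3
    \<comment> \<open>The two degree conditions together give 2 a0 = 9.\<close>
    then have e: "2 * (a0 * d1) = 9 * d1" and "a0 = 4 \<or> a0 = 5" using c0 c1 by auto
    from this(2) show ?thesis by (rule disjE) (use e d_pos in simp_all)
  next
    case 4
    have False
    proof (rule rigid_id)
      fix y1 y2 y3 :: "'a poly" and h n
      assume hc: "homogeneous_curve y1 y2 y3 h d1 d2 d3 n" and eq: "y3\<^sup>2 + pev B y1 y2 0 = 0"
      have "y3\<^sup>2 + smult c3 (y2 ^ 3) + smult c0 (y1 ^ 4) = 0"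
        using eq by (simp add: B c2 4 pev_simps C3_simps algebra_simps)
      then show "degree y1 = 0 \<and> degree y2 = 0 \<and> degree y3 = 0"
        by (rule homogeneous_curve.const_E6[OF hc]) (use c3 4 d c0 in auto)
    qed
    then show ?thesis ..
  next
    case 5
    have False
    proof (rule rigid_id)
      fix y1 y2 y3 :: "'a poly" and h n
      assume hc: "homogeneous_curve y1 y2 y3 h d1 d2 d3 n" and eq: "y3\<^sup>2 + pev B y1 y2 0 = 0"
      have "y3\<^sup>2 + smult c3 (y2 ^ 3) + smult c0 (y1 ^ 5) = 0"
        using eq by (simp add: B c2 5 pev_simps C3_simps algebra_simps)
      then show "degree y1 = 0 \<and> degree y2 = 0 \<and> degree y3 = 0"
        by (rule homogeneous_curve.const_E8[OF hc]) (use c3 5 d c0 in auto)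
    qed
    then show ?thesis ..
  qed
qed

text \<open>If d1 divides d2, then \<open>B\<close> splits into two factors linear in x2, which must
  differ since \<open>B\<close> is no square. Otherwise the mixed term is impossible, and so is an
  even \<open>a0\<close>.\<close>

lemma quadratic_case:
  assumes d: "d2 = d3" and c2: "c2 \<noteq> 0"
    and B: "B = C3 c0 * X1 ^ a0 + C3 c1 * X1 ^ a1 * X2 + C3 c2 * X2\<^sup>2"
    and a: "c0 \<noteq> 0 \<longrightarrow> a0 * d1 = 2 * d2" "c1 \<noteq> 0 \<longrightarrow> a1 * d1 = d2"
  shows "normal_form d (X3 + H) ((X3 + H)\<^sup>2 + B)"
proof (cases "d1 dvd d2")
  case True
  then obtain e where e: "d2 = e * d1" by (auto simp: dvd_def mult.commute)
  then have e1: "1 \<le> e" using d_pos d_le by (cases e) auto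
  have "c0 \<noteq> 0 \<longrightarrow> a0 = 2 * e" "c1 \<noteq> 0 \<longrightarrow> a1 = e"
    using a e d_pos by auto
  then have B1: "B = C3 c0 * X1 ^ (2 * e) + C3 c1 * X1 ^ e * X2 + C3 c2 * X2\<^sup>2"
    unfolding B by (cases "c0 = 0"; cases "c1 = 0") (simp_all add: C3_simps)
  obtain r s where rs: "c1 = - c2 * (r + s)" "c0 = c2 * r * s" using quadratic_roots[OF ac c2] by blast
  have B2: "B = C3 c2 * (X2 - C3 r * X1 ^ e) * (X2 - C3 s * X1 ^ e)"
    unfolding B1 rs power_even_eq
      by (simp add: C3_mult C3_add C3_uminus C3_diff C3_numeral power2_eq_square algebra_simps)
  show ?thesis
  proof (cases "r = s")
    case True
    have "whom d (int d3) (X2 - C3 s * X1 ^ e)"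
      using d e by (auto intro!: wset_diff whom_C3_mult whom_X1_power simp: wset_X)
    then show ?thesis using not_square[of c2 "X2 - C3 s * X1 ^ e"] B2 True by (simp add: power2_eq_square mult_ac)
  next
    case False
    have "B = (C3 (- c2 * r) * X1 ^ e + C3 c2 * X2) * (C3 (- s) * X1 ^ e + C3 1 * X2)"
      unfolding B2 by (simp add: C3_mult C3_uminus C3_simps algebra_simps)
    moreover have "(- c2 * r) * 1 - c2 * (- s) \<noteq> 0"
    proof -
      have "(- c2 * r) * 1 - c2 * (- s) = c2 * (s - r)" by (simp add: algebra_simps)
      then show ?thesis using c2 False by simp
    qed
    ultimately show ?thesis using normal_form_12[of "- c2 * r" 1 c2 "- s" e] e1 by simp
  qed
next
  case False
  have c1: "c1 = 0" using a(2) False by (metis dvd_triv_right)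
  show ?thesis
  proof (cases "c0 = 0")
    case True
    then have "B = C3 c2 * X2\<^sup>2" using c1 by (simp add: B C3_simps)
    then show ?thesis using not_square[of c2 X2] d by (simp add: wset_X)
  next
    case c0: False
    then have e: "a0 * d1 = 2 * d2" using a(1) by simp
    have "odd a0"
    proof
      assume "even a0"
      then obtain k where "a0 = 2 * k" by (elim evenE)
      with e have "d2 = k * d1" by simp
      with False show False by simp
    qed
    moreover have "2 \<le> a0"
    proof -
      have "2 * d1 \<le> a0 * d1" using e d_le by simp
      then show ?thesis using d_pos by simp
    qed
    ultimately obtain k where "a0 = 3 + 2 * k" using odd_ge_2 by blast
    then show ?thesis using normal_form_10[of c0 c2 d "X3 + H" k] c0 c2 c1 by (simp add: B C3_simps add.assoc)
  qed
qed

lemma quadratic_times_x1_case: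
  assumes d: "2 * d3 = d1 + 2 * d2" and c2: "c2 \<noteq> 0"
    and B: "B = C3 c0 * X1 ^ a0 + C3 c1 * X1 ^ a1 * X2 + C3 c2 * X1 * X2\<^sup>2"
    and a: "c0 \<noteq> 0 \<longrightarrow> a0 * d1 = d1 + 2 * d2" "c1 \<noteq> 0 \<longrightarrow> a1 * d1 = d1 + d2"
  shows "normal_form d (X3 + H) ((X3 + H)\<^sup>2 + B)"
proof (cases "d1 dvd d2")
  case True
  then obtain e where e: "d2 = e * d1" by (auto simp: dvd_def mult.commute)
  then have e1: "1 \<le> e" using d_pos d_le by (cases e) auto
  have "c0 \<noteq> 0 \<longrightarrow> a0 * d1 = Suc (2 * e) * d1" "c1 \<noteq> 0 \<longrightarrow> a1 * d1 = Suc e * d1"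
    using a e by simp_all
  then have "c0 \<noteq> 0 \<longrightarrow> a0 = Suc (2 * e)" "c1 \<noteq> 0 \<longrightarrow> a1 = Suc e"
    using d_pos by (simp_all only: mult_cancel2) auto
  then have B1: "B = C3 c0 * X1 ^ Suc (2 * e) + C3 c1 * X1 ^ Suc e * X2 + C3 c2 * X1 * X2\<^sup>2"
    unfolding B by (cases "c0 = 0"; cases "c1 = 0") (simp_all add: C3_simps)
  obtain r s where rs: "c1 = - c2 * (r + s)" "c0 = c2 * r * s" using quadratic_roots[OF ac c2] by blast
  show ?thesis
  proof (cases "r = s")
    case True
    have B2: "B = C3 c2 * X1 * (X2 - C3 s * X1 ^ e)\<^sup>2"
      unfolding B1 rs True power_Suc power_even_eq
      by (simp add: C3_mult C3_add C3_uminus C3_diff C3_numeral power2_eq_square algebra_simps)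
    \<comment> \<open>A double factor: form (13) for equal weights, form (7) if the factor is x2
      itself, form (14) otherwise.\<close>
    consider "e = 1" | "2 \<le> e" "s = 0" | "2 \<le> e" "s \<noteq> 0" using e1 by linarith
    then show ?thesis
    proof cases
      case 1
      have "B = (C3 c2 * X1 + C3 0 * X2) * (C3 (- s) * X1 + C3 1 * X2)\<^sup>2"
        unfolding B2 1 by (simp add: C3_simps C3_uminus)
      then show ?thesis using normal_form_13[of c2 0 "- s" 1] c2 by simp
    next
      case 2
      then show ?thesis using normal_form_7[OF c2] by (simp add: B2 C3_simps)
    next
      case 3
      obtain b where b: "b\<^sup>2 = c2" using ex_sqrt[OF ac] by blast
      have "B = (C3 (- b * s) * X1 ^ e + C3 b * X2)\<^sup>2 * X1"
        unfolding B2 b[symmetric] by (simp add: C3_mult C3_uminus power2_eq_square algebra_simps)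
      moreover have "(- b * s) * b \<noteq> 0" using b c2 3 by auto
      ultimately show ?thesis using normal_form_14[of "- b * s" b e] 3 by simp
    qed
  next
    case False
    \<comment> \<open>The midpoint of the roots; \<open>\<gamma>\<close> is minus the square of half
      their difference, so distinct roots give type \<open>D\<close>.\<close>
    define \<rho> where "\<rho> = (r + s) / 2"
    have rho: "r + s = 2 * \<rho>" by (simp add: \<rho>_def)
    have \<gamma>: "r * s = \<rho>\<^sup>2 + - ((r - s) / 2)\<^sup>2" by (simp add: \<rho>_def power2_eq_square field_simps)
    define \<gamma> where "\<gamma> = - ((r - s) / 2)\<^sup>2"
    have c: "c1 = - (2 * c2 * \<rho>)" "c0 = c2 * (\<rho>\<^sup>2 + \<gamma>)"
      using rs rho \<gamma> by (simp_all add: \<gamma>_def mult.assoc)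
    have "B = C3 c2 * (X1 * ((X2 - C3 \<rho> * X1 ^ e)\<^sup>2 + C3 \<gamma> * X1 ^ (2 * e)))"
    proof -
      have "C3 c1 = - (C3 c2 * C3 \<rho> + C3 c2 * C3 \<rho>)" unfolding c by (simp add: C3_uminus C3_numeral C3_mult algebra_simps)
      moreover have "C3 c0 = C3 c2 * (C3 \<rho> * C3 \<rho> + C3 \<gamma>)" unfolding c by (simp add: C3_add C3_mult power2_eq_square)
      ultimately show ?thesis
        unfolding B1 power_Suc power_even_eq by (simp add: power2_eq_square algebra_simps)
    qed
    then have False
      using not_D[of "2 * e" c2 \<gamma> \<rho> e] d e e1 c2 False by (simp add: \<gamma>_def)
    then show ?thesis ..
  qed
next
  case False
  have c1: "c1 = 0"
  proof (rule ccontr)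
    assume "c1 \<noteq> 0"
    then have "d1 dvd d1 + d2" using a(2) by (metis dvd_triv_right)
    with False show False by simp
  qed
  show ?thesis
  proof (cases "c0 = 0")
    case True
    then show ?thesis using normal_form_7[OF c2] by (simp add: B c1 C3_simps)
  next
    case c0: False
    then have e: "a0 * d1 = d1 + 2 * d2" using a(1) by simp
    then obtain m where m: "a0 = Suc m" using d_pos by (cases a0) auto
    have md: "m * d1 = 2 * d2" using e m by simp
    have "2 * d1 \<le> m * d1" using md d_le by simp
    then have "2 \<le> m" using d_pos by simp
    moreover have "B = C3 c2 * (X1 * ((X2 - C3 0 * X1 ^ 0)\<^sup>2 + C3 (c0 / c2) * X1 ^ m))"
    proof -
      have "C3 c0 = C3 c2 * C3 (c0 / c2)" using c2 by (simp flip: C3_mult)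
      then show ?thesis unfolding B c1 m by (simp add: C3_simps algebra_simps)
    qed
    ultimately have False using not_D[OF md d, of c2 "c0 / c2" 0 0] c2 c0 by simp
    then show ?thesis ..
  qed
qed

lemma linear_case:
  assumes B: "B = C3 c0 * X1 ^ a0 + C3 c1 * X1 ^ a1 * X2"
    and a: "c0 \<noteq> 0 \<longrightarrow> a0 * d1 = 2 * d3" "c1 \<noteq> 0 \<longrightarrow> a1 * d1 + d2 = 2 * d3"
  shows "normal_form d (X3 + H) ((X3 + H)\<^sup>2 + B)"
proof (cases "c1 = 0")
  case False
  then have a1: "a1 * d1 + d2 = 2 * d3" using a(2) by simp
  show ?thesis
  proof (cases "c0 = 0")
    case True
    have "1 \<le> a1" using a1 d_pos d_le by (cases a1) auto
    then show ?thesis using normal_form_9[OF False] True by (simp add: B C3_simps)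
  next
    case c0: False
    then have "a0 * d1 = a1 * d1 + d2" using a(1) a1 by simp
    then have "a1 * d1 < a0 * d1" using d_pos d_le by simp
    then have "a1 < a0" by simp
    then obtain e where e: "a0 = e + a1" "1 \<le> e" by (metis add.commute less_iff_Suc_add le_add1 plus_1_eq_Suc add_Suc_right)
    have "B = (C3 c0 * X1 ^ e + C3 c1 * X2) * X1 ^ a1" unfolding B e(1) by (simp add: power_add algebra_simps)
    then show ?thesis using normal_form_11[of c0 c1 e] c0 False e(2) by simp
  qed
next
  case True
  then have B1: "B = C3 c0 * X1 ^ a0" by (simp add: B C3_simps)
  have c0: "c0 \<noteq> 0"
  proof
    assume "c0 = 0"
    then show False using not_square[of 0 0] B1 by (simp add: C3_simps)
  qed
  then have a0: "a0 * d1 = 2 * d3" using a(1) by simp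
  \<comment> \<open>An even power would make \<open>B\<close> a multiple of a square.\<close>
  have "odd a0"
  proof
    assume "even a0"
    then obtain k where k: "a0 = 2 * k" by (elim evenE)
    have "whom d (int d3) (X1 ^ k :: 'a mpoly3)" by (rule whom_X1_power) (use a0 k in simp)
    then show False using not_square[of c0 "X1 ^ k"] B1 by (simp add: k power_even_eq)
  qed
  moreover have "2 \<le> a0"
  proof -
    have "2 * d1 \<le> a0 * d1" using a0 d_le by simp
    then show ?thesis using d_pos by simp
  qed
  ultimately obtain k where "a0 = 3 + 2 * k" using odd_ge_2 by blast
  then show ?thesis using normal_form_8[OF c0, of d "X3 + H" k] B1 by simp
qed

text \<open>Cases by the degree of \<open>B\<close> in x2. The bound d3 < d1 + d2 leaves no factor
  x1 beside x2^3 and at most one beside x2^2.\<close>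

lemma square_case:
  assumes hB: "whom d (int (2 * d3)) B" and d3: "d3 < d1 + d2"
  shows "normal_form d (X3 + H) ((X3 + H)\<^sup>2 + B)"
proof -
  have "2 * d3 < 4 * d2" using d3 d_le by linarith
  from binary_expansion[OF HB(2) hB this] obtain c0 c1 c2 c3 a0 a1 a2 a3 where
    B: "B = C3 c0 * X1 ^ a0 + C3 c1 * X1 ^ a1 * X2 + C3 c2 * X1 ^ a2 * X2\<^sup>2 + C3 c3 * X1 ^ a3 * X2 ^ 3" and
    a: "c0 \<noteq> 0 \<longrightarrow> a0 * d1 = 2 * d3" "c1 \<noteq> 0 \<longrightarrow> a1 * d1 + d2 = 2 * d3" "c2 \<noteq> 0 \<longrightarrow> a2 * d1 + 2 * d2 = 2 * d3"
      "c3 \<noteq> 0 \<longrightarrow> a3 * d1 + 3 * d2 = 2 * d3" .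
  show ?thesis
  proof (cases "c3 = 0")
    case False
    then have e: "a3 * d1 + 3 * d2 = 2 * d3" using a(4) by simp
    have "a3 = 0" using e d3 d_le by (cases a3) auto
    then show ?thesis using cubic_case[of c3 c0 a0 c1 a1 c2 a2] B a e d3 False by simp
  next
    case c3: True
    show ?thesis
    proof (cases "c2 = 0")
      case False
      then have e: "a2 * d1 + 2 * d2 = 2 * d3" using a(3) by simp
      then have "a2 * d1 < 2 * d1" using d3 by linarith
      then have "a2 < 2" by simp
      then consider "a2 = 0" | "a2 = 1" by linarith
      then show ?thesis
      proof cases
        case 1
        then have "d2 = d3" using e by simp
        then show ?thesis using quadratic_case[of c2 c0 a0 c1 a1] B a 1 False c3 by (simp add: C3_simps)
      next
        case 2
        then have d: "2 * d3 = d1 + 2 * d2" using e by simp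
        then show ?thesis using quadratic_times_x1_case[of c2 c0 a0 c1 a1] B a 2 False c3 by (simp add: C3_simps)
      qed
    next
      case True
      then show ?thesis using linear_case[of c0 a0 c1 a1] B a c3 by (simp add: C3_simps)
    qed
  qed
qed

end

section \<open>Relations linear in x3 and the classification\<close>

context principal_relation
begin

text \<open>The coefficient of x3 has degree below d1 + d2, so up to scalars it is a power of x1, or
  x2 plus a multiple of such a power. The former gives forms (2) and (5); in the latter, division by
  the coefficient produces \<open>h\<close> and form (4).\<close>

lemma linear_x3_case:
  assumes R: "R = A0 + A1 * X3" and A: "in_x1x2 A0" "in_x1x2 A1" "whom d (int N) A0" "whom d (int N - int d3) A1" "A1 \<noteq> 0"
  shows "\<exists>h. in_x1x2 h \<and> whom d (int d3) h \<and> (\<exists>c F. c \<noteq> 0 \<and> normal_form d (X3 + h) F \<and> R = C3 c * F)"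
proof -
  have "\<not> int N - int d3 < 0" using whom_negative[OF A(4)] A(5) by blast
  then have N: "int N - int d3 = int (N - d3)" "d3 \<le> N" by auto
  have "N - d3 < 4 * d2" using N_bound d_pos d_le by linarith
  from binary_expansion[OF A(2) A(4)[unfolded N(1)] this] obtain c0 c1 c2 c3 a0 a1 a2 a3 where
    A1: "A1 = C3 c0 * X1 ^ a0 + C3 c1 * X1 ^ a1 * X2 + C3 c2 * X1 ^ a2 * X2\<^sup>2 + C3 c3 * X1 ^ a3 * X2 ^ 3" and
    a: "c0 \<noteq> 0 \<longrightarrow> a0 * d1 = N - d3" "c1 \<noteq> 0 \<longrightarrow> a1 * d1 + d2 = N - d3" "c2 \<noteq> 0 \<longrightarrow> a2 * d1 + 2 * d2 = N - d3"
      "c3 \<noteq> 0 \<longrightarrow> a3 * d1 + 3 * d2 = N - d3" .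
  have lt: "N - d3 < d1 + d2" using N_bound N(2) by linarith
  have c2: "c2 = 0"
  proof (rule ccontr)
    assume "c2 \<noteq> 0"
    then show False using a(3) lt d_le by simp
  qed
  have c3: "c3 = 0"
  proof (rule ccontr)
    assume "c3 \<noteq> 0"
    then show False using a(4) lt d_le by simp
  qed
  have a1: "a1 = 0 \<and> d2 = N - d3" if "c1 \<noteq> 0" using a(2) that lt by (cases a1) auto
  have A1': "A1 = C3 c0 * X1 ^ a0 + C3 c1 * X2"
    using a1 by (cases "c1 = 0") (simp_all add: A1 c2 c3 C3_simps)
  show ?thesis
  proof (cases "c1 = 0")
    case True
    then have c0: "c0 \<noteq> 0" using A(5) A1' by (auto simp: C3_simps)
    define P where "P = C3 (inverse c0) * A0"
    have "C3 c0 * P = A0" unfolding P_def using C3_inverse[OF c0] by (simp flip: mult.assoc)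
    then have R1: "R = C3 c0 * (X1 ^ a0 * X3 + P)" unfolding R A1' True by (simp add: C3_simps algebra_simps)
    have P: "in_x1x2 P" "whom d (int N) P" using A(1,3) by (auto simp: P_def intro: in_x1x2_simps whom_C3_mult)
    show ?thesis
    proof (cases "a0 = 0")
      case True
      then have "N = d3" using a(1) c0 N(2) by simp
      moreover have "R = C3 c0 * (X3 + P)" using R1 True by simp
      ultimately show ?thesis using P c0 normal_form_2 by blast
    next
      case False
      then have "normal_form d (X3 + 0) (X1 ^ a0 * (X3 + 0) + P)"
        using normal_form_5[of a0 P d N "X3 + 0"] P by (simp add: whomog_iff)
      then show ?thesis using R1 c0 by (intro exI[of _ 0]) (auto simp: in_x1x2_simps)
    qed
  next
    case False
    then have d2: "d2 = N - d3" using a1 by blast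
    define b where "b = c0 / c1"
    \<comment> \<open>For \<open>c0 = 0\<close> any exponent would do; form (4) wants at least
      1.\<close>
    define e where "e = (if c0 = 0 then 1 else a0)"
    let ?L = "X2 + C3 b * X1 ^ e"
    have e: "b \<noteq> 0 \<longrightarrow> e * d1 = d2" using a(1) d2 by (simp add: b_def e_def)
    have e1: "1 \<le> e" using a(1) d2 d_pos d_le by (cases a0) (auto simp: e_def)
    have "C3 c1 * C3 b = C3 c0" using False by (simp add: b_def flip: C3_mult)
    then have AL: "A1 = C3 c1 * ?L"
      unfolding A1' by (cases "c0 = 0") (simp_all add: e_def b_def C3_simps distrib_left flip: mult.assoc)
    define P where "P = C3 (inverse c1) * A0"
    have P0: "C3 c1 * P = A0" unfolding P_def using C3_inverse[OF False] by (simp flip: mult.assoc)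
    have P: "in_x1x2 P" "whom d (int N) P" using A(1,3) by (auto simp: P_def intro: in_x1x2_simps whom_C3_mult)
    have "\<exists>H c k. P = ?L * H + C3 c * X1 ^ k \<and> in_x1x2 H \<and> whom d (int N - int d2) H \<and> (c \<noteq> 0 \<longrightarrow> k * d1 = N)"
      by (rule divide_linear[OF bform_of_x1x2[OF P] refl e])
    then obtain H c k where H: "P = ?L * H + C3 c * X1 ^ k" "in_x1x2 H" "whom d (int N - int d2) H" "c \<noteq> 0 \<longrightarrow> k * d1 = N"
      by (elim exE conjE)
    have "int N - int d2 = int d3" using d2 N(2) by linarith
    with H(3) have Hd: "whom d (int d3) H" by simp
    have R1: "R = C3 c1 * (?L * (X3 + H) + C3 c * X1 ^ k)"
      unfolding R AL P0[symmetric] H(1) by (simp add: algebra_simps)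
    \<comment> \<open>A zero remainder would split \<open>R\<close> into factors of degrees d2 and
      d3, both below N = d2 + d3.\<close>
    have "c \<noteq> 0"
    proof
      assume "c = 0"
      then have r: "R = (C3 c1 * ?L) * (X3 + H)" using R1 by (simp add: C3_simps mult.assoc)
      have "whom d (int d2) (C3 b * X1 ^ e)"
        using e by (cases "b = 0") (auto simp: C3_simps intro!: whom_C3_mult whom_X1_power)
      then have "whom d (int d2) (C3 c1 * ?L)" "whom d (int d3) (X3 + H)"
        using Hd by (auto intro!: whom_C3_mult wset_add simp: wset_X)
      then have w: "wle d (int d2) (C3 c1 * ?L)" "wle d (int d3) (X3 + H)" by (auto elim: whom_wle)
      have "int d2 < int N" "int d3 < int N" using d2 N(2) d_pos d_le by linarith+
      with R_not_product[OF r w] show False .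
    qed
    moreover have "2 \<le> k"
    proof -
      have "k * d1 = d2 + d3" using H(4) \<open>c \<noteq> 0\<close> d2 N(2) by simp
      then have "2 * d1 \<le> k * d1" using d_le by simp
      then show ?thesis using d_pos by simp
    qed
    ultimately have "normal_form d (X3 + H) (?L * (X3 + H) + C3 c * X1 ^ k)" using e1 by (intro normal_form_4)
    then show ?thesis using H(2) Hd R1 False by blast
  qed
qed

lemma classification:
  assumes ac: "alg_closed_field TYPE('a)"
  shows "\<exists>h. in_x1x2 h \<and> whom d (int d3) h \<and> (\<exists>c F. c \<noteq> 0 \<and> normal_form d (X3 + h) F \<and> R = C3 c * F)"
proof -
  \<comment> \<open>N < d1 + d2 + d3 <= 3 d3.\<close>
  have "snd (snd m) \<le> 2" if "m \<in> keys R" for m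
  proof -
    have "d3 * snd (snd m) < d3 * 3" using whom_keysD[OF R_hom that] N_bound d_le by linarith
    then show ?thesis by simp
  qed
  from slice_x3[OF R_hom this] obtain A0 A1 A2 where
    R: "R = A0 + A1 * X3 + A2 * X3\<^sup>2" "in_x1x2 A0" "in_x1x2 A1" "in_x1x2 A2" and
    A: "whom d (int N) A0" "whom d (int N - int d3) A1" "whom d (int N - 2 * int d3) A2" by blast
  show ?thesis
  proof (cases "A2 = 0")
    case True
    show ?thesis
    proof (cases "A1 = 0")
      case A1: True
      then have "in_x1x2 R" using R True by simp
      from binary_case[OF ac this]
      obtain c k e1 e2 where F: "c \<noteq> 0" "k \<noteq> 0" "gcd e1 e2 = 1" "R = C3 k * (X1 ^ e1 + C3 c * X2 ^ e2)"
        by (elim exE conjE)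
      have "normal_form d (X3 + 0) (X1 ^ e1 + C3 c * X2 ^ e2)" using F by (intro normal_form_3)
      then show ?thesis using F by (intro exI[of _ 0]) (auto simp: in_x1x2_simps)
    next
      case False
      then show ?thesis using linear_x3_case[of A0 A1] R A True by simp
    qed
  next
    case False
    \<comment> \<open>The degree N - 2 d3 of \<open>A2\<close> is below d1, the smallest
      weight.\<close>
    have "wle d 0 A2"
      unfolding wset_def
    proof
      fix m assume m: "m \<in> keys A2"
      obtain a b c where abc: "m = (a,b,c)" by (cases m)
      have "c = 0" using R(4) m abc by (auto simp: in_x1x2_def)
      moreover have "int (wdeg_mono d m) = int N - 2 * int d3" using A(3) m by (simp add: wset_def)
      ultimately have "int (d1 * a + d2 * b) = int N - 2 * int d3" by (simp add: abc wdeg_mono_def)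
      then have "int (d1 * a + d2 * b) < int d1" using N_bound d_le by linarith
      then have "d1 * a + d2 * b < d1" by (simp only: of_nat_less_iff)
      then have "a = 0" "b = 0" using d_le by (cases a; cases b; simp)+
      then show "int (wdeg_mono d m) \<in> {..0}" using \<open>c = 0\<close> by (simp add: abc wdeg_mono_def)
    qed
    then obtain \<kappa> where k: "A2 = C3 \<kappa>" using wle_const[of d1 d2 d3] d_pos d_le by auto
    have k0: "\<kappa> \<noteq> 0" using False k by (simp add: C3_simps)
    have N: "N = 2 * d3"
      using A(3) k0 unfolding k wset_C3 by simp
    then have d3: "d3 < d1 + d2" using N_bound by simp
    \<comment> \<open>Completing the square in x3; this \<open>H\<close> is the \<open>h\<close> of
      the theorem.\<close>
    define H where "H = C3 (1 / (2 * \<kappa>)) * A1"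
    define B where "B = C3 (1 / \<kappa>) * A0 - H\<^sup>2"
    have A1: "A1 = C3 \<kappa> * H + C3 \<kappa> * H"
    proof -
      have "C3 \<kappa> * C3 (1 / (2 * \<kappa>)) + C3 \<kappa> * C3 (1 / (2 * \<kappa>)) = (1 :: 'a mpoly3)"
        using k0 by (simp add: C3_simps flip: C3_mult C3_add)
      then have "(C3 \<kappa> * C3 (1 / (2 * \<kappa>)) + C3 \<kappa> * C3 (1 / (2 * \<kappa>))) * A1 = A1" by simp
      then show ?thesis unfolding H_def by (simp add: algebra_simps)
    qed
    have "C3 \<kappa> * (C3 (1 / \<kappa>) * A0) = A0" using C3_inverse[OF k0] by (simp add: inverse_eq_divide flip: mult.assoc)
    then have A0: "A0 = C3 \<kappa> * (B + H\<^sup>2)" by (simp add: B_def)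
    have R1: "R = C3 \<kappa> * ((X3 + H)\<^sup>2 + B)"
      unfolding R(1) A0 A1 k by (simp add: power2_eq_square algebra_simps)
    have H: "in_x1x2 H" "whom d (int d3) H" using R(3) A(2) N by (auto simp: H_def intro: in_x1x2_simps whom_C3_mult)
    have B: "in_x1x2 B" "whom d (int (2 * d3)) B"
      using R(2) A(1) H N by (auto simp: B_def intro!: in_x1x2_simps wset_diff whom_C3_mult whom_power[OF H(2)])
    interpret square_relation f1 f2 f3 g1 g2 g3 h1 h2 h3 d1 d2 d3 R N H B \<kappa>
      by unfold_locales (use ac R1 k0 H B N in auto)
    show ?thesis using square_case[OF B(2) d3] H R1 k0 by blast
  qed
qed

end

section \<open>Leading forms and the final assembly\<close>

lemma top_top_comp:
  fixes f :: "'a::comm_ring_1 mpoly3"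
  assumes "f \<noteq> 0"
  shows "top (1,1,1) (int (deg1 f)) f (top_comp f)" "top_comp f \<noteq> 0"
proof -
  let ?S = "{m \<in> keys f. wdeg_mono (1,1,1) m = deg1 f}"
  have le: "wdeg_mono (1,1,1) m \<le> deg1 f" if "m \<in> keys f" for m
    unfolding deg1_def using that by (intro Max_ge) auto
  have l: "lookup (top_comp f) m = (if m \<in> ?S then lookup f m else 0)" for m
    unfolding top_comp_def lookup_sum by (simp add: lookup_single when_def)
  show "top (1,1,1) (int (deg1 f)) f (top_comp f)"
    unfolding top_def wset_def
  proof (intro conjI ballI)
    fix m assume "m \<in> keys (top_comp f)"
    then show "int (wdeg_mono (1,1,1) m) \<in> {int (deg1 f)}" by (auto simp: in_keys_iff l split: if_splits)
  next
    fix m assume "m \<in> keys (f - top_comp f)"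
    then have "m \<in> keys f" "wdeg_mono (1,1,1) m \<noteq> deg1 f"
      by (auto simp: in_keys_iff l lookup_minus split: if_splits)
    then show "int (wdeg_mono (1,1,1) m) \<in> {..int (deg1 f) - 1}" using le[of m] by simp
  qed
  have "deg1 f \<in> wdeg_mono (1,1,1) ` keys f"
    unfolding deg1_def using assms by (intro Max_in) auto
  then obtain m where "m \<in> ?S" by auto
  then have "lookup (top_comp f) m \<noteq> 0" by (simp add: l in_keys_iff)
  then show "top_comp f \<noteq> 0" by auto
qed

text \<open>The leading forms are homogeneous, so the kernel of \<open>\<psi>\<close> is graded and
  contains the leading form of \<open>R\<close>. This is a multiple of \<open>R\<close> of the same
  degree, hence a scalar multiple. \<open>N = 0\<close> would make \<open>R\<close> a unit and put 1
  into the kernel.\<close>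

lemma (in automorphism3) relation_homogeneous:
  assumes R: "\<And>P. \<psi> P = 0 \<longleftrightarrow> R dvd P" "R \<noteq> 0"
  obtains N where "whom d (int N) R" "1 \<le> N"
proof -
  obtain N Q where Q: "top d (int N) R Q" "Q \<noteq> 0" using ex_top_nonzero[OF R(2)] .
  have "top (1,1,1) (int N) (\<psi> R) (\<psi> Q)"
    unfolding \<psi>_def by (rule top_ev[OF _ _ _ Q(1)]) (use top_f[THEN topD(1)] in \<open>auto intro: top_self\<close>)
  moreover have "\<psi> R = 0" by (simp add: R(1))
  ultimately have "\<psi> Q = 0" by (metis top_unique top_lower wset_zero)
  then obtain S where S: "Q = R * S" by (auto simp: R(1))
  have "wle d (int N - int N) S"
    using wle_mult_cancel[OF Q, of "int N" S] whom_wle[OF topD(1)[OF Q(1)]] S by simp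
  then obtain c where c: "S = C3 c" using wle_const[of d1 d2 d3 S] d_pos d_le by auto
  have c0: "c \<noteq> 0" using Q(2) S c by (auto simp: C3_simps)
  have "R = C3 (inverse c) * Q" unfolding S c using C3_inverse[OF c0] by (simp add: mult_ac)
  then have h: "whom d (int N) R" using topD(1)[OF Q(1)] by (metis whom_C3_mult)
  have "N \<noteq> 0"
  proof
    assume "N = 0"
    then obtain k where k: "R = C3 k" using wle_const[of d1 d2 d3 R] whom_wle[OF h, of 0] d_pos d_le by auto
    then have "k \<noteq> 0" using R(2) by (auto simp: C3_simps)
    then have "R dvd 1" unfolding k using C3_inverse by (metis dvd_triv_left)
    then have "\<psi> 1 = 0" by (simp add: R(1))
    then show False by (simp add: \<psi>_simps)
  qed
  with h show ?thesis using that by simp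
qed

theorem theorem3:
  fixes f1 f2 f3 R :: "'a::field_char_0 mpoly3"
  assumes "alg_closed_field TYPE('a)"
    and "poly_automorphism3 f1 f2 f3"
    and "deg1 f1 \<le> deg1 f2" and "deg1 f2 \<le> deg1 f3"
    and "{P. subst3 P (top_comp f1) (top_comp f2) (top_comp f3) = 0} = {R * Q | Q. True}"
  shows "\<exists>h. in_x1x2 h \<and> whomog (deg1 f1, deg1 f2, deg1 f3) (deg1 f3) h \<and>
           (\<exists>c F. c \<noteq> 0 \<and> normal_form (deg1 f1, deg1 f2, deg1 f3) (X3 + h) F \<and> R = C3 c * F)"
proof (cases "R = 0")
  case True
  then have "R = C3 1 * 0" "normal_form (deg1 f1, deg1 f2, deg1 f3) (X3 + 0) (0::'a mpoly3)"
    by (simp_all add: normal_form_def)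
  moreover have "in_x1x2 (0::'a mpoly3)" "whomog (deg1 f1, deg1 f2, deg1 f3) (deg1 f3) (0::'a mpoly3)"
    by (simp_all add: in_x1x2_def whomog_def)
  ultimately show ?thesis by (metis one_neq_zero)
next
  case False
  obtain g1 g2 g3 where
    gf: "ev C3 g1 f1 f2 f3 = X1" "ev C3 g2 f1 f2 f3 = X2" "ev C3 g3 f1 f2 f3 = X3" and
    fg: "ev C3 f1 g1 g2 g3 = X1" "ev C3 f2 g1 g2 g3 = X2" "ev C3 f3 g1 g2 g3 = X3"
    using assms(2) unfolding poly_automorphism3_def subst3_eq_ev by blast
  have f0: "f1 \<noteq> 0" "f2 \<noteq> 0" "f3 \<noteq> 0"
    using fg X_nonzero[where 'a = 'a] by (metis ev_zero)+
  have "deg1 f1 \<noteq> 0"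
  proof
    assume "deg1 f1 = 0"
    then have "wle (1,1,1) 0 f1" using topD(3)[OF top_top_comp(1)[OF f0(1)]] by simp
    then obtain c where "f1 = C3 c" using wle_const[of 1 1 1 f1] by auto
    then have "C3 c = (X1 :: 'a mpoly3)" using fg(1) by (simp add: rhom_C3)
    then have "wle (1,1,1) 0 (X1 :: 'a mpoly3)" by (metis wset_C3 atMost_iff order_refl)
    then show False by (simp add: wset_X)
  qed
  then have "1 \<le> deg1 f1" by simp
  then interpret automorphism3 f1 f2 f3 g1 g2 g3 "top_comp f1" "top_comp f2" "top_comp f3" "deg1 f1" "deg1 f2" "deg1 f3"
    by unfold_locales (use gf fg f0 assms(3,4) in \<open>simp_all add: top_top_comp del: One_nat_def\<close>)
  have \<psi>: "\<psi> P = 0 \<longleftrightarrow> R dvd P" for P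
    using assms(5) unfolding \<psi>_def subst3_eq_ev by (auto simp: set_eq_iff dvd_def)
  obtain N where "whom (deg1 f1, deg1 f2, deg1 f3) (int N) R" "1 \<le> N"
    using relation_homogeneous[OF \<psi> False] .
  then interpret principal_relation f1 f2 f3 g1 g2 g3 "top_comp f1" "top_comp f2" "top_comp f3" "deg1 f1" "deg1 f2" "deg1 f3" R N
    by unfold_locales (use \<psi> False in auto)
  show ?thesis using classification[OF assms(1)] by (simp add: whomog_iff)
qed

end
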